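(* Let $n\ge1$. There is a constant $C(n)$ depending only on $n$ such that the following holds. Let, for every prime power $p^v$, a subset $A_{p^v}\subset(\mathbf{Z}/p^v\mathbf{Z})^n$ be given (possibly empty, no relation required between different powers of the same prime). Suppose there are constants $\alpha>0$, $x_0\ge2$ with $\sum_{p\le y,\ \rho(p)\ge1}\log p\ge\alpha y$ for all $y\ge x_0$. Then for all $x$ sufficiently large in terms of $\alpha$ and $x_0$, $$\frac{1}{|\mathcal{Q}(x)|}\sum_{q\in\mathcal{Q}(x)}\operatorname{disc}(\Delta_q)\le\frac{C(n)}{\alpha}\exp\Big(-\frac13\sum_{\substack{p\le x\\ \rho(p)\ge1}}\Big(1-\frac{\lambda(p)}{\rho(p)}\Big)\frac1p\Big).$$
   Context: For $q\ge1$, $A_q\subset(\mathbf{Z}/q\mathbf{Z})^n$ is the set of $x\bmod q$ with $x\bmod p^v\in A_{p^v}$ for every prime power $p^v$ exactly dividing $q$; $\rho(q)=|A_q|$ (multiplicative, $\rho(1)=1$). $\mathcal{Q}=\{q\ge1:\rho(q)\ge1\}$, $\mathcal{Q}(x)=\{q\in\mathcal{Q}:q\le x\}$. For a prime $p$ with $\rho(p)\ge1$, $\lambda(p)=\max_H|H\cap A_p|$, the maximum over affine hyperplanes $H=\{x\in(\mathbf{Z}/p\mathbf{Z})^n: h_1x_1+\dots+h_nx_n=a\}$ with $a\in\mathbf{Z}/p\mathbf{Z}$ and $(h_i)\ne 0$. For $q\in\mathcal{Q}$, $\Delta_q=\frac1{\rho(q)}\sum_{a\in A_q}\delta_{\{a/q\}}$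 on $(\mathbf{R}/\mathbf{Z})^n$, with $\{a/q\}$ the vector of fractional parts of the coordinates. $\operatorname{disc}(\Delta_q)=\sup_B|\Delta_q(B)-\operatorname{vol}(B)|$, over all boxes $B$ of $(\mathbf{R}/\mathbf{Z})^n$ (projections mod $\mathbf{Z}^n$ of products of closed intervals of $\mathbf{R}$ with all side lengths $\le1$), $\operatorname{vol}$ the Lebesgue measure. *)

theory Defs
  imports "HOL-Analysis.Analysis" "HOL-Number_Theory.Number_Theory"
begin

text \<open>
  The group \<open>(Z/qZ)^n\<close> is represented by its vectors of least non-negative residues, the index
  type \<open>'n\<close> playing the role of \<open>{1, ..., n}\<close>.
\<close>

definition zmod_vecs :: "nat \<Rightarrow> (int ^ 'n) set" where
  "zmod_vecs q = {x. \<forall>i. 0 \<le> x $ i \<and> x $ i < int q}"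

definition reduce_mod :: "nat \<Rightarrow> int ^ 'n \<Rightarrow> int ^ 'n" where
  "reduce_mod q x = (\<chi> i. x $ i mod int q)"

text \<open>
  A family \<open>A\<close> is a function of the modulus; only its values at the prime powers
  \<open>p ^ v\<close> with \<open>v \<ge> 1\<close> are used.
\<close>

definition prime_power_family :: "(nat \<Rightarrow> (int ^ 'n) set) \<Rightarrow> bool" where
  "prime_power_family A \<longleftrightarrow>
     (\<forall>p v. prime p \<and> v \<ge> 1 \<longrightarrow> A (p ^ v) \<subseteq> zmod_vecs (p ^ v))"

definition crt_set :: "(nat \<Rightarrow> (int ^ 'n) set) \<Rightarrow> nat \<Rightarrow> (int ^ 'n) set" where
  "crt_set A q =
     {x \<in> zmod_vecs q. \<forall>p \<in> prime_factors q.
        reduce_mod (p ^ multiplicity p q) x \<in> A (p ^ multiplicity p q)}"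

definition rho :: "(nat \<Rightarrow> (int ^ 'n) set) \<Rightarrow> nat \<Rightarrow> nat" where
  "rho A q = card (crt_set A q)"

definition moduli :: "(nat \<Rightarrow> (int ^ 'n) set) \<Rightarrow> nat set" where
  "moduli A = {q. q \<ge> 1 \<and> rho A q \<ge> 1}"

definition moduli_upto :: "(nat \<Rightarrow> (int ^ 'n) set) \<Rightarrow> real \<Rightarrow> nat set" where
  "moduli_upto A x = {q \<in> moduli A. real q \<le> x}"

definition admissible_primes :: "(nat \<Rightarrow> (int ^ 'n) set) \<Rightarrow> real \<Rightarrow> nat set" where
  "admissible_primes A y = {p. prime p \<and> real p \<le> y \<and> rho A p \<ge> 1}"

definition affine_hyperplanes :: "nat \<Rightarrow> (int ^ 'n) set set" where
  "affine_hyperplanes p =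
     {{x \<in> zmod_vecs p. [(\<Sum>i\<in>UNIV. h $ i * x $ i) = a] (mod int p)} | h a.
        h \<in> zmod_vecs p \<and> h \<noteq> 0 \<and> a \<in> {0..<int p}}"

definition max_hyperplane :: "(nat \<Rightarrow> (int ^ 'n) set) \<Rightarrow> nat \<Rightarrow> nat" where
  "max_hyperplane A p = Max ((\<lambda>H. card (H \<inter> crt_set A p)) ` affine_hyperplanes p)"

text \<open>
  The torus \<open>(R/Z)^n\<close> is represented by the fundamental domain \<open>[0,1)^n\<close>; the projection from
  \<open>R^n\<close> takes fractional parts coordinatewise and the invariant measure is the restriction of
  Lebesgue measure.
\<close>

definition torus_proj :: "real ^ 'n \<Rightarrow> real ^ 'n" where
  "torus_proj x = (\<chi> i. frac (x $ i))"

definition torus_boxes :: "(real ^ 'n) set set" where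
  "torus_boxes = {torus_proj ` cbox a b | a b. \<forall>i. a $ i \<le> b $ i \<and> b $ i - a $ i \<le> 1}"

definition frac_point :: "nat \<Rightarrow> int ^ 'n \<Rightarrow> real ^ 'n" where
  "frac_point q a = torus_proj (\<chi> i. real_of_int (a $ i) / real q)"

text \<open>The measure \<open>\<Delta>\<^sub>q\<close> as a set function; \<open>indicator B z\<close> is the mass \<open>\<delta>\<^sub>z(B)\<close>.\<close>

definition Delta :: "(nat \<Rightarrow> (int ^ 'n) set) \<Rightarrow> nat \<Rightarrow> (real ^ 'n) set \<Rightarrow> real" where
  "Delta A q B = (1 / real (rho A q)) * (\<Sum>a\<in>crt_set A q. indicator B (frac_point q a))"

definition disc :: "((real ^ 'n) set \<Rightarrow> real) \<Rightarrow> real" where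
  "disc \<mu> = (SUP B\<in>torus_boxes. \<bar>\<mu> B - measure lborel B\<bar>)"

end

theory Submission
  imports Defs "HOL-Computational_Algebra.Squarefree" "HOL-Real_Asymp.Real_Asymp"
begin

text \<open>
  Write \<open>q = r s\<close> with \<open>r\<close> the part of \<open>q\<close> composed of primes up to \<open>z = x powr (1/K)\<close>. By the Chinese
  remainder theorem \<open>\<Delta>\<^sub>q\<close> is an average of translates of the image of \<open>\<Delta>\<^sub>r\<close> under multiplication by
  the inverse \<open>c\<close> of \<open>s\<close> modulo \<open>r\<close>, hence its discrepancy is at most that of this image. For
  \<open>r \<le> x powr (1/4)\<close> Selberg's sieve bounds the number of \<open>s\<close> belonging to a given \<open>c\<close>, so
  that up to constants one averages over all \<open>c\<close> modulo \<open>r\<close>. Finite Fourier analysis then reduces the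
  discrepancy to the exponential sums over \<open>A\<^sub>r\<close> at nonzero frequencies \<open>c h\<close>. Their mean square over
  \<open>c\<close> counts pairs in \<open>A\<^sub>r\<close> that agree modulo \<open>r\<close> under a linear form, which gains a factor
  \<open>\<lambda>(p)/\<rho>(p)\<close> for every prime \<open>p\<close> exactly dividing \<open>r\<close> and exceeding all coordinates of \<open>h\<close>. The moduli
  with \<open>r > x powr (1/4)\<close> are rare by Rankin's trick, and \<open>|Q(x)|\<close> is bounded below by an elementary
  argument from the density hypothesis.

  With \<open>S\<close> the sum in the exponent of the theorem, smoothing at scale \<open>exp (- S/2)\<close> and \<open>K\<close> of size
  \<open>1 + S\<close> cost only powers of \<open>1 + S\<close>, while Cauchy-Schwarz leaves the saving \<open>exp (- S/2)\<close>; together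
  this is at most a constant times \<open>exp (- S/3)\<close>.
\<close>

section \<open>Chebyshev and Mertens bounds\<close>

text \<open>Both the sum of discrepancies and the number of moduli are measured against x / ln x
  times exp E, where E (\<open>sum_inv A x\<close>) sums 1/p over the admissible primes; exp E
  cancels in the quotient. As S is at most E, which is O(ln ln x), the whole saving is at most a
  power of ln x: a lost power of ln x would be fatal, lost powers of 1 + S are harmless. This fixes
  K: the sieve yields 1 / ln z = K / ln x, Rankin's trick yields exp (- K/4), so K linear in S costs
  1 + S and gains enough. A sieve, which gives upper bounds only, suffices because what is averaged
  over c is a nonnegative majorant of the discrepancy. Different powers of a prime being unrelated,
  exponents v \<ge> 2 give no gain, but they only contribute convergent products. Primes that may
  divide a frequency give none either; they lie below the cutoff exp S and cost a factor O((1 +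
  S)^3). The saving is exp (- S/2) instead of exp (- S) because Cauchy-Schwarz produces the root of
  g = \<lambda>(p)/\<rho>(p), and the root of g is at most 1 - (1 - g)/2.\<close>

definition primes_le :: "real \<Rightarrow> nat set" where
  "primes_le y = {p. prime p \<and> real p \<le> y}"

lemma finite_primes_le [simp]: "finite (primes_le y)"
proof (rule finite_subset)
  show "primes_le y \<subseteq> {..nat \<lfloor>y\<rfloor>}"
    by (auto simp: primes_le_def le_nat_iff le_floor_iff)
qed simp

lemma primes_le_floor: "y \<ge> 0 \<Longrightarrow> primes_le y = primes_le (real (nat \<lfloor>y\<rfloor>))"
proof -
  assume y: "y \<ge> 0"
  have "real p \<le> y \<longleftrightarrow> real p \<le> real (nat \<lfloor>y\<rfloor>)" for p
    using y by (metis le_nat_floor of_nat_floor of_nat_le_iff order_trans)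
  then show ?thesis by (simp add: primes_le_def)
qed

lemma primes_le_mono: "x \<le> y \<Longrightarrow> primes_le x \<subseteq> primes_le y"
  by (auto simp: primes_le_def)

lemma primes_leD: "p \<in> primes_le y \<Longrightarrow> prime p" "p \<in> primes_le y \<Longrightarrow> real p \<le> y"
  "p \<in> primes_le y \<Longrightarrow> real p \<ge> 2"
  using prime_ge_2_nat[of p] by (auto simp: primes_le_def)

lemma prod_dvd_of_coprime:
  fixes f :: "'b \<Rightarrow> nat"
  assumes "finite A" "\<And>a. a \<in> A \<Longrightarrow> f a dvd n"
    "\<And>a b. a \<in> A \<Longrightarrow> b \<in> A \<Longrightarrow> a \<noteq> b \<Longrightarrow> coprime (f a) (f b)"
  shows "prod f A dvd n"
  using assms
proof (induction A rule: finite_induct)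
  case (insert a A)
  have "coprime (f a) (prod f A)"
    using insert.prems(2) insert.hyps by (intro prod_coprime_right) auto
  then show ?case using insert by (auto intro!: divides_mult)
qed auto

lemma prime_pow_dvd_fact:
  fixes p :: nat assumes "p \<ge> 1" shows "p ^ k dvd (fact (p * k) :: nat)"
proof (induction k)
  case (Suc k)
  obtain m where m: "p * Suc k = Suc m"
    using assms by (metis Suc_pred' mult_is_0 not_one_le_zero neq0_conv old.nat.distinct(1))
  have "p * k \<le> m" using m assms by simp
  then have "(fact (p*k) :: nat) dvd fact m" by (rule fact_dvd)
  then have a: "p ^ k dvd (fact m :: nat)" using Suc by (rule dvd_trans[rotated])
  have "p dvd Suc m" using m by (metis dvd_triv_left)
  then have "p ^ Suc k dvd Suc m * (fact m :: nat)" using a by (simp only: power_Suc mult_dvd_mono)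
  then show ?case using m by (simp only: fact_Suc of_nat_id)
qed simp

text \<open>The factorial n! contains the multiples p, 2p, ..., (n div p) p, hence p^(n div p)
  divides it; these powers are coprime for distinct p, so their product divides n! as well.\<close>

lemma sum_ln_primes_div:
  fixes n :: nat
  shows "(\<Sum>p\<in>primes_le n. real (n div p) * ln (real p)) \<le> ln (fact n)"
proof -
  let ?P = "primes_le n"
  have dvd: "(\<Prod>p\<in>?P. p ^ (n div p)) dvd (fact n :: nat)"
  proof (rule prod_dvd_of_coprime)
    show "p ^ (n div p) dvd (fact n :: nat)" if "p \<in> ?P" for p
    proof -
      have "p ^ (n div p) dvd (fact (p * (n div p)) :: nat)"
        using primes_leD(3)[OF that] by (intro prime_pow_dvd_fact) auto
      also have "(fact (p * (n div p)) :: nat) dvd fact n" by (intro fact_dvd) simp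
      finally show ?thesis .
    qed
  qed (auto simp: primes_coprime primes_le_def)
  have "(\<Sum>p\<in>?P. real (n div p) * ln (real p)) = ln (\<Prod>p\<in>?P. real p ^ (n div p))"
    by (subst ln_prod) (auto simp: ln_realpow dest: primes_leD(3))
  also have "(\<Prod>p\<in>?P. real p ^ (n div p)) = real (\<Prod>p\<in>?P. p ^ (n div p))" by simp
  also have "ln \<dots> \<le> ln (real (fact n))"
  proof -
    have "(\<Prod>p\<in>?P. p ^ (n div p)) \<le> (fact n :: nat)" using dvd by (rule dvd_imp_le) simp
    moreover have "(\<Prod>p\<in>?P. p ^ (n div p)) > 0"
      by (intro prod_pos) (auto simp: primes_le_def prime_gt_0_nat)
    ultimately show ?thesis by (subst ln_le_cancel_iff) (simp_all only: of_nat_le_iff of_nat_0_less_iff fact_gt_zero)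
  qed
  finally show ?thesis by simp
qed

text \<open>An upper bound of Mertens type from n! \<le> n^n. The constant 2 comes from n / (2p)
  \<le> n div p, valid for p \<le> n.\<close>

lemma sum_ln_over_primes_le:
  assumes "y \<ge> 1"
  shows "(\<Sum>p\<in>primes_le y. ln (real p) / real p) \<le> 2 * ln y"
proof -
  define n where "n = nat \<lfloor>y\<rfloor>"
  have n: "n \<ge> 1" "real n \<le> y" "primes_le y = primes_le n"
    using assms primes_le_floor[of y] by (auto simp: n_def le_nat_iff)
  have "(\<Sum>p\<in>primes_le n. ln (real p) / real p) * (n / 2)
      = (\<Sum>p\<in>primes_le n. (n / (2 * p)) * ln (real p))"
    by (subst sum_distrib_right, rule sum.cong) (auto simp: mult_ac)
  also have "\<dots> \<le> (\<Sum>p\<in>primes_le n. real (n div p) * ln (real p))"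
  proof (intro sum_mono mult_right_mono)
    fix p assume p: "p \<in> primes_le (real n)"
    then have pn: "p \<le> n" "p > 0" using primes_leD(3)[OF p] by (auto simp: primes_le_def)
    have "n < p * (n div p) + p" using pn by (metis add_less_cancel_left div_mult_mod_eq mod_less_divisor mult.commute)
    moreover have "p \<le> p * (n div p)" using pn by (simp add: Suc_le_eq div_greater_zero_iff)
    ultimately have "n \<le> 2 * p * (n div p)" by linarith
    then have "real n \<le> real (2 * p * (n div p))" by (simp only: of_nat_le_iff)
    then show "n / (2 * p) \<le> real (n div p)" using pn by (simp add: divide_simps mult_ac)
  qed (use primes_leD(3) in force)
  also have "\<dots> \<le> ln (fact n)" by (rule sum_ln_primes_div)
  also have "\<dots> \<le> ln (real (n ^ n))"
    using fact_le_power[of n, where 'a = real] n by (subst ln_le_cancel_iff) auto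
  also have "\<dots> = n * ln n" using n by (simp add: ln_realpow)
  finally have "(\<Sum>p\<in>primes_le n. ln (real p) / real p) \<le> 2 * ln n"
    using n by (simp add: field_simps)
  also have "\<dots> \<le> 2 * ln y" using n by simp
  finally show ?thesis using n by simp
qed

text \<open>Chebyshev's argument by halving: the primes in (m, 2m] divide the central binomial
  coefficient, which is at most 4^m.\<close>

lemma theta_nat_le: "(\<Sum>p\<in>primes_le (real n). ln (real p)) \<le> 4 * real n"
proof (induction n rule: less_induct)
  case (less n)
  show ?case
  proof (cases "n \<ge> 2")
    case False
    then have "primes_le (real n) = {}" by (auto simp: primes_le_def dest: prime_ge_2_nat)
    then show ?thesis by simp
  next
    case True
    define m where "m = n div 2"
    have m: "m \<ge> 1" "m < n" "n \<le> 2*m+1" "2*m \<le> n" using True by (auto simp: m_def)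
    define Q where "Q = {p. prime p \<and> m < p \<and> p \<le> 2*m}"
    have [simp]: "finite Q" by (rule finite_subset[of _ "{..2*m}"]) (auto simp: Q_def)
    have "\<Prod>Q dvd ((2*m) choose m)"
    proof (rule prod_dvd_of_coprime)
      fix p assume p: "p \<in> Q"
      then have pp: "prime p" "m < p" "p \<le> 2*m" by (auto simp: Q_def)
      have "p dvd (fact (2*m) :: nat)" using pp prime_dvd_fact_iff by blast
      also have "fact (2*m) = fact m * (fact m * ((2*m) choose m))"
        using binomial_fact_lemma[of m "2*m"] by (simp add: mult_ac)
      finally have "p dvd fact m \<or> p dvd fact m \<or> p dvd ((2*m) choose m)"
        using pp by (metis prime_dvd_mult_iff)
      then show "p dvd ((2*m) choose m)" using pp prime_dvd_fact_iff by (metis not_le)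
    qed (auto simp: primes_coprime Q_def)
    moreover have "((2*m) choose m) > 0" by (simp add: zero_less_binomial_iff)
    ultimately have "\<Prod>Q \<le> ((2*m) choose m)" by (rule dvd_imp_le)
    also have "\<dots> \<le> 2 ^ (2*m)" by (rule binomial_le_pow2)
    finally have le: "\<Prod>Q \<le> 2 ^ (2*m)" .
    have "(\<Sum>p\<in>Q. ln (real p)) = ln (\<Prod>p\<in>Q. real p)"
      by (subst ln_prod) (auto simp: Q_def prime_gt_0_nat)
    also have "(\<Prod>p\<in>Q. real p) = real (\<Prod>Q)" by simp
    also have "ln \<dots> \<le> ln (real (2 ^ (2*m)))"
    proof (subst ln_le_cancel_iff)
      show "0 < real (\<Prod>Q)" by (auto intro!: prod_pos simp: Q_def prime_gt_0_nat)
      show "real (\<Prod>Q) \<le> real (2^(2*m))" using le by (simp only: of_nat_le_iff)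
    qed simp
    also have "\<dots> = 2 * m * ln 2" by (simp add: ln_realpow)
    also have "\<dots> \<le> 2 * m" using ln_2_less_1 mult_left_mono[of "ln 2" 1 "real m"] by simp
    finally have Q: "(\<Sum>p\<in>Q. ln (real p)) \<le> 2 * m" by simp
    \<comment> \<open>For odd n = 2m + 1 the number n itself lies outside the first two
      sets.\<close>
    have sub: "primes_le (real n) \<subseteq> primes_le (real m) \<union> Q \<union> {n}"
      using m by (auto simp: primes_le_def Q_def)
    have nn: "ln (real p) \<ge> 0" if "p \<in> primes_le (real m) \<union> Q \<union> {n}" for p
      using that m by (auto simp: Q_def primes_le_def prime_gt_0_nat Suc_le_eq)
    have "(\<Sum>p\<in>primes_le (real n). ln (real p)) \<le> (\<Sum>p\<in>primes_le (real m) \<union> Q \<union> {n}. ln (real p))"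
      using sub nn by (intro sum_mono2) auto
    also have "\<dots> \<le> (\<Sum>p\<in>primes_le (real m). ln (real p)) + (\<Sum>p\<in>Q. ln (real p)) + ln (real n)"
    proof -
      have u: "sum (\<lambda>p. ln (real p)) (A \<union> B) \<le> sum (\<lambda>p. ln (real p)) A + sum (\<lambda>p. ln (real p)) B"
        if "finite A" "finite B" "A \<union> B \<subseteq> primes_le (real m) \<union> Q \<union> {n}" for A B :: "nat set"
      proof -
        have "sum (\<lambda>p. ln (real p)) (A \<inter> B) \<ge> 0" using that nn by (intro sum_nonneg) auto
        then show ?thesis using that by (subst sum_Un) auto
      qed
      have sub: "primes_le (real m) \<union> Q \<subseteq> primes_le (real m) \<union> Q \<union> {n}" by blast
      show ?thesis
        using u[of "primes_le (real m) \<union> Q" "{n}"] u[of "primes_le (real m)" Q, OF _ _ sub] by simp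
    qed
    also have "\<dots> \<le> 4 * m + 2 * m + (n - 1)"
      using less.IH[OF m(2)] Q ln_le_minus_one[of "real n"] True by (simp add: of_nat_diff)
    also have "\<dots> \<le> 4 * real n" using m by (simp add: of_nat_diff)
    finally show ?thesis .
  qed
qed

lemma theta_le:
  assumes "y \<ge> 0" shows "(\<Sum>p\<in>primes_le y. ln (real p)) \<le> 4 * y"
  using theta_nat_le[of "nat \<lfloor>y\<rfloor>"] primes_le_floor[OF assms] assms
  by (smt (verit) floor_of_nat of_int_floor_le of_nat_0_le_iff of_nat_nat zero_le_floor)

text \<open>On the primes in (u, u^2] one has 1/p \<le> (ln p / p) / ln u, and
  \<open>sum_ln_over_primes_le\<close> at u^2 bounds the sum by 2 ln (u^2) / ln u = 4. Thus every
  squaring of the endpoint costs 4.\<close>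

lemma sum_inverse_primes_block:
  assumes "y > 1"
  shows "(\<Sum>p\<in>primes_le (y ^ 2 ^ k) - primes_le y. 1 / real p) \<le> 4 * real k"
proof (induction k)
  case (Suc k)
  define u where "u = y ^ 2 ^ k"
  have u: "u > 1" using assms by (simp add: u_def one_less_power)
  have u2: "y ^ 2 ^ Suc k = u ^ 2" by (simp add: u_def power_mult [symmetric] mult.commute)
  have "u \<le> u ^ 2" using u by (simp add: power2_eq_square)
  have "y \<le> u" using assms by (simp add: u_def self_le_power)
  have "(\<Sum>p\<in>primes_le (u^2) - primes_le u. 1 / real p)
      \<le> (\<Sum>p\<in>primes_le (u^2) - primes_le u. (ln (real p) / real p) / ln u)"
  proof (intro sum_mono)
    fix p assume p: "p \<in> primes_le (u^2) - primes_le u"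
    then have "p > u" "p > 0" by (auto simp: primes_le_def prime_gt_0_nat)
    then have "ln p \<ge> ln u" "ln u > 0" using u by auto
    then show "1 / real p \<le> (ln (real p) / real p) / ln u" using \<open>p > 0\<close> by (simp add: field_simps)
  qed
  also have "\<dots> \<le> (\<Sum>p\<in>primes_le (u^2). (ln (real p) / real p) / ln u)"
    using u by (intro sum_mono2) (auto dest!: primes_leD(3))
  also have "\<dots> = (\<Sum>p\<in>primes_le (u^2). ln (real p) / real p) / ln u" by (simp add: sum_divide_distrib)
  also have "\<dots> \<le> (2 * ln (u^2)) / ln u"
    using u sum_ln_over_primes_le[of "u^2"] by (intro divide_right_mono) auto
  also have "\<dots> = 4" using u by (simp add: ln_realpow)
  finally have b: "(\<Sum>p\<in>primes_le (u^2) - primes_le u. 1 / real p) \<le> 4" .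
  have "primes_le (u^2) - primes_le y = (primes_le u - primes_le y) \<union> (primes_le (u^2) - primes_le u)"
    using primes_le_mono[OF \<open>u \<le> u ^ 2\<close>] primes_le_mono[OF \<open>y \<le> u\<close>] by auto
  then have "(\<Sum>p\<in>primes_le (u^2) - primes_le y. 1 / real p) =
     (\<Sum>p\<in>primes_le u - primes_le y. 1 / real p) + (\<Sum>p\<in>primes_le (u^2) - primes_le u. 1 / real p)"
    by (simp, subst sum.union_disjoint) auto
  then show ?case using b Suc u2 by (simp add: u_def)
qed simp

text \<open>The exponent 6 is an upper bound for \<open>4 / ln 2\<close>.\<close>

lemma exp_sum_inverse_primes_le:
  assumes "1 < y" "y \<le> x"
  shows "exp (\<Sum>p\<in>primes_le x - primes_le y. 1 / real p) \<le> exp 4 * (ln x / ln y) ^ 6"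
proof -
  define t where "t = log 2 (ln x / ln y)"
  define k where "k = nat \<lceil>t\<rceil>"
  have r: "ln x / ln y \<ge> 1" using assms by simp
  then have t: "t \<ge> 0" by (simp add: t_def)
  have k: "t \<le> real k" "real k \<le> t + 1" using t by (auto simp: k_def)
  have p: "ln x / ln y = 2 powr t" using r by (simp add: t_def)
  have "ln x = ln y * 2 powr t" using p assms by (simp add: field_simps)
  also have "\<dots> \<le> ln y * 2 powr real k" using k assms by (intro mult_left_mono) auto
  also have "\<dots> = ln (y ^ 2 ^ k)" using assms by (simp add: ln_realpow powr_realpow)
  finally have "x \<le> y ^ 2 ^ k" using assms by (subst (asm) ln_le_cancel_iff) auto
  then have "(\<Sum>p\<in>primes_le x - primes_le y. 1 / real p) \<le> (\<Sum>p\<in>primes_le (y ^ 2 ^ k) - primes_le y. 1 / real p)"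
    using primes_le_mono by (intro sum_mono2) auto
  also have "\<dots> \<le> 4 * real k" by (rule sum_inverse_primes_block) (use assms in auto)
  also have "\<dots> \<le> 4 + 4 * t" using k by simp
  also have "4 * t \<le> 6 * ln 2 * t" using ln2_ge_two_thirds t by (intro mult_right_mono) auto
  finally have "(\<Sum>p\<in>primes_le x - primes_le y. 1 / real p) \<le> 4 + 6 * (ln 2 * t)" by simp
  then have "exp (\<Sum>p\<in>primes_le x - primes_le y. 1 / real p) \<le> exp (4 + 6 * (ln 2 * t))" by simp
  also have "\<dots> = exp 4 * exp (ln 2 * t) ^ 6" by (simp add: exp_add flip: exp_of_nat_mult)
  also have "exp (ln 2 * t) = ln x / ln y" using p by (simp add: powr_def mult.commute)
  finally show ?thesis .
qed

section \<open>Sums of multiplicative functions\<close>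

text \<open>Multiplicative functions are encoded by their values at prime powers, so that products,
  square roots and indicator functions can be formed prime by prime.\<close>

definition mfun :: "(nat \<Rightarrow> nat \<Rightarrow> real) \<Rightarrow> nat \<Rightarrow> real" where
  "mfun F q = (\<Prod>p\<in>prime_factors q. F p (multiplicity p q))"

lemma mfun_1 [simp]: "mfun F 1 = 1" "mfun F (Suc 0) = 1"
  by (simp_all add: mfun_def)

lemma mfun_nonneg: "(\<And>p v. F p v \<ge> 0) \<Longrightarrow> mfun F q \<ge> 0"
  by (simp add: mfun_def prod_nonneg)

lemma coprime_multiplicity_mult:
  fixes a b p :: nat
  assumes "coprime a b" "a > 0" "b > 0" "p \<in> prime_factors a"
  shows "multiplicity p (a * b) = multiplicity p a"
proof -
  have "prime p" "p dvd a" using assms by (auto simp: prime_factors_dvd)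
  then have "\<not> p dvd b" using assms(1) by (metis coprime_common_divisor not_prime_unit)
  then show ?thesis using assms \<open>prime p\<close>
    by (simp add: prime_elem_multiplicity_mult_distrib not_dvd_imp_multiplicity_0)
qed

lemma coprime_prime_factors_disjoint:
  fixes a b :: nat
  assumes "coprime a b"
  shows "prime_factors a \<inter> prime_factors b = {}"
proof -
  have False if "prime p" "p dvd a" "p dvd b" for p
    using coprime_common_divisor_nat[OF assms that(2,3)] that(1) by auto
  then show ?thesis by (auto simp: prime_factors_dvd)
qed

lemma mfun_mult:
  assumes "coprime a b" "a > 0" "b > 0"
  shows "mfun F (a * b) = mfun F a * mfun F b"
proof -
  have "prime_factors (a * b) = prime_factors a \<union> prime_factors b"
    using assms by (simp add: prime_factors_product)
  then have "mfun F (a * b) = (\<Prod>p\<in>prime_factors a. F p (multiplicity p (a*b)))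
      * (\<Prod>p\<in>prime_factors b. F p (multiplicity p (a*b)))"
    using coprime_prime_factors_disjoint[OF assms(1)] by (simp add: mfun_def prod.union_disjoint)
  also have "(\<Prod>p\<in>prime_factors a. F p (multiplicity p (a*b))) = mfun F a"
    unfolding mfun_def using coprime_multiplicity_mult[OF assms] by (intro prod.cong) auto
  also have "(\<Prod>p\<in>prime_factors b. F p (multiplicity p (a*b))) = mfun F b"
    unfolding mfun_def using coprime_multiplicity_mult[of b a] assms
    by (intro prod.cong) (auto simp: coprime_commute mult.commute)
  finally show ?thesis .
qed

lemma mfun_prime_power: "prime p \<Longrightarrow> v \<ge> 1 \<Longrightarrow> mfun F (p ^ v) = F p v"
  by (simp add: mfun_def prime_factors_power prime_prime_factors)

text \<open>Serves to peel a single prime off r. The case distinction covers v = 0, where m is r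
  itself and no Euler factor appears.\<close>

lemma split_prime_power:
  fixes p r :: nat
  assumes "prime p" "r > 0"
  obtains v m where "v = multiplicity p r" "r = p ^ v * m" "m > 0" "m \<le> r" "coprime (p ^ v) m"
    "\<not> p dvd m" "prime_factors m = prime_factors r - {p}"
    "mfun F r = (if p dvd r then F p v else 1) * mfun F m"
proof -
  define v where "v = multiplicity p r"
  have u: "\<not> is_unit p" "r \<noteq> 0" using assms by (auto dest: not_prime_unit)
  obtain m where m: "r = p ^ v * m" "\<not> p dvd m"
    unfolding v_def using multiplicity_decompose'[of r p] u by blast
  have m0: "m > 0" using m assms by (intro gr0I) simp
  have p0: "p > 0" using assms by (simp add: prime_gt_0_nat)
  then have "m \<le> r" using m by simp
  have c: "coprime (p ^ v) m" using m assms by (simp add: prime_imp_coprime)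
  have pf: "prime_factors r = prime_factors (p ^ v) \<union> prime_factors m"
    unfolding m(1) using m0 p0 by (intro prime_factors_product) auto
  have pf2: "prime_factors (p ^ v) \<subseteq> {p}" using assms(1)
    by (cases "v = 0") (simp_all add: prime_factors_power prime_prime_factors)
  have "p \<notin> prime_factors m" using m by (auto simp: prime_factors_dvd)
  then have pf3: "prime_factors m = prime_factors r - {p}" using pf pf2 by auto
  have "mfun F r = mfun F (p ^ v) * mfun F m"
    unfolding m(1) using mfun_mult[OF c _ m0] p0 by simp
  moreover have "mfun F (p ^ v) = (if p dvd r then F p v else 1)"
  proof (cases "p dvd r")
    case True
    then have "v \<ge> 1"
      using assms by (simp add: v_def Suc_le_eq prime_multiplicity_gt_zero_iff)
    then show ?thesis using True mfun_prime_power[OF assms(1)] by simp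
  qed (simp add: v_def not_dvd_imp_multiplicity_0)
  ultimately have "mfun F r = (if p dvd r then F p v else 1) * mfun F m" by simp
  then show thesis by (rule that[OF v_def m(1) m0 \<open>m \<le> r\<close> c m(2) pf3])
qed

lemma multiplicity_less_self: 
  fixes p r :: nat
  assumes "prime p" "r > 0" shows "multiplicity p r < r"
proof -
  have "p ^ multiplicity p r \<le> r" using assms multiplicity_dvd by (metis dvd_imp_le)
  moreover have "multiplicity p r < 2 ^ multiplicity p r" by (rule less_exp)
  moreover have "2 ^ multiplicity p r \<le> p ^ multiplicity p r"
    using assms prime_ge_2_nat by (intro power_mono) auto
  ultimately show ?thesis by linarith
qed

text \<open>The expanded Euler product contains every r by unique factorization. Cutting each factor
  at exponent N is harmless since the exponents in r stay below r \<le> N.\<close>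

lemma sum_mfun_le:
  assumes "finite P" "\<And>p. p \<in> P \<Longrightarrow> prime p" "\<And>p v. F p v \<ge> 0"
  shows "(\<Sum>r | r \<in> {1..N} \<and> prime_factors r \<subseteq> P. mfun F r) \<le> (\<Prod>p\<in>P. 1 + (\<Sum>v=1..N. F p v))"
  using assms(1,2)
proof (induction P rule: finite_induct)
  case empty
  have "{r. r \<in> {1..N} \<and> prime_factors r \<subseteq> {}} \<subseteq> {1}" by (auto simp: prime_factorization_empty_iff)
  then have "(\<Sum>r | r \<in> {1..N} \<and> prime_factors r \<subseteq> {}. mfun F r) \<le> (\<Sum>r\<in>{1}. mfun F r)"
    by (intro sum_mono2) auto
  then show ?case by simp
next
  case (insert p P)
  let ?A = "\<lambda>P. {r. r \<in> {1..N} \<and> prime_factors r \<subseteq> P}"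
  let ?F = "\<lambda>v. if v = 0 then 1 else F p v"
  have p: "prime p" using insert.prems by auto
  have "(\<Sum>r\<in>?A (insert p P). mfun F r) \<le> (\<Sum>(v,m)\<in>{0..N} \<times> ?A P. ?F v * mfun F m)"
  proof (rule sum_le_included[where i = "\<lambda>(v,m). p ^ v * m"])
    show "\<forall>r\<in>?A (insert p P). \<exists>y\<in>{0..N} \<times> ?A P. (case y of (v, m) \<Rightarrow> p ^ v * m) = r \<and>
        mfun F r \<le> (case y of (v, m) \<Rightarrow> ?F v * mfun F m)"
    proof
      fix r assume r: "r \<in> ?A (insert p P)"
      then have r0: "r > 0" by auto
      obtain v m where m: "v = multiplicity p r" "r = p ^ v * m" "m > 0" "m \<le> r"
        "coprime (p ^ v) m" "\<not> p dvd m" "prime_factors m = prime_factors r - {p}"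
        "mfun F r = (if p dvd r then F p v else 1) * mfun F m"
        by (rule split_prime_power[OF p r0, where F = F])
      have "v < r" unfolding m(1) using p r0 by (rule multiplicity_less_self)
      moreover have "(if p dvd r then F p v else 1) = ?F v"
        unfolding m(1) using p r0 prime_multiplicity_gt_zero_iff[of p r] by auto
      ultimately show "\<exists>y\<in>{0..N} \<times> ?A P. (case y of (v, m) \<Rightarrow> p ^ v * m) = r \<and>
        mfun F r \<le> (case y of (v, m) \<Rightarrow> ?F v * mfun F m)"
        using m(3-) m(2)[symmetric] r by (intro bexI[of _ "(v, m)"]) auto
    qed
  qed (auto intro!: mult_nonneg_nonneg mfun_nonneg assms(3))
  also have "\<dots> = (\<Sum>v\<in>{0..N}. ?F v) * (\<Sum>m\<in>?A P. mfun F m)"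
    by (simp add: sum_product sum.cartesian_product)
  also have "(\<Sum>v\<in>{0..N}. ?F v) = 1 + (\<Sum>v=1..N. F p v)"
    by (subst sum.atLeast_Suc_atMost) auto
  also have "(1 + (\<Sum>v=1..N. F p v)) * (\<Sum>m\<in>?A P. mfun F m) \<le>
     (1 + (\<Sum>v=1..N. F p v)) * (\<Prod>p\<in>P. 1 + (\<Sum>v=1..N. F p v))"
    using insert by (intro mult_left_mono insert.IH add_nonneg_nonneg sum_nonneg assms(3)) auto
  finally show ?case using insert by simp
qed

text \<open>The value of the zeta function at 5/4. The exponent arises from prime squares weighted
  by p^(-3/2), with a factor p^(1/4) given up to absorb ln p; being above 1 it keeps all
  contributions of higher prime powers bounded.\<close>

definition zeta_const :: real where
  "zeta_const = (\<Sum>n. real n powr (-5/4))"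

lemma summable_zeta_const: "summable (\<lambda>n. real n powr (-5/4))"
  by (subst summable_real_powr_iff) simp

lemma zeta_const_nonneg: "zeta_const \<ge> 0"
  unfolding zeta_const_def by (rule suminf_nonneg[OF summable_zeta_const]) simp

lemma sum_le_zeta_const: "finite P \<Longrightarrow> (\<Sum>p\<in>P. real p powr (-5/4)) \<le> zeta_const"
  unfolding zeta_const_def by (rule sum_le_suminf[OF summable_zeta_const]) auto

text \<open>Each Euler factor is bounded through 1 + t \<le> exp t. The term \<open>e p\<close> is
  meant for the first power of p, the term with \<open>a\<close> for everything of lower
  order.\<close>

lemma sum_mfun_le_exp:
  assumes "finite P" "\<And>p. p \<in> P \<Longrightarrow> prime p" "\<And>p v. F p v \<ge> 0" "a \<ge> 0"
    and "\<And>p. p \<in> P \<Longrightarrow> (\<Sum>v=1..N. F p v) \<le> e p + a * real p powr (-5/4)"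
  shows "(\<Sum>r | r \<in> {1..N} \<and> prime_factors r \<subseteq> P. mfun F r) \<le> exp ((\<Sum>p\<in>P. e p) + a * zeta_const)"
proof -
  have "(\<Sum>r | r \<in> {1..N} \<and> prime_factors r \<subseteq> P. mfun F r) \<le> (\<Prod>p\<in>P. 1 + (\<Sum>v=1..N. F p v))"
    using assms by (intro sum_mfun_le) auto
  also have "\<dots> \<le> (\<Prod>p\<in>P. exp (e p + a * real p powr (-5/4)))"
  proof (rule prod_mono)
    fix p assume p: "p \<in> P"
    have "1 + (\<Sum>v=1..N. F p v) \<le> 1 + (e p + a * real p powr (-5/4))" using assms(5)[OF p] by simp
    also have "\<dots> \<le> exp (e p + a * real p powr (-5/4))" by (rule exp_ge_add_one_self)
    finally show "0 \<le> 1 + (\<Sum>v=1..N. F p v) \<and> 1 + (\<Sum>v=1..N. F p v) \<le> exp (e p + a * real p powr (-5/4))"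
      using assms(3) by (simp add: sum_nonneg add_nonneg_nonneg)
  qed
  also have "\<dots> = exp (\<Sum>p\<in>P. e p + a * real p powr (-5/4))" using assms by (simp add: exp_sum)
  also have "(\<Sum>p\<in>P. e p + a * real p powr (-5/4)) = (\<Sum>p\<in>P. e p) + a * (\<Sum>p\<in>P. real p powr (-5/4))"
    by (simp add: sum.distrib sum_distrib_left)
  also have "exp \<dots> \<le> exp ((\<Sum>p\<in>P. e p) + a * zeta_const)"
    using assms sum_le_zeta_const[of P] by (simp add: mult_left_mono)
  finally show ?thesis .
qed

section \<open>Sums of multiplicative functions weighted by ln q\<close>

definition prime_powers_le :: "real \<Rightarrow> (nat \<times> nat) set" where
  "prime_powers_le y = {(p, v). prime p \<and> v \<ge> 1 \<and> real (p ^ v) \<le> y}"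

lemma finite_prime_powers_le [simp]: "finite (prime_powers_le y)"
proof (rule finite_subset)
  show "prime_powers_le y \<subseteq> {..nat \<lfloor>y\<rfloor>} \<times> {..nat \<lfloor>y\<rfloor>}"
  proof
    fix x assume "x \<in> prime_powers_le y"
    then obtain p v where x: "x = (p, v)" "prime p" "v \<ge> 1" "real (p ^ v) \<le> y"
      by (auto simp: prime_powers_le_def)
    have "p ^ v \<le> nat \<lfloor>y\<rfloor>" using x(4) by (rule le_nat_floor)
    moreover have "p \<le> p ^ v" using x(2,3) prime_gt_0_nat[of p] by (intro self_le_power) auto
    moreover have "v < 2 ^ v" by (rule less_exp)
    moreover have "2 ^ v \<le> p ^ v" using x prime_ge_2_nat by (intro power_mono) auto
    ultimately have "p \<le> nat \<lfloor>y\<rfloor>" "v \<le> nat \<lfloor>y\<rfloor>" by linarith+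
    then show "x \<in> {..nat \<lfloor>y\<rfloor>} \<times> {..nat \<lfloor>y\<rfloor>}" using x by simp
  qed
qed simp

lemma ln_eq_sum_prime_factors:
  fixes q :: nat assumes "q > 0"
  shows "ln (real q) = (\<Sum>p\<in>prime_factors q. real (multiplicity p q) * ln (real p))"
proof -
  have "real q = (\<Prod>p\<in>prime_factors q. real p ^ multiplicity p q)"
    using prime_factorization_nat[OF assms] by (metis (no_types, lifting) of_nat_prod of_nat_power prod.cong)
  also have "ln \<dots> = (\<Sum>p\<in>prime_factors q. ln (real p ^ multiplicity p q))"
    by (rule ln_prod) (auto dest!: in_prime_factors_imp_prime simp: prime_gt_0_nat)
  also have "\<dots> = (\<Sum>p\<in>prime_factors q. real (multiplicity p q) * ln (real p))"
    by (intro sum.cong refl ln_realpow)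
  finally show ?thesis .
qed

text \<open>Write ln q as the sum of v ln p over the prime powers p^v exactly dividing q and put q =
  p^v m. For fixed m the sum over p^v \<le> N/m is of Chebyshev type and contributes C N / m;
  dropping the coprimality of p and m only enlarges the sum.\<close>

lemma sum_mfun_ln_le:
  assumes F: "\<And>p v. F p v \<ge> 0"
    and C: "\<And>y. y \<ge> 1 \<Longrightarrow> (\<Sum>(p,v)\<in>prime_powers_le y. F p v * (real v * ln (real p))) \<le> C * y"
  shows "(\<Sum>q=1..N. mfun F q * ln (real q)) \<le> C * real N * (\<Sum>m=1..N. mfun F m / real m)"
proof -
  let ?g = "\<lambda>(p,v). F p v * (real v * ln (real p))"
  have g0: "?g x \<ge> 0" if "x \<in> prime_powers_le y" for x y
    using that F by (auto simp: prime_powers_le_def intro!: mult_nonneg_nonneg dest: prime_ge_1_nat)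
  have "(\<Sum>q=1..N. mfun F q * ln (real q)) =
      (\<Sum>q=1..N. \<Sum>p\<in>prime_factors q. mfun F q * (real (multiplicity p q) * ln (real p)))"
    by (intro sum.cong) (auto simp: ln_eq_sum_prime_factors sum_distrib_left)
  also have "\<dots> = (\<Sum>(q,p)\<in>(SIGMA q:{1..N}. prime_factors q). mfun F q * (real (multiplicity p q) * ln (real p)))"
    by (subst sum.Sigma) auto
  also have "\<dots> \<le> (\<Sum>(m,x)\<in>(SIGMA m:{1..N}. prime_powers_le (real N / real m)). mfun F m * ?g x)"
  proof (rule sum_le_included[where i = "\<lambda>(m,(p,v)). (p ^ v * m, p)"], goal_cases)
    case 3
    show ?case using mfun_nonneg[of F] F g0 by (auto intro!: mult_nonneg_nonneg simp: prime_powers_le_def dest: prime_ge_1_nat)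
  next
    case 4
    show ?case
    proof (clarify, goal_cases)
      case (1 q p)
      then have qp: "q > 0" "q \<le> N" "prime p" "p dvd q" by (auto simp: prime_factors_dvd)
      obtain v m where v_def: "v = multiplicity p q" and m: "q = p ^ v * m" "m > 0" "m \<le> q"
        "coprime (p ^ v) m" "\<not> p dvd m" "prime_factors m = prime_factors q - {p}"
        "mfun F q = (if p dvd q then F p v else 1) * mfun F m"
        by (rule split_prime_power[OF qp(3,1), where F = F])
      have "v \<ge> 1" using qp unfolding v_def
        by (simp add: Suc_le_eq prime_multiplicity_gt_zero_iff)
      have "real (p ^ v) * real m \<le> real N" using m(1) qp(2) by (simp flip: of_nat_mult of_nat_power)
      then have "real (p ^ v) \<le> real N / real m" using m(2) by (simp add: field_simps)
      then have "(m,(p,v)) \<in> (SIGMA m:{1..N}. prime_powers_le (real N / real m))"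
        using m(3) qp m(2) \<open>v \<ge> 1\<close> by (auto simp: prime_powers_le_def)
      then show ?case using m(1)[symmetric] m(7) qp(4) v_def[symmetric]
        by (intro bexI[of _ "(m,(p,v))"]) simp_all
    qed
  qed (auto intro!: finite_SigmaI)
  also have "\<dots> = (\<Sum>m=1..N. mfun F m * (\<Sum>x\<in>prime_powers_le (real N / real m). ?g x))"
    by (subst sum.Sigma[symmetric]) (auto simp: sum_distrib_left)
  also have "\<dots> \<le> (\<Sum>m=1..N. mfun F m * (C * (real N / real m)))"
    by (intro sum_mono mult_left_mono C mfun_nonneg F) auto
  also have "\<dots> = C * real N * (\<Sum>m=1..N. mfun F m / real m)"
    by (simp add: sum_distrib_left mult_ac)
  finally show ?thesis .
qed

text \<open>Multiplication by 1 - q telescopes both sums. The bound 3/5 is a convenient number above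
  2 powr (-3/4), and 5/2 = 1 / (1 - 3/5).\<close>

lemma power_sum_from_2:
  fixes q :: real assumes "0 \<le> q" "q \<le> 3/5"
  shows "(\<Sum>v=2..N. q ^ v) \<le> 5/2 * q ^ 2" "(\<Sum>v=2..N. real v * q ^ v) \<le> 25/2 * q ^ 2"
proof -
  have a: "(1 - q) * (\<Sum>v=2..N. q ^ v) \<le> q ^ 2 - (if N \<ge> 2 then q ^ (N+1) else 0)"
  proof (induction N)
    case (Suc N)
    then show ?case by (cases "N \<ge> 2"; cases "N = 1") (auto simp: algebra_simps numeral_2_eq_2)
  qed simp
  have "(2/5) * (\<Sum>v=2..N. q ^ v) \<le> (1 - q) * (\<Sum>v=2..N. q ^ v)"
    using assms by (intro mult_right_mono sum_nonneg) auto
  also have "\<dots> \<le> q ^ 2" using a assms by (auto split: if_splits intro: order_trans)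
  finally show 1: "(\<Sum>v=2..N. q ^ v) \<le> 5/2 * q ^ 2" by simp
  have b: "(1 - q) * (\<Sum>v=2..N. real v * q ^ v) \<le> q ^ 2 + (\<Sum>v=2..N. q ^ v) - (if N \<ge> 2 then real N * q ^ (N+1) else 0)" for N
  proof (induction N)
    case (Suc N)
    then show ?case by (cases "N \<ge> 2"; cases "N = 1") (auto simp: algebra_simps numeral_2_eq_2)
  qed simp
  have "(2/5) * (\<Sum>v=2..N. real v * q ^ v) \<le> (1 - q) * (\<Sum>v=2..N. real v * q ^ v)"
    using assms by (intro mult_right_mono sum_nonneg) auto
  also have "\<dots> \<le> q ^ 2 + (\<Sum>v=2..N. q ^ v)"
  proof -
    have "(if N \<ge> 2 then real N * q ^ (N+1) else 0) \<ge> 0" using assms by simp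
    then show ?thesis using b[of N] by linarith
  qed
  also have "\<dots> \<le> 5 * q^2" using 1 zero_le_power2[of q] by linarith
  finally show "(\<Sum>v=2..N. real v * q ^ v) \<le> 25/2 * q ^ 2" by simp
qed

text \<open>The exponent 3/4 instead of 1 leaves room for Rankin weights (p^v) powr \<epsilon> with
  \<epsilon> \<le> 1/4. In the second bound ln p \<le> 4 p^(1/4) turns p^(-3/2) into p^(-5/4),
  whence 50 = 25/2 * 4.\<close>

lemma prime_power_tail:
  assumes "p \<ge> (2::real)"
  shows "(\<Sum>v=2..N. p powr (- 3/4 * real v)) \<le> 5/2 * p powr (-5/4)"
    "(\<Sum>v=2..N. p powr (- 3/4 * real v) * (real v * ln p)) \<le> 50 * p powr (-5/4)"
proof -
  define q where "q = p powr (-3/4)"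
  have q: "p powr (- 3/4 * real v) = q ^ v" for v
    using assms by (simp add: q_def powr_power mult.commute)
  \<comment> \<open>Fourth powers avoid fractional exponents: (3/5)^4 = 0.1296 just exceeds 2^(-3) =
    0.125.\<close>
  have "q ^ 4 = p powr (-3)" unfolding q_def using assms by (simp add: powr_powr flip: powr_realpow)
  also have "\<dots> \<le> 2 powr (-3)" using assms by (intro powr_mono2') auto
  also have "\<dots> \<le> (3/5)^4" by (simp add: powr_minus field_simps)
  finally have q35: "q \<le> 3/5" by (rule power_le_imp_le_base[of _ 3, simplified]) auto
  have q0: "q \<ge> 0" by (simp add: q_def)
  have q2: "q ^ 2 = p powr (-3/2)" unfolding q_def using assms by (simp add: powr_powr flip: powr_realpow)
  also have "\<dots> \<le> p powr (-5/4)" using assms by (intro powr_mono) auto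
  finally have q2': "q ^ 2 \<le> p powr (-5/4)" .
  show "(\<Sum>v=2..N. p powr (- 3/4 * real v)) \<le> 5/2 * p powr (-5/4)"
    unfolding q using power_sum_from_2(1)[OF q0 q35, of N] q2' by linarith
  have "ln p \<le> 4 * p powr (1/4)" using ln_powr_bound[of p "1/4"] assms by simp
  then have "q ^ 2 * ln p \<le> p powr (-3/2) * (4 * p powr (1/4))" unfolding q2 by (intro mult_left_mono) auto
  also have "\<dots> = 4 * p powr (-5/4)" by (simp flip: powr_add)
  finally have l: "q ^ 2 * ln p \<le> 4 * p powr (-5/4)" .
  have "(\<Sum>v=2..N. p powr (- 3/4 * real v) * (real v * ln p)) = (\<Sum>v=2..N. real v * q ^ v) * ln p"
    unfolding q by (simp add: sum_distrib_left mult_ac)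
  also have "\<dots> \<le> (25/2 * q ^ 2) * ln p"
    using assms by (intro mult_right_mono power_sum_from_2 q0 q35) auto
  also have "\<dots> = 25/2 * (q ^ 2 * ln p)" by (simp only: mult.assoc)
  also have "\<dots> \<le> 50 * p powr (-5/4)" using l by linarith
  finally show "(\<Sum>v=2..N. p powr (- 3/4 * real v) * (real v * ln p)) \<le> 50 * p powr (-5/4)" .
qed

section \<open>A lower bound for the number of moduli\<close>

lemma prod_set_primes_pos: "(\<And>p. p \<in> T \<Longrightarrow> prime (p::nat)) \<Longrightarrow> \<Prod>T > 0"
  by (intro prod_pos) (auto simp: prime_gt_0_nat)

lemma prime_dvd_prod_set_iff:
  fixes T :: "nat set"
  assumes "finite T" "\<And>p. p \<in> T \<Longrightarrow> prime p" "prime p"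
  shows "p dvd \<Prod>T \<longleftrightarrow> p \<in> T"
proof
  assume "p dvd \<Prod>T"
  then obtain r where "r \<in> T" "p dvd r" using assms by (auto simp: prime_dvd_prod_iff)
  then show "p \<in> T" using assms primes_dvd_imp_eq by blast
qed (use assms in auto)

lemma prod_set_primes_inj:
  fixes T U :: "nat set"
  assumes "finite T" "finite U" "\<And>p. p \<in> T \<union> U \<Longrightarrow> prime p" "\<Prod>T = \<Prod>U"
  shows "T = U"
proof (rule Set.set_eqI)
  fix p
  show "p \<in> T \<longleftrightarrow> p \<in> U"
  proof (cases "prime p")
    case True
    then show ?thesis
      using prime_dvd_prod_set_iff[of T p] prime_dvd_prod_set_iff[of U p] assms by simp
  qed (use assms(3) in auto)
qed

lemma sum_Pow_prod:
  fixes P :: "nat set" and g :: "nat \<Rightarrow> real"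
  assumes "finite P"
  shows "(\<Sum>T\<in>Pow P. \<Prod>p\<in>T. g p) = (\<Prod>p\<in>P. 1 + g p)"
  using prod_add[OF assms, of g "\<lambda>_. 1"] by (simp add: add.commute)

text \<open>
  Rankin's trick: the sets \<open>T\<close> with \<open>\<Prod>T > w\<close> contribute at most
  \<open>\<Sum>T. (\<Prod>T / w) powr \<epsilon> / \<Prod>T\<close>, where \<open>\<epsilon> = 1 / ln y\<close>.
\<close>

lemma sum_inverse_prod_small_sets:
  fixes P :: "nat set"
  assumes P: "P \<subseteq> primes_le y" and y: "y > 1" and w: "w \<ge> y ^ 5"
  shows "(\<Sum>T | T \<in> Pow P \<and> real (\<Prod>T) \<le> w. 1 / real (\<Prod>T)) \<ge> 1/2 * (\<Prod>p\<in>P. 1 + 1 / real p)"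
proof -
  have fin: "finite P" using P finite_subset by fastforce
  define \<epsilon> where "\<epsilon> = 1 / ln y"
  have e: "\<epsilon> > 0" using y by (simp add: \<epsilon>_def)
  have w0: "w > 0" using w y by (smt (verit) zero_less_power)
  let ?S = "{T \<in> Pow P. real (\<Prod>T) \<le> w}" and ?B = "{T \<in> Pow P. \<not> real (\<Prod>T) \<le> w}"
  have pr: "prime p" "p > 0" if "p \<in> P" for p using that P by (auto simp: primes_le_def prime_gt_0_nat)
  have m0: "real (\<Prod>T) > 0" if "T \<subseteq> P" for T using that pr by (auto intro!: prod_pos)
  have tot: "(\<Sum>T\<in>?S. 1 / real (\<Prod>T)) + (\<Sum>T\<in>?B. 1 / real (\<Prod>T)) = (\<Prod>p\<in>P. 1 + 1 / real p)"
  proof -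
    have "(\<Prod>p\<in>P. 1 + 1 / real p) = (\<Sum>T\<in>Pow P. \<Prod>p\<in>T. 1 / real p)"
      by (rule sum_Pow_prod[OF fin, symmetric])
    also have "\<dots> = (\<Sum>T\<in>Pow P. 1 / real (\<Prod>T))" by (simp add: prod_dividef)
    also have "Pow P = ?S \<union> ?B" by auto
    also have "(\<Sum>T\<in>?S \<union> ?B. 1 / real (\<Prod>T)) = (\<Sum>T\<in>?S. 1 / real (\<Prod>T)) + (\<Sum>T\<in>?B. 1 / real (\<Prod>T))"
      using fin by (intro sum.union_disjoint) auto
    finally show ?thesis by simp
  qed
  have "(\<Sum>T\<in>?B. 1 / real (\<Prod>T)) \<le> (\<Sum>T\<in>?B. w powr (-\<epsilon>) * (\<Prod>p\<in>T. real p powr \<epsilon> / real p))"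
  proof (intro sum_mono)
    fix T assume T: "T \<in> ?B"
    have "1 \<le> (real (\<Prod>T) / w) powr \<epsilon>" using T w0 e by (intro ge_one_powr_ge_zero) auto
    also have "\<dots> = w powr (-\<epsilon>) * real (\<Prod>T) powr \<epsilon>"
      using w0 by (simp add: powr_divide powr_minus field_simps prod_nonneg)
    also have "real (\<Prod>T) powr \<epsilon> = (\<Prod>p\<in>T. real p powr \<epsilon>)"
      using fin T by (simp add: prod_powr_distrib)
    finally have "1 / real (\<Prod>T) \<le> (w powr (-\<epsilon>) * (\<Prod>p\<in>T. real p powr \<epsilon>)) / real (\<Prod>T)"
      using m0[of T] T by (intro divide_right_mono) auto
    then show "1 / real (\<Prod>T) \<le> w powr (-\<epsilon>) * (\<Prod>p\<in>T. real p powr \<epsilon> / real p)"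
      by (simp add: prod_dividef)
  qed
  also have "\<dots> \<le> (\<Sum>T\<in>Pow P. w powr (-\<epsilon>) * (\<Prod>p\<in>T. real p powr \<epsilon> / real p))"
    using fin by (intro sum_mono2) (auto intro!: mult_nonneg_nonneg prod_nonneg)
  also have "\<dots> = w powr (-\<epsilon>) * (\<Prod>p\<in>P. 1 + real p powr \<epsilon> / real p)"
    by (simp add: sum_distrib_left[symmetric] sum_Pow_prod[OF fin])
  \<comment> \<open>The assumption w \<ge> y^5 gives exp (-5), while replacing p powr \<epsilon> by
    1 in the Euler factors costs exp (2 * \<epsilon> * 2 ln y) = exp 4. The exponent 5 is thus just
    large enough for the discarded sets to carry at most half of the product.\<close>
  also have "\<dots> \<le> exp (-5) * (exp 4 * (\<Prod>p\<in>P. 1 + 1 / real p))"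
  proof (intro mult_mono)
    have "w powr (-\<epsilon>) \<le> (y ^ 5) powr (-\<epsilon>)" using w y e by (intro powr_mono2') auto
    also have "\<dots> = exp (-5)" using y by (simp add: powr_def \<epsilon>_def ln_realpow)
    finally show "w powr (-\<epsilon>) \<le> exp (-5)" .
    have "(\<Prod>p\<in>P. 1 + real p powr \<epsilon> / real p) \<le> (\<Prod>p\<in>P. exp (2 * \<epsilon> * (ln p / p)) * (1 + 1 / real p))"
    proof (intro prod_mono conjI)
      fix p assume p: "p \<in> P"
      then have p1: "real p \<ge> 2" "real p \<le> y" using P primes_leD by auto
      have t: "0 \<le> \<epsilon> * ln p" "\<epsilon> * ln p \<le> 1" using p1 y e by (auto simp: \<epsilon>_def)
      have "real p powr \<epsilon> = exp (\<epsilon> * ln p)" using p1 by (simp add: powr_def)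
      also have "\<dots> \<le> 1 + \<epsilon> * ln p + (\<epsilon> * ln p)^2" using t by (rule exp_bound)
      also have "\<dots> \<le> 1 + 2 * (\<epsilon> * ln p)" using t by (simp add: power2_eq_square mult_left_le_one_le)
      finally have "real p powr \<epsilon> \<le> 1 + 2 * (\<epsilon> * ln p)" .
      then have "1 + real p powr \<epsilon> / real p \<le> 1 + (1 + 2 * (\<epsilon> * ln p)) / real p"
        using p1 by (simp add: divide_right_mono)
      also have "\<dots> = 1 + 1 / real p + 2 * \<epsilon> * (ln p / p)" by (simp add: add_divide_distrib mult_ac)
      also have "\<dots> \<le> (1 + 2 * \<epsilon> * (ln p / p)) * (1 + 1 / real p)"
      proof -
        have "0 \<le> 2 * \<epsilon> * (ln p / p) * (1 / real p)" using e p1 by simp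
        then show ?thesis unfolding distrib_left distrib_right by linarith
      qed
      also have "\<dots> \<le> exp (2 * \<epsilon> * (ln p / p)) * (1 + 1 / real p)"
        by (intro mult_right_mono exp_ge_add_one_self) auto
      finally show "1 + real p powr \<epsilon> / real p \<le> exp (2 * \<epsilon> * (ln p / p)) * (1 + 1 / real p)" .
    qed auto
    also have "\<dots> = exp (2 * \<epsilon> * (\<Sum>p\<in>P. ln p / p)) * (\<Prod>p\<in>P. 1 + 1 / real p)"
      using fin by (simp add: prod.distrib sum_distrib_left exp_sum)
    also have "\<dots> \<le> exp 4 * (\<Prod>p\<in>P. 1 + 1 / real p)"
    proof (intro mult_right_mono prod_nonneg)
      have "(\<Sum>p\<in>P. ln p / p) \<le> (\<Sum>p\<in>primes_le y. ln p / p)"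
        using P by (intro sum_mono2) (auto dest!: primes_leD(3))
      also have "\<dots> \<le> 2 * ln y" using y by (intro sum_ln_over_primes_le) auto
      finally have "2 * \<epsilon> * (\<Sum>p\<in>P. ln p / p) \<le> 2 * \<epsilon> * (2 * ln y)" using e by (intro mult_left_mono) auto
      also have "\<dots> = 4" using y by (simp add: \<epsilon>_def)
      finally show "exp (2 * \<epsilon> * (\<Sum>p\<in>P. ln p / p)) \<le> exp 4" by simp
    qed auto
    finally show "(\<Prod>p\<in>P. 1 + real p powr \<epsilon> / real p) \<le> exp 4 * (\<Prod>p\<in>P. 1 + 1 / real p)" .
  qed (auto intro!: prod_nonneg)
  also have "\<dots> = exp (-1) * (\<Prod>p\<in>P. 1 + 1 / real p)" by (simp add: mult_exp_exp flip: mult.assoc)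
  also have "\<dots> \<le> 1/2 * (\<Prod>p\<in>P. 1 + 1 / real p)"
  proof (intro mult_right_mono prod_nonneg)
    have "(2::real) \<le> exp 1" using exp_ge_add_one_self[of 1] by simp
    then show "exp (-1) \<le> (1/2 :: real)" by (simp add: exp_minus field_simps)
  qed auto
  finally show ?thesis using tot by simp
qed

text \<open>Each admissible squarefree number \<Prod>U \<le> x is counted with weight ln (\<Prod>U)
  \<le> ln x, split into the terms ln p for p in U. The pairs (U, p) correspond to (T, p) with T = U
  - {p} and p \<le> x / \<Prod>T; for \<Prod>T \<le> sqrt x the density hypothesis applies at x /
  \<Prod>T \<ge> sqrt x \<ge> x0.\<close>

lemma card_mult_ln_ge:
  fixes \<P> Q :: "nat set"
  assumes pr: "\<And>p. p \<in> \<P> \<Longrightarrow> prime p"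
    and Q: "\<And>U. finite U \<Longrightarrow> U \<subseteq> \<P> \<Longrightarrow> \<Prod>U \<in> Q"
    and th: "\<And>y. y \<ge> x0 \<Longrightarrow> (\<Sum>p\<in>\<P> \<inter> primes_le y. ln (real p)) \<ge> \<alpha> * y"
    and x: "x \<ge> 1" "sqrt x \<ge> x0" "\<alpha> * sqrt x \<ge> ln x"
    and P: "finite P" "P \<subseteq> \<P>"
  shows "real (card {q\<in>Q. q \<ge> 1 \<and> real q \<le> x}) * ln x \<ge>
    \<alpha> * x / 2 * (\<Sum>T | T \<in> Pow P \<and> real (\<Prod>T) \<le> sqrt x. 1 / real (\<Prod>T))"
proof -
  let ?T = "{T \<in> Pow P. real (\<Prod>T) \<le> sqrt x}"
  let ?R = "\<lambda>T. \<P> \<inter> primes_le (x / real (\<Prod>T)) - T"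
  define \<U> where "\<U> = {U \<in> Pow (\<P> \<inter> primes_le x). real (\<Prod>U) \<le> x}"
  have finU: "finite \<U>" by (rule finite_subset[of _ "Pow (primes_le x)"]) (auto simp: \<U>_def)
  have Uprop: "finite U" "\<And>p. p \<in> U \<Longrightarrow> prime p" "\<Prod>U > 0" "U \<subseteq> \<P>" if "U \<in> \<U>" for U
  proof -
    show "finite U" using that by (auto simp: \<U>_def intro: finite_subset[OF _ finite_primes_le])
    show "\<And>p. p \<in> U \<Longrightarrow> prime p" "U \<subseteq> \<P>" using that by (auto simp: \<U>_def primes_le_def)
    then show "\<Prod>U > 0" by (intro prod_set_primes_pos)
  qed
  have inj: "inj_on (\<lambda>U. \<Prod>U) \<U>" using Uprop by (intro inj_onI prod_set_primes_inj) auto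
  have "(\<lambda>U. \<Prod>U) ` \<U> \<subseteq> {q\<in>Q. q \<ge> 1 \<and> real q \<le> x}"
  proof clarify
    fix U assume U: "U \<in> \<U>"
    show "\<Prod>U \<in> Q \<and> 1 \<le> \<Prod>U \<and> real (\<Prod>U) \<le> x"
      using Uprop[OF U] Q[of U] U by (auto simp: \<U>_def Suc_le_eq)
  qed
  moreover have "finite {q\<in>Q. q \<ge> 1 \<and> real q \<le> x}"
    by (rule finite_subset[of _ "{..nat \<lfloor>x\<rfloor>}"]) (auto simp: le_nat_floor)
  ultimately have "card \<U> \<le> card {q\<in>Q. q \<ge> 1 \<and> real q \<le> x}"
    using card_inj_on_le[OF inj] by blast
  then have "real (card \<U>) * ln x \<le> real (card {q\<in>Q. q \<ge> 1 \<and> real q \<le> x}) * ln x"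
    using x by (intro mult_right_mono) auto
  moreover have "(\<Sum>U\<in>\<U>. \<Sum>p\<in>U. ln (real p)) \<le> real (card \<U>) * ln x"
  proof -
    have "(\<Sum>p\<in>U. ln (real p)) \<le> ln x" if U: "U \<in> \<U>" for U
    proof -
      have "(\<Sum>p\<in>U. ln (real p)) = ln (\<Prod>p\<in>U. real p)"
        using Uprop[OF U] by (subst ln_prod) (auto dest: prime_gt_0_nat)
      also have "\<dots> = ln (real (\<Prod>U))" by simp
      also have "\<dots> \<le> ln x" using U Uprop(3)[OF U] x by (subst ln_le_cancel_iff) (auto simp: \<U>_def simp del: of_nat_prod)
      finally show ?thesis .
    qed
    then show ?thesis using sum_bounded_above[of \<U> "\<lambda>U. \<Sum>p\<in>U. ln (real p)" "ln x"] by simp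
  qed
  moreover have "(\<Sum>T\<in>?T. \<Sum>p\<in>?R T. ln (real p)) \<le> (\<Sum>U\<in>\<U>. \<Sum>p\<in>U. ln (real p))"
  proof -
    have "(\<Sum>T\<in>?T. \<Sum>p\<in>?R T. ln (real p)) = (\<Sum>(T,p)\<in>(SIGMA T:?T. ?R T). ln (real p))"
      using P(1) by (subst sum.Sigma) auto
    also have "\<dots> \<le> (\<Sum>(U,p)\<in>(SIGMA U:\<U>. U). ln (real p))"
    proof (rule sum_le_included[where i = "\<lambda>(U,p). (U - {p}, p)"], goal_cases)
      case 1 then show ?case using P(1) by (intro finite_SigmaI) auto
    next
      case 2 then show ?case using finU Uprop by (intro finite_SigmaI) auto
    next
      case 3
      have "ln (real p) \<ge> 0" if "U \<in> \<U>" "p \<in> U" for U p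
        using Uprop(2)[OF that] prime_ge_1_nat[of p] by simp
      then show ?case by auto
    next
      case 4
      show ?case
      proof (clarify, goal_cases)
        case (1 T p)
        have Tp: "finite T" using 1 P finite_subset by auto
        have pp: "prime p" using 1 pr by auto
        have Tpos: "\<Prod>T > 0" using 1 P pr by (intro prod_set_primes_pos) auto
        have Tprime: "prime r" if "r \<in> T" for r using that 1 P pr by auto
        have Tx: "real r \<le> x" if "r \<in> T" for r
        proof -
          have "r \<le> \<Prod>T" using Tp that Tpos by (intro dvd_imp_le dvd_prodI) auto
          then have "real r \<le> real (\<Prod>T)" by (simp only: of_nat_le_iff)
          also have "\<dots> \<le> sqrt x" using 1 by simp
          also have "\<dots> \<le> x" using x by (simp add: sqrt_le_D real_le_lsqrt power2_eq_square)
          finally show ?thesis .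
        qed
        have "1 \<le> \<Prod>T" using Tpos by linarith
        then have "real 1 \<le> real (\<Prod>T)" by (simp only: of_nat_le_iff)
        then have Tpos': "real (\<Prod>T) > 0" "real (\<Prod>T) \<ge> 1" by linarith+
        have "real p \<le> x / real (\<Prod>T)" using 1 by (simp add: primes_le_def)
        then have px: "real p * real (\<Prod>T) \<le> x" using Tpos' by (simp only: pos_le_divide_eq)
        have "real p * 1 \<le> real p * real (\<Prod>T)" using Tpos' by (intro mult_left_mono) simp_all
        then have "real p \<le> x" using px by simp
        have "insert p T \<in> \<U>"
          using 1 Tp Tx Tprime pp px \<open>real p \<le> x\<close> P(2) by (auto simp: \<U>_def primes_le_def)
        then show ?case using 1 by (intro bexI[of _ "(insert p T, p)"]) auto
      qed
    qed
    also have "\<dots> = (\<Sum>U\<in>\<U>. \<Sum>p\<in>U. ln (real p))" using finU Uprop by (subst sum.Sigma) auto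
    finally show ?thesis .
  qed
  moreover have "\<alpha> * x / 2 * (\<Sum>T\<in>?T. 1 / real (\<Prod>T)) \<le> (\<Sum>T\<in>?T. \<Sum>p\<in>?R T. ln (real p))"
  proof (subst sum_distrib_left, intro sum_mono)
    fix T assume T: "T \<in> ?T"
    then have fT: "finite T" using P finite_subset by auto
    have prT: "prime p" if "p \<in> T" for p using that T P pr by auto
    define m where "m = real (\<Prod>T)"
    have "\<Prod>T > 0" using T P pr by (intro prod_set_primes_pos) auto
    then have m: "m \<ge> 1" "m \<le> sqrt x" using T by (auto simp: m_def Suc_le_eq simp del: of_nat_prod)
    have xm: "sqrt x \<le> x / m" 
    proof -
      have "sqrt x * m \<le> sqrt x * sqrt x" using m x by (intro mult_left_mono) auto
      then show ?thesis using m x by (simp add: field_simps)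
    qed
    have "\<alpha> * (x / m) \<le> (\<Sum>p\<in>\<P> \<inter> primes_le (x / m). ln (real p))" using xm x by (intro th) auto
    also have "\<dots> \<le> (\<Sum>p\<in>?R T \<union> T. ln (real p))"
    proof (rule sum_mono2)
      show "ln (real b) \<ge> 0" if "b \<in> (?R T \<union> T) - \<P> \<inter> primes_le (x / m)" for b
      proof -
        have "prime b" using that pr prT by auto
        then show ?thesis using prime_ge_1_nat[of b] by simp
      qed
    qed (use fT in \<open>auto simp: m_def\<close>)
    also have "\<dots> = (\<Sum>p\<in>?R T. ln (real p)) + (\<Sum>p\<in>T. ln (real p))"
      using fT by (intro sum.union_disjoint) auto
    also have "(\<Sum>p\<in>T. ln (real p)) = ln m"
      unfolding m_def of_nat_prod using fT prT by (subst ln_prod) (auto dest: prime_gt_0_nat)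
    \<comment> \<open>The primes already in T must not be used again. They cost ln m \<le> (ln x)/2,
      which by \<alpha> sqrt x \<ge> ln x is at most half of the density bound.\<close>
    also have "ln m \<le> ln (sqrt x)" using m x by (subst ln_le_cancel_iff) auto
    also have "\<dots> = ln x / 2" using x by (simp add: ln_sqrt)
    also have "\<dots> \<le> \<alpha> * (x / m) / 2"
    proof -
      have "0 \<le> \<alpha> * sqrt x" using x ln_ge_zero[of x] by linarith
      then have "\<alpha> \<ge> 0" using x by (simp add: zero_le_mult_iff)
      then have "\<alpha> * sqrt x \<le> \<alpha> * (x / m)" using xm by (rule mult_left_mono[rotated])
      then show ?thesis using x by simp
    qed
    finally show "\<alpha> * x / 2 * (1 / real (\<Prod>T)) \<le> (\<Sum>p\<in>?R T. ln (real p))"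
      unfolding m_def by simp
  qed
  ultimately show ?thesis by linarith
qed

text \<open>The factor exp (- zeta_const) compares the product of 1 + 1/p with the exponential of
  the sum of 1/p. The factor exp (-4) / 10^6 pays for the primes between x^(1/10) and x. One factor
  1/2 comes from Rankin's trick, the other from \<open>card_mult_ln_ge\<close>.\<close>

definition lower_const :: real where
  "lower_const = exp (- zeta_const) * exp (-4) / (4 * 10 ^ 6)"

lemma lower_const_pos: "lower_const > 0"
  by (simp add: lower_const_def)

lemma card_ge_exp_sum_inverse:
  fixes \<P> Q :: "nat set"
  assumes pr: "\<And>p. p \<in> \<P> \<Longrightarrow> prime p"
    and Q: "\<And>U. finite U \<Longrightarrow> U \<subseteq> \<P> \<Longrightarrow> \<Prod>U \<in> Q"
    and th: "\<And>y. y \<ge> x0 \<Longrightarrow> (\<Sum>p\<in>\<P> \<inter> primes_le y. ln (real p)) \<ge> \<alpha> * y"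
    and x: "x > 1" "sqrt x \<ge> x0" "\<alpha> * sqrt x \<ge> ln x" "\<alpha> > 0"
  shows "real (card {q\<in>Q. q \<ge> 1 \<and> real q \<le> x}) * ln x \<ge>
    lower_const * \<alpha> * x * exp (\<Sum>p\<in>\<P> \<inter> primes_le x. 1 / real p)"
proof -
  \<comment> \<open>With this exponent y^5 = sqrt x, as \<open>sum_inverse_prod_small_sets\<close>
    demands for sets with product at most sqrt x.\<close>
  define y where "y = x powr (1/10)"
  have y: "y > 1" "y \<le> x" using x powr_mono[of "1/10" 1 x] by (auto simp: y_def)
  have ly: "ln x / ln y = 10" using x by (simp add: y_def ln_powr)
  have y5: "y ^ 5 = sqrt x" using x by (simp add: y_def powr_power powr_half_sqrt[symmetric])
  define P where "P = \<P> \<inter> primes_le y"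
  have fin: "finite P" by (simp add: P_def)
  have pP: "real p \<ge> 2" if "p \<in> P" for p using that primes_leD(3) by (auto simp: P_def)
  have "exp (\<Sum>p\<in>P. 1 / real p) * exp (- zeta_const) \<le> (\<Prod>p\<in>P. 1 + 1 / real p)"
  proof -
    have "(\<Sum>p\<in>P. 1 / real p) - zeta_const \<le> (\<Sum>p\<in>P. 1 / real p) - (\<Sum>p\<in>P. real p powr (-5/4))"
      using sum_le_zeta_const[OF fin] by simp
    also have "\<dots> = (\<Sum>p\<in>P. 1 / real p - real p powr (-5/4))" by (simp add: sum_subtractf)
    also have "\<dots> \<le> (\<Sum>p\<in>P. ln (1 + 1 / real p))"
    proof (intro sum_mono)
      fix p assume p: "p \<in> P"
      have "(1 / real p)\<^sup>2 = real p powr (-2)" using pP[OF p] by (simp add: powr_minus powr_numeral field_simps)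
      also have "\<dots> \<le> real p powr (-5/4)" using pP[OF p] by (intro powr_mono) auto
      finally have "(1 / real p)\<^sup>2 \<le> real p powr (-5/4)" .
      moreover have "1 / real p - (1 / real p)\<^sup>2 \<le> ln (1 + 1 / real p)"
        using pP[OF p] by (intro ln_one_plus_pos_lower_bound) auto
      ultimately show "1 / real p - real p powr (-5/4) \<le> ln (1 + 1 / real p)" by linarith
    qed
    finally have "exp ((\<Sum>p\<in>P. 1 / real p) - zeta_const) \<le> exp (\<Sum>p\<in>P. ln (1 + 1 / real p))" by simp
    also have "\<dots> = (\<Prod>p\<in>P. 1 + 1 / real p)"
      unfolding exp_sum[OF fin] by (intro prod.cong refl exp_ln) (smt (verit) divide_nonneg_nonneg of_nat_0_le_iff)
    finally show ?thesis by (simp add: exp_diff exp_minus divide_inverse)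
  qed
  moreover have "exp (\<Sum>p\<in>\<P> \<inter> primes_le x. 1 / real p) \<le> exp (\<Sum>p\<in>P. 1 / real p) * (exp 4 * 10 ^ 6)"
  proof -
    have "(\<Sum>p\<in>\<P> \<inter> primes_le x. 1 / real p) \<le> (\<Sum>p\<in>P \<union> (primes_le x - primes_le y). 1 / real p)"
      by (intro sum_mono2) (auto simp: P_def)
    also have "\<dots> = (\<Sum>p\<in>P. 1 / real p) + (\<Sum>p\<in>primes_le x - primes_le y. 1 / real p)"
      by (intro sum.union_disjoint) (auto simp: P_def)
    finally have "exp (\<Sum>p\<in>\<P> \<inter> primes_le x. 1 / real p) \<le> exp (\<Sum>p\<in>P. 1 / real p) * exp (\<Sum>p\<in>primes_le x - primes_le y. 1 / real p)"
      by (simp flip: exp_add)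
    also have "\<dots> \<le> exp (\<Sum>p\<in>P. 1 / real p) * (exp 4 * 10 ^ 6)"
      using exp_sum_inverse_primes_le[OF y] unfolding ly by (intro mult_left_mono) auto
    finally show ?thesis .
  qed
  moreover have "1/2 * (\<Prod>p\<in>P. 1 + 1 / real p) \<le> (\<Sum>T | T \<in> Pow P \<and> real (\<Prod>T) \<le> sqrt x. 1 / real (\<Prod>T))"
    using y y5 by (intro sum_inverse_prod_small_sets[of P y]) (auto simp: P_def)
  moreover have "\<alpha> * x / 2 * (\<Sum>T | T \<in> Pow P \<and> real (\<Prod>T) \<le> sqrt x. 1 / real (\<Prod>T))
      \<le> real (card {q\<in>Q. q \<ge> 1 \<and> real q \<le> x}) * ln x"
    using x fin by (intro card_mult_ln_ge[OF pr Q th]) (auto simp: P_def)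
  ultimately have *: "\<alpha> * x / 2 * (1/2 * (exp (\<Sum>p\<in>\<P> \<inter> primes_le x. 1 / real p) / (exp 4 * 10 ^ 6) * exp (- zeta_const)))
      \<le> real (card {q\<in>Q. q \<ge> 1 \<and> real q \<le> x}) * ln x"
  proof -
    assume 1: "exp (\<Sum>p\<in>P. 1 / real p) * exp (- zeta_const) \<le> (\<Prod>p\<in>P. 1 + 1 / real p)"
      and 2: "exp (\<Sum>p\<in>\<P> \<inter> primes_le x. 1 / real p) \<le> exp (\<Sum>p\<in>P. 1 / real p) * (exp 4 * 10 ^ 6)"
      and 3: "1/2 * (\<Prod>p\<in>P. 1 + 1 / real p) \<le> (\<Sum>T | T \<in> Pow P \<and> real (\<Prod>T) \<le> sqrt x. 1 / real (\<Prod>T))"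
      and 4: "\<alpha> * x / 2 * (\<Sum>T | T \<in> Pow P \<and> real (\<Prod>T) \<le> sqrt x. 1 / real (\<Prod>T))
      \<le> real (card {q\<in>Q. q \<ge> 1 \<and> real q \<le> x}) * ln x"
    have "exp (\<Sum>p\<in>\<P> \<inter> primes_le x. 1 / real p) / (exp 4 * 10 ^ 6) * exp (- zeta_const) \<le> exp (\<Sum>p\<in>P. 1 / real p) * exp (- zeta_const)"
      using 2 by (intro mult_right_mono) (auto simp: field_simps)
    then have "1/2 * (exp (\<Sum>p\<in>\<P> \<inter> primes_le x. 1 / real p) / (exp 4 * 10 ^ 6) * exp (- zeta_const)) \<le>
       (\<Sum>T | T \<in> Pow P \<and> real (\<Prod>T) \<le> sqrt x. 1 / real (\<Prod>T))" using 1 3 by linarith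
    then have "\<alpha> * x / 2 * (1/2 * (exp (\<Sum>p\<in>\<P> \<inter> primes_le x. 1 / real p) / (exp 4 * 10 ^ 6) * exp (- zeta_const)))
      \<le> \<alpha> * x / 2 * (\<Sum>T | T \<in> Pow P \<and> real (\<Prod>T) \<le> sqrt x. 1 / real (\<Prod>T))"
      using x by (intro mult_left_mono) auto
    then show ?thesis using 4 by linarith
  qed
  show ?thesis using * by (simp add: lower_const_def exp_minus field_simps)
qed

section \<open>The Chinese remainder theorem\<close>

lemma finite_zmod_vecs [simp]: "finite (zmod_vecs q :: (int ^ 'n::finite) set)"
proof (rule finite_subset)
  show "zmod_vecs q \<subseteq> (\<lambda>f. \<chi> i::'n. f i) ` PiE UNIV (\<lambda>_. {0..<int q})"
  proof
    fix x :: "int ^ 'n" assume "x \<in> zmod_vecs q"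
    then show "x \<in> (\<lambda>f. \<chi> i::'n. f i) ` PiE UNIV (\<lambda>_. {0..<int q})"
      by (intro image_eqI[of _ _ "\<lambda>i. x $ i"]) (auto simp: zmod_vecs_def)
  qed
qed (intro finite_imageI finite_PiE; simp)

lemma finite_crt_set [simp]: "finite (crt_set A q :: (int ^ 'n::finite) set)"
  by (rule finite_subset[of _ "zmod_vecs q"]) (auto simp: crt_set_def)

lemma reduce_mod_in_zmod_vecs: "q > 0 \<Longrightarrow> reduce_mod q x \<in> zmod_vecs q"
  by (simp add: reduce_mod_def zmod_vecs_def)

lemma reduce_mod_reduce_mod: "d dvd q \<Longrightarrow> reduce_mod d (reduce_mod q x) = reduce_mod d x"
  by (simp add: reduce_mod_def vec_eq_iff mod_mod_cancel)

lemma crt_set_mult_iff: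
  assumes "coprime r s" "r > 0" "s > 0"
  shows "x \<in> crt_set A (r * s) \<longleftrightarrow>
    x \<in> zmod_vecs (r * s) \<and> reduce_mod r x \<in> crt_set A r \<and> reduce_mod s x \<in> crt_set A s"
proof -
  have pf: "prime_factors (r * s) = prime_factors r \<union> prime_factors s"
    using assms by (simp add: prime_factors_product)
  have r: "reduce_mod (p ^ multiplicity p (r * s)) x = reduce_mod (p ^ multiplicity p r) (reduce_mod r x)"
    "multiplicity p (r * s) = multiplicity p r" if "p \<in> prime_factors r" for p
    using coprime_multiplicity_mult[OF assms that] by (simp_all add: reduce_mod_reduce_mod multiplicity_dvd)
  have s: "reduce_mod (p ^ multiplicity p (r * s)) x = reduce_mod (p ^ multiplicity p s) (reduce_mod s x)"
    "multiplicity p (r * s) = multiplicity p s" if "p \<in> prime_factors s" for p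
    using coprime_multiplicity_mult[of s r p] that assms
    by (simp_all add: reduce_mod_reduce_mod multiplicity_dvd coprime_commute mult.commute)
  show ?thesis
    unfolding crt_set_def pf using r s reduce_mod_in_zmod_vecs[OF assms(2)] reduce_mod_in_zmod_vecs[OF assms(3)]
    by (auto simp: ball_Un)
qed

text \<open>The inverses c of s modulo r and d of r modulo s are explicit parameters because they
  act geometrically: modulo 1 the combination divided by r s is c a / r + d b / s, a dilation by c
  of the point a / r followed by a translation.\<close>

definition crt_combine :: "nat \<Rightarrow> nat \<Rightarrow> int \<Rightarrow> int \<Rightarrow> int ^ 'n \<Rightarrow> int ^ 'n \<Rightarrow> int ^ 'n" where
  "crt_combine r s c d a b = (\<chi> i. (a $ i * (c * int s) + b $ i * (d * int r)) mod int (r * s))"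

context
  fixes r s :: nat and c d :: int
  assumes rs: "coprime r s" "r > 0" "s > 0"
    and c: "[c * int s = 1] (mod int r)" and d: "[d * int r = 1] (mod int s)"
begin

lemma crt_combine_in: "crt_combine r s c d a b \<in> zmod_vecs (r * s)"
  using rs by (simp add: crt_combine_def zmod_vecs_def)

lemma crt_combine_component:
  "[(crt_combine r s c d a b :: int ^ 'n) $ i = a $ i] (mod int r)"
  "[(crt_combine r s c d a b :: int ^ 'n) $ i = b $ i] (mod int s)"
proof -
  have 0: "[crt_combine r s c d a b $ i = a $ i * (c * int s) + b $ i * (d * int r)] (mod int (r * s))"
    by (simp add: crt_combine_def)
  have "[crt_combine r s c d a b $ i = a $ i * (c * int s) + b $ i * (d * int r)] (mod int r)"
    using 0 by (rule cong_dvd_modulus) simp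
  also have "[a $ i * (c * int s) + b $ i * (d * int r) = a $ i * 1 + 0] (mod int r)"
    by (intro cong_add cong_mult cong_refl c) (simp add: cong_0_iff)
  finally show "[crt_combine r s c d a b $ i = a $ i] (mod int r)" by simp
  have "[crt_combine r s c d a b $ i = a $ i * (c * int s) + b $ i * (d * int r)] (mod int s)"
    using 0 by (rule cong_dvd_modulus) simp
  also have "[a $ i * (c * int s) + b $ i * (d * int r) = 0 + b $ i * 1] (mod int s)"
    by (intro cong_add cong_mult cong_refl d) (simp add: cong_0_iff)
  finally show "[crt_combine r s c d a b $ i = b $ i] (mod int s)" by simp
qed

lemma reduce_mod_crt_combine:
  "a \<in> zmod_vecs r \<Longrightarrow> reduce_mod r (crt_combine r s c d a b) = a"
  "b \<in> zmod_vecs s \<Longrightarrow> reduce_mod s (crt_combine r s c d a b) = b"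
  using crt_combine_component[of a b]
  by (auto simp: reduce_mod_def zmod_vecs_def vec_eq_iff cong_def)

lemma crt_combine_reduce_mod:
  assumes x: "x \<in> zmod_vecs (r * s)"
  shows "crt_combine r s c d (reduce_mod r x) (reduce_mod s x) = x"
proof -
  let ?y = "crt_combine r s c d (reduce_mod r x) (reduce_mod s x)"
  have "?y $ i = x $ i" for i
  proof -
    have "[?y $ i = x $ i] (mod int r)" "[?y $ i = x $ i] (mod int s)"
      using crt_combine_component[of "reduce_mod r x" "reduce_mod s x" i]
      by (auto simp: reduce_mod_def)
    then have "[?y $ i = x $ i] (mod int (r * s))"
      using rs by (simp add: coprime_cong_mult)
    then show ?thesis
      using x crt_combine_in[of "reduce_mod r x" "reduce_mod s x"] by (auto simp: zmod_vecs_def cong_def)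
  qed
  then show ?thesis by (simp add: vec_eq_iff)
qed

lemma bij_betw_crt_combine:
  "bij_betw (\<lambda>(a, b). crt_combine r s c d a b) (crt_set A r \<times> crt_set A s) (crt_set A (r * s))"
proof (rule bij_betw_byWitness[where f' = "\<lambda>x. (reduce_mod r x, reduce_mod s x)"])
  have z: "a \<in> crt_set A q \<Longrightarrow> a \<in> zmod_vecs q" for a :: "int ^ 'a" and A q by (simp add: crt_set_def)
  show "\<forall>x\<in>crt_set A r \<times> crt_set A s. (\<lambda>x. (reduce_mod r x, reduce_mod s x))
      (case x of (a, b) \<Rightarrow> crt_combine r s c d a b) = x"
    using z by (auto simp: reduce_mod_crt_combine)
  show "\<forall>x\<in>crt_set A (r * s). (case (reduce_mod r x, reduce_mod s x) of (a, b) \<Rightarrow> crt_combine r s c d a b) = x"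
    using z by (auto simp: crt_combine_reduce_mod)
  show "(\<lambda>(a, b). crt_combine r s c d a b) ` (crt_set A r \<times> crt_set A s) \<subseteq> crt_set A (r * s)"
    using z by (auto simp: crt_set_mult_iff[OF rs] crt_combine_in reduce_mod_crt_combine)
  show "(\<lambda>x. (reduce_mod r x, reduce_mod s x)) ` crt_set A (r * s) \<subseteq> crt_set A r \<times> crt_set A s"
    by (auto simp: crt_set_mult_iff[OF rs])
qed

end

lemma coprime_inverses_exist:
  assumes "coprime r (s::nat)"
  obtains c where "[c * int s = 1] (mod int r)"
proof -
  have "coprime (int s) (int r)" using assms by (simp add: coprime_commute)
  then obtain c where "[int s * c = 1] (mod int r)" using cong_solve_coprime_int by blast
  then show thesis using that by (simp add: mult.commute)
qed

lemma rho_mult: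
  assumes "coprime r s" "r > 0" "s > 0"
  shows "rho A (r * s) = rho A r * rho A (s::nat)"
proof -
  obtain c where c: "[c * int s = 1] (mod int r)" using coprime_inverses_exist assms by blast
  obtain d where d: "[d * int r = 1] (mod int s)"
    using coprime_inverses_exist[of s r] assms by (auto simp: coprime_commute)
  show ?thesis
    unfolding rho_def using bij_betw_same_card[OF bij_betw_crt_combine[OF assms c d, of A]]
    by (simp add: card_cartesian_product)
qed

lemma crt_set_1: "crt_set A 1 = {0 :: int ^ 'n}"
proof -
  have "x = 0" if "\<forall>i. 0 \<le> x $ i \<and> x $ i < 1" for x :: "int ^ 'n"
    using that by (simp add: vec_eq_iff) (metis zless_add1_eq add_0 dual_order.antisym int_one_le_iff_zero_less not_le)
  then show ?thesis by (auto simp: crt_set_def zmod_vecs_def)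
qed

lemma rho_1 [simp]: "rho A 1 = 1" "rho A (Suc 0) = 1"
  using crt_set_1[of A] by (simp_all add: rho_def)

lemma multiplicative_eq_mfun:
  fixes G :: "nat \<Rightarrow> real"
  assumes "G 1 = 1" "\<And>r s. coprime r s \<Longrightarrow> r > 0 \<Longrightarrow> s > 0 \<Longrightarrow> G (r * s) = G r * G s"
  shows "q > 0 \<Longrightarrow> G q = mfun (\<lambda>p v. G (p ^ v)) q"
proof (induction q rule: less_induct)
  case (less q)
  show ?case
  proof (cases "q = 1")
    case False
    then obtain p where p: "prime p" "p dvd q" using prime_factor_nat by blast
    obtain v m where vm: "v = multiplicity p q" "q = p ^ v * m" "m > 0" "m \<le> q" "coprime (p ^ v) m"
      "\<not> p dvd m" "prime_factors m = prime_factors q - {p}"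
      "mfun (\<lambda>p v. G (p ^ v)) q = (if p dvd q then G (p ^ v) else 1) * mfun (\<lambda>p v. G (p ^ v)) m"
      by (rule split_prime_power[OF p(1) less.prems, where F = "\<lambda>p v. G (p ^ v)"])
    have "m < q" using vm(4,6) p(2) by (metis le_neq_implies_less)
    then have "G m = mfun (\<lambda>p v. G (p ^ v)) m" using less.IH vm(3) by blast
    moreover have "G q = G (p ^ v) * G m"
      unfolding vm(2) using vm(3,5) p(1) by (intro assms(2)) (auto simp: prime_gt_0_nat)
    ultimately show ?thesis using vm(8) p(2) by simp
  qed (use assms in simp)
qed

lemma rho_eq_mfun: "q > 0 \<Longrightarrow> real (rho A q) = mfun (\<lambda>p v. real (rho A (p ^ v))) q"
  by (rule multiplicative_eq_mfun) (simp_all add: rho_mult)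

lemma rho_prod_primes_pos:
  assumes "finite U" "\<And>p. p \<in> U \<Longrightarrow> prime p \<and> rho A p \<ge> 1"
  shows "rho A (\<Prod>U) \<ge> 1"
  using assms
proof (induction U rule: finite_induct)
  case (insert p U)
  have "coprime p (\<Prod>U)"
  proof (rule prod_coprime_right)
    fix x assume "x \<in> U"
    then show "coprime p x" using insert.hyps(2) insert.prems[of x] insert.prems[of p]
      by (metis insertCI primes_coprime)
  qed
  moreover have "p > 0" "\<Prod>U > 0" using insert by (auto intro!: prod_pos simp: prime_gt_0_nat)
  ultimately have "rho A (p * \<Prod>U) = rho A p * rho A (\<Prod>U)" by (rule rho_mult)
  then show ?case using insert by (simp add: Suc_le_eq)
qed simp

section \<open>Boxes of the torus\<close>

text \<open>A projected box may wrap around the fundamental domain. Measuring from its left end with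
  \<open>frac\<close> describes every side as one arc, without distinguishing whether it wraps, and
  makes translations a mere change of a.\<close>

lemma torus_proj_cbox:
  fixes a b :: "real ^ 'n"
  assumes "\<And>i. a $ i \<le> b $ i" "\<And>i. b $ i - a $ i \<le> 1"
  shows "torus_proj ` cbox a b = {y. \<forall>i. 0 \<le> y $ i \<and> y $ i < 1 \<and> frac (y $ i - a $ i) \<le> b $ i - a $ i}"
proof (intro equalityI subsetI)
  fix y assume "y \<in> torus_proj ` cbox a b"
  then obtain x where x: "y = torus_proj x" "\<And>i. a $ i \<le> x $ i" "\<And>i. x $ i \<le> b $ i"
    by (auto simp: mem_box_cart)
  have "frac (y $ i - a $ i) \<le> b $ i - a $ i" for i
  proof -
    have "frac (y $ i - a $ i) = frac (x $ i - a $ i)"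
    proof -
      have "frac (x $ i) - a $ i = x $ i - a $ i + of_int (- \<lfloor>x $ i\<rfloor>)" by (simp add: frac_def)
      then show ?thesis unfolding x(1) torus_proj_def by (simp only: vec_lambda_beta frac_add_int_right Ints_of_int)
    qed
    also have "\<dots> \<le> x $ i - a $ i" using x(2)[of i] by (simp add: frac_def)
    finally show ?thesis using x(3)[of i] by linarith
  qed
  then show "y \<in> {y. \<forall>i. 0 \<le> y $ i \<and> y $ i < 1 \<and> frac (y $ i - a $ i) \<le> b $ i - a $ i}"
    by (simp add: x(1) torus_proj_def frac_lt_1)
next
  fix y assume y: "y \<in> {y. \<forall>i. 0 \<le> y $ i \<and> y $ i < 1 \<and> frac (y $ i - a $ i) \<le> b $ i - a $ i}"
  define x :: "real ^ 'n" where "x = (\<chi> i. a $ i + frac (y $ i - a $ i))"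
  have "torus_proj x = y"
  proof -
    have "frac (x $ i) = y $ i" for i
    proof -
      have "x $ i = y $ i + of_int (- \<lfloor>y $ i - a $ i\<rfloor>)" by (simp add: x_def frac_def)
      then have "frac (x $ i) = frac (y $ i)" by (simp only: frac_add_int_right Ints_of_int)
      also have "\<dots> = y $ i" using y by (simp add: frac_eq)
      finally show ?thesis .
    qed
    then show ?thesis by (simp add: torus_proj_def vec_eq_iff)
  qed
  moreover have "x \<in> cbox a b"
  proof -
    have "a $ i \<le> x $ i \<and> x $ i \<le> b $ i" for i
      using y frac_ge_0[of "y $ i - a $ i"] by (simp add: x_def) (metis add.commute le_diff_eq)
    then show ?thesis by (simp add: mem_box_cart)
  qed
  ultimately show "y \<in> torus_proj ` cbox a b" by blast
qed

text \<open>Carries the product formula for \<open>lborel\<close>, which runs over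
  \<open>Basis\<close>, to coordinates through the bijection of i with
  \<open>axis i 1\<close>.\<close>

lemma measure_lborel_cart_prod:
  fixes B :: "'n::finite \<Rightarrow> real set"
  assumes [measurable]: "\<And>i. B i \<in> sets borel" and fin: "\<And>i. emeasure lborel (B i) \<noteq> \<infinity>"
  shows "measure lborel {y :: real ^ 'n. \<forall>i. y $ i \<in> B i} = (\<Prod>i\<in>UNIV. measure lborel (B i))"
proof -
  define ix where "ix = (\<lambda>b :: real ^ 'n. THE i. b = axis i 1)"
  have ix [simp]: "ix (axis i 1) = i" for i unfolding ix_def by (rule the_equality) (auto simp: axis_eq_axis)
  have bas: "(Basis :: (real ^ 'n) set) = (\<lambda>i. axis i 1) ` UNIV"
    by (auto simp: Basis_vec_def)
  have inj: "inj (\<lambda>i::'n. axis i (1::real))" by (auto simp: inj_on_def axis_eq_axis)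
  have meas: "{y :: real ^ 'n. \<forall>i. y $ i \<in> B i} \<in> sets borel"
  proof -
    have "{y :: real ^ 'n. \<forall>i. y $ i \<in> B i} = (\<Inter>i. (\<lambda>y. y $ i) -` B i \<inter> space borel)" by auto
    also have "\<dots> \<in> sets borel"
    proof (intro sets.countable_INT' countable_finite)
      have "(\<lambda>y :: real ^ 'n. y $ i) -` B i \<inter> space borel \<in> sets borel" for i
        by (rule measurable_sets[of _ borel borel])
          (auto intro!: borel_measurable_continuous_onI continuous_intros assms(1))
      then show "(\<lambda>i. (\<lambda>y :: real ^ 'n. y $ i) -` B i \<inter> space borel) ` UNIV \<subseteq> sets borel" by auto
    qed auto
    finally show ?thesis .
  qed
  have "emeasure lborel {y :: real ^ 'n. \<forall>i. y $ i \<in> B i}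
     = (\<integral>\<^sup>+ y. indicator {y :: real ^ 'n. \<forall>i. y $ i \<in> B i} y \<partial>lborel)"
    using meas by simp
  also have "\<dots> = (\<integral>\<^sup>+ y. (\<Prod>b\<in>Basis. indicator (B (ix b)) (y \<bullet> b)) \<partial>(lborel :: (real ^ 'n) measure))"
  proof (rule nn_integral_cong)
    fix y :: "real ^ 'n"
    have "(\<Prod>b\<in>Basis. indicator (B (ix b)) (y \<bullet> b) :: ennreal) = (\<Prod>i\<in>UNIV. indicator (B i) (y $ i))"
      unfolding bas by (subst prod.reindex[OF inj]) (simp add: inner_axis)
    also have "\<dots> = indicator {y :: real ^ 'n. \<forall>i. y $ i \<in> B i} y"
    proof (cases "\<forall>i. y $ i \<in> B i")
      case False
      then obtain i where "y $ i \<notin> B i" by blast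
      then have "(\<Prod>i\<in>UNIV. indicator (B i) (y $ i) :: ennreal) = 0" by (intro prod_zero bexI[of _ i]) auto
      then show ?thesis using False by simp
    qed simp
    finally show "indicator {y :: real ^ 'n. \<forall>i. y $ i \<in> B i} y = (\<Prod>b\<in>Basis. indicator (B (ix b)) (y \<bullet> b) :: ennreal)"
      by simp
  qed
  also have "\<dots> = (\<Prod>b\<in>(Basis :: (real ^ 'n) set). \<integral>\<^sup>+ x. indicator (B (ix b)) x \<partial>lborel)"
    by (rule nn_integral_lborel_prod) auto
  also have "\<dots> = (\<Prod>i\<in>UNIV. emeasure lborel (B i))"
    unfolding bas by (subst prod.reindex[OF inj]) simp
  also have "\<dots> = (\<Prod>i\<in>UNIV. ennreal (measure lborel (B i)))"
    using fin by (simp add: emeasure_eq_ennreal_measure)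
  also have "\<dots> = ennreal (\<Prod>i\<in>UNIV. measure lborel (B i))" by (simp add: prod_ennreal)
  finally show ?thesis by (simp add: measure_def prod_nonneg)
qed

lemma measure_arc:
  fixes a l :: real
  assumes l: "0 \<le> l" "l \<le> 1"
  defines "B \<equiv> {t. 0 \<le> t \<and> t < 1 \<and> frac (t - a) \<le> l}"
  shows "B \<in> sets borel" "emeasure lborel B = ennreal l"
proof -
  define \<alpha> where "\<alpha> = frac a"
  have \<alpha>: "0 \<le> \<alpha>" "\<alpha> < 1" by (auto simp: \<alpha>_def frac_lt_1)
  have fr: "frac (t - a) = (if \<alpha> \<le> t then t - \<alpha> else t - \<alpha> + 1)" if "0 \<le> t" "t < 1" for t
  proof -
    have "t - a = t - \<alpha> + of_int (- \<lfloor>a\<rfloor>)" by (simp add: \<alpha>_def frac_def)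
    then have "frac (t - a) = frac (t - \<alpha>)" by (simp only: frac_add_int_right Ints_of_int)
    also have "\<dots> = (if \<alpha> \<le> t then t - \<alpha> else t - \<alpha> + 1)"
    proof (cases "\<alpha> \<le> t")
      case True then show ?thesis using that \<alpha> by (simp add: frac_eq)
    next
      case False
      then have "t - \<alpha> + 1 - (t - \<alpha>) = 1" "0 \<le> t - \<alpha> + 1" "t - \<alpha> + 1 < 1" using that \<alpha> by auto
      then have "frac (t - \<alpha>) = t - \<alpha> + 1" by (subst frac_unique_iff) (auto simp: Ints_def intro!: range_eqI[of _ _ "-1"])
      then show ?thesis using False by simp
    qed
    finally show ?thesis .
  qed
  \<comment> \<open>The arc stays inside [0,1), wraps around, or is the full circle. The last case
    is separate because for l = 1 the two pieces of a wrapping arc would meet in the point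
    \<alpha>.\<close>
  consider "\<alpha> + l < 1" | "\<alpha> + l \<ge> 1" "l < 1" | "l = 1" using l by linarith
  then have "B \<in> sets borel \<and> emeasure lborel B = ennreal l"
  proof cases
    case 1
    have "B = {\<alpha>..\<alpha> + l}"
    proof (rule Set.set_eqI)
      show "t \<in> B \<longleftrightarrow> t \<in> {\<alpha>..\<alpha> + l}" for t
        using 1 \<alpha> l by (cases "0 \<le> t \<and> t < 1"; cases "\<alpha> \<le> t") (auto simp: B_def fr)
    qed
    then show ?thesis using l by simp
  next
    case 2
    have "B = {\<alpha>..<1} \<union> {0..\<alpha> + l - 1}"
    proof (rule Set.set_eqI)
      show "t \<in> B \<longleftrightarrow> t \<in> {\<alpha>..<1} \<union> {0..\<alpha> + l - 1}" for t
        using 2 \<alpha> l by (cases "0 \<le> t \<and> t < 1"; cases "\<alpha> \<le> t") (auto simp: B_def fr)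
    qed
    moreover have "emeasure lborel ({\<alpha>..<1} \<union> {0..\<alpha> + l - 1}) = emeasure lborel {\<alpha>..<1} + emeasure lborel {0..\<alpha> + l - 1}"
      using 2 by (intro plus_emeasure[symmetric]) auto
    moreover have "\<dots> = ennreal l" using 2 \<alpha> by (simp flip: ennreal_plus)
    ultimately show ?thesis by simp
  next
    case 3
    have "B = {0..<1}" unfolding B_def using 3 by (auto simp: less_imp_le[OF frac_lt_1])
    then show ?thesis using 3 by simp
  qed
  then show "B \<in> sets borel" "emeasure lborel B = ennreal l" by auto
qed

lemma measure_torus_box:
  fixes a b :: "real ^ 'n"
  assumes "\<And>i. a $ i \<le> b $ i" "\<And>i. b $ i - a $ i \<le> 1"
  shows "measure lborel (torus_proj ` cbox a b) = (\<Prod>i\<in>UNIV. b $ i - a $ i)"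
proof -
  let ?B = "\<lambda>i. {t. 0 \<le> t \<and> t < 1 \<and> frac (t - a $ i) \<le> b $ i - a $ i}"
  have l: "0 \<le> b $ i - a $ i" "b $ i - a $ i \<le> 1" for i using assms[of i] by auto
  note B = measure_arc[OF l]
  have "measure lborel (torus_proj ` cbox a b) = measure lborel {y. \<forall>i. y $ i \<in> ?B i}"
    unfolding torus_proj_cbox[OF assms] by (simp only: mem_Collect_eq)
  also have "\<dots> = (\<Prod>i\<in>UNIV. measure lborel (?B i))"
  proof (rule measure_lborel_cart_prod)
    show "?B i \<in> sets borel" for i by (rule B(1))
    show "emeasure lborel (?B i) \<noteq> \<infinity>" for i unfolding B(2) by simp
  qed
  also have "\<dots> = (\<Prod>i\<in>UNIV. b $ i - a $ i)"
  proof (intro prod.cong refl)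
    show "measure lborel (?B i) = b $ i - a $ i" for i
      unfolding measure_def B(2) using assms(1)[of i] by simp
  qed
  finally show ?thesis .
qed

text \<open>The mass of the box with corner a and side lengths l under the image of \<Delta>_r by
  multiplication with c. Keeping corner and side lengths apart makes the class of boxes visibly
  closed under translation.\<close>

definition dil_mass :: "(nat \<Rightarrow> (int ^ 'n) set) \<Rightarrow> nat \<Rightarrow> int \<Rightarrow> real ^ 'n \<Rightarrow> real ^ 'n \<Rightarrow> real" where
  "dil_mass A r c a l = real (card {x \<in> crt_set A r. \<forall>i. frac (of_int (c * x $ i) / real r - a $ i) \<le> l $ i}) / real (rho A r)"

text \<open>
  By the Chinese remainder theorem \<open>\<Delta>\<^sub>r\<^sub>s\<close> is an average of translates of the image of
  \<open>\<Delta>\<^sub>r\<close> under multiplication by \<open>c\<close>, and the class of boxes is translation invariant.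
\<close>

lemma disc_Delta_mult_le:
  fixes A :: "nat \<Rightarrow> (int ^ 'n::finite) set"
  assumes rs: "coprime r s" "r > 0" "s > 0" and c: "[c * int s = 1] (mod int r)"
    and rho: "rho A r \<ge> 1" "rho A s \<ge> 1"
    and E: "\<And>a l. (\<And>i. 0 \<le> l $ i \<and> l $ i \<le> 1) \<Longrightarrow> \<bar>dil_mass A r c a l - (\<Prod>i\<in>UNIV. l $ i)\<bar> \<le> E"
  shows "disc (Delta A (r * s)) \<le> E"
  unfolding disc_def
proof (rule cSUP_least)
  have "torus_proj ` cbox 0 (0 :: real ^ 'n) \<in> torus_boxes"
    unfolding torus_boxes_def by (intro CollectI exI[of _ "0 :: real ^ 'n"]) auto
  then show "(torus_boxes :: (real ^ 'n) set set) \<noteq> {}" by blast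
next
  fix B :: "(real ^ 'n) set" assume "B \<in> torus_boxes"
  then obtain a b where B: "B = torus_proj ` cbox a b" and ab: "\<And>i. a $ i \<le> b $ i" "\<And>i. b $ i - a $ i \<le> 1"
    unfolding torus_boxes_def by auto
  obtain d where d: "[d * int r = 1] (mod int s)"
    using coprime_inverses_exist[of s r] rs by (auto simp: coprime_commute)
  define l where "l = b - a"
  define V where "V = (\<Prod>i\<in>UNIV. l $ i)"
  have vol: "measure lborel B = V" unfolding B V_def l_def using measure_torus_box[OF ab] by simp
  \<comment> \<open>The residue y modulo s only translates the picture by d y / s, and this
    translation is moved into the corner of the box.\<close>
  define sh where "sh = (\<lambda>y :: int ^ 'n. \<chi> i. a $ i - of_int (d * y $ i) / real s)"
  have mem: "frac_point (r * s) (crt_combine r s c d x y) \<in> B \<longleftrightarrow>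
      (\<forall>i. frac (of_int (c * x $ i) / real r - sh y $ i) \<le> l $ i)" for x y
  proof -
    have "frac (frac (of_int (crt_combine r s c d x y $ i) / real (r * s)) - a $ i)
        = frac (of_int (c * x $ i) / real r - sh y $ i)" for i
    proof -
      let ?w = "x $ i * (c * int s) + y $ i * (d * int r)"
      define k where "k = ?w div int (r * s)"
      have "crt_combine r s c d x y $ i = ?w - int (r * s) * k"
        unfolding k_def crt_combine_def by (simp add: minus_mult_div_eq_mod)
      then have "of_int (crt_combine r s c d x y $ i) = (of_int ?w :: real) - real (r * s) * of_int k"
        by simp
      then have "of_int (crt_combine r s c d x y $ i) / real (r * s) = of_int ?w / real (r * s) - of_int k"
        using rs by (simp only: diff_divide_distrib) simp
      also have "of_int ?w / real (r * s) = of_int (c * x $ i) / real r + of_int (d * y $ i) / real s"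
        using rs by (simp add: field_simps)
      finally have 1: "of_int (crt_combine r s c d x y $ i) / real (r * s) =
        of_int (c * x $ i) / real r + of_int (d * y $ i) / real s - of_int k" .
      define u where "u = of_int (crt_combine r s c d x y $ i) / real (r * s)"
      have "frac u - a $ i = of_int (c * x $ i) / real r - sh y $ i + of_int (- k - \<lfloor>u\<rfloor>)"
        using 1 unfolding u_def[symmetric] by (simp add: frac_def sh_def)
      then show ?thesis unfolding u_def[symmetric] by (simp only: frac_add_int_right Ints_of_int)
    qed
    then show ?thesis
      unfolding B torus_proj_cbox[OF ab] frac_point_def torus_proj_def by (simp add: frac_lt_1 l_def)
  qed
  have sum: "(\<Sum>x\<in>crt_set A (r * s). indicator B (frac_point (r * s) x) :: real) =
     (\<Sum>y\<in>crt_set A s. real (rho A r) * dil_mass A r c (sh y) l)"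
  proof -
    have "(\<Sum>x\<in>crt_set A (r * s). indicator B (frac_point (r * s) x) :: real) =
       (\<Sum>(x, y)\<in>crt_set A r \<times> crt_set A s. indicator B (frac_point (r * s) (crt_combine r s c d x y)))"
      by (subst sum.reindex_bij_betw[OF bij_betw_crt_combine[OF rs c d, of A], symmetric]) (simp add: split_def)
    also have "\<dots> = (\<Sum>y\<in>crt_set A s. \<Sum>x\<in>crt_set A r. indicator B (frac_point (r * s) (crt_combine r s c d x y)))"
      by (subst sum.swap) (simp add: sum.cartesian_product)
    also have "\<dots> = (\<Sum>y\<in>crt_set A s. real (rho A r) * dil_mass A r c (sh y) l)"
    proof (intro sum.cong refl)
      fix y
      have "(\<Sum>x\<in>crt_set A r. indicator B (frac_point (r * s) (crt_combine r s c d x y)) :: real)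
        = (\<Sum>x | x \<in> crt_set A r \<and> (\<forall>i. frac (of_int (c * x $ i) / real r - sh y $ i) \<le> l $ i). 1)"
        by (intro sum.mono_neutral_cong_right) (auto simp: indicator_def mem)
      then show "(\<Sum>x\<in>crt_set A r. indicator B (frac_point (r * s) (crt_combine r s c d x y))) =
          real (rho A r) * dil_mass A r c (sh y) l"
        using rho by (simp add: dil_mass_def)
    qed
    finally show ?thesis .
  qed
  have rs0: "real (rho A r) > 0" "real (rho A s) > 0" using rho by auto
  have card_s: "real (card (crt_set A s)) = real (rho A s)" by (simp add: rho_def)
  have "Delta A (r * s) B - V = (\<Sum>y\<in>crt_set A s. dil_mass A r c (sh y) l - V) / real (rho A s)"
    unfolding Delta_def sum rho_mult[OF rs] using rs0
    by (simp add: sum_subtractf card_s field_simps flip: sum_distrib_left)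
  then have "\<bar>Delta A (r * s) B - V\<bar> \<le> (\<Sum>y\<in>crt_set A s. \<bar>dil_mass A r c (sh y) l - V\<bar>) / real (rho A s)"
    using rs0 by (simp add: divide_right_mono)
  also have "\<dots> \<le> (\<Sum>y\<in>crt_set A s. E) / real (rho A s)"
    using ab unfolding V_def by (intro divide_right_mono sum_mono E) (auto simp: l_def)
  also have "\<dots> = E" using rs0 card_s by simp
  finally show "\<bar>Delta A (r * s) B - measure lborel B\<bar> \<le> E" unfolding vol .
qed

section \<open>Selberg's sieve\<close>

context
  fixes P :: "nat set" and D :: real
  assumes finP: "finite P" and all_primeP: "\<forall>p\<in>P. prime p" and D: "D \<ge> 1"
begin

lemma primeP: "p \<in> P \<Longrightarrow> prime p"
  using all_primeP by blast

text \<open>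
  Selberg's sieve indexed by sets of primes instead of squarefree divisors, so that least common
  multiples and greatest common divisors become unions and intersections.
\<close>

definition sieve_sets :: "nat set set" where
  "sieve_sets = {T \<in> Pow P. real (\<Prod>T) \<le> D}"

definition sieve_phi :: "nat set \<Rightarrow> real" where
  "sieve_phi T = (\<Prod>p\<in>T. real p - 1)"

definition sieve_sum :: real where
  "sieve_sum = (\<Sum>T\<in>sieve_sets. 1 / sieve_phi T)"

text \<open>With d = \<Prod>T these are Selberg's weights \<mu>(d) d / G times the sum of
  1/\<phi>(k) over the admissible multiples k of d, where \<open>sieve_phi\<close> is Euler's
  function and \<open>sieve_sum\<close> is the normalizing sum G. They minimize the quadratic form
  of the sieve subject to value 1 at the empty set.\<close>

definition sieve_weight :: "nat set \<Rightarrow> real" where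
  "sieve_weight T = real (\<Prod>T) * (-1) ^ card T *
     (\<Sum>K\<in>sieve_sets. if T \<subseteq> K then 1 / (sieve_phi K * sieve_sum) else 0)"

lemma finite_sieve_sets [simp]: "finite sieve_sets"
  using finP by (simp add: sieve_sets_def)

lemma sieve_setsD:
  assumes "T \<in> sieve_sets"
  shows "T \<subseteq> P" "finite T" "\<And>p. p \<in> T \<Longrightarrow> prime p" "\<Prod>T > 0"
proof -
  show *: "T \<subseteq> P" using assms by (simp add: sieve_sets_def)
  then show "finite T" using finP finite_subset by blast
  show pr: "\<And>p. p \<in> T \<Longrightarrow> prime p" using * primeP by blast
  then show "\<Prod>T > 0" by (rule prod_set_primes_pos)
qed

lemma real_prod_pos: "T \<subseteq> P \<Longrightarrow> real (\<Prod>T) > 0"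
  unfolding of_nat_0_less_iff using primeP by (intro prod_set_primes_pos) blast

lemma sieve_setsI: "T \<subseteq> P \<Longrightarrow> real (\<Prod>T) \<le> D \<Longrightarrow> T \<in> sieve_sets"
  by (simp add: sieve_sets_def)

lemma sieve_sets_down:
  assumes "T \<in> sieve_sets" "K \<subseteq> T" shows "K \<in> sieve_sets"
proof -
  have "\<Prod>K dvd \<Prod>T" using assms(2) sieve_setsD(2)[OF assms(1)] by (intro prod_dvd_prod_subset)
  then have "\<Prod>K \<le> \<Prod>T" using sieve_setsD(4)[OF assms(1)] by (rule dvd_imp_le)
  then have "real (\<Prod>K) \<le> real (\<Prod>T)" by (simp only: of_nat_le_iff)
  then show ?thesis using assms unfolding sieve_sets_def by auto
qed

lemma empty_sieve_set: "{} \<in> sieve_sets"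
  using D by (simp add: sieve_sets_def)

lemma sieve_phi_pos: "T \<subseteq> P \<Longrightarrow> sieve_phi T > 0"
  unfolding sieve_phi_def
proof (rule prod_pos)
  fix p assume "T \<subseteq> P" "p \<in> T"
  then have "p \<ge> 2" using primeP prime_ge_2_nat by blast
  then show "0 < real p - 1" by simp
qed

lemma sieve_sum_pos: "sieve_sum > 0"
proof -
  have "1 / sieve_phi {} \<le> sieve_sum" unfolding sieve_sum_def
    using sieve_phi_pos sieve_setsD empty_sieve_set by (intro member_le_sum) (auto intro: less_imp_le)
  then show ?thesis by (simp add: sieve_phi_def)
qed

lemma sieve_weight_empty: "sieve_weight {} = 1"
  using sieve_sum_pos
  by (simp add: sieve_weight_def sieve_sum_def flip: divide_divide_eq_left sum_divide_distrib)

text \<open>The inner sum is a part of \<open>sieve_sum\<close> divided by \<open>sieve_sum\<close>,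
  hence at most 1. This is cruder than the classical bound 1 for the weights, but it costs only
  powers of D in the remainder.\<close>

lemma sieve_weight_abs_le:
  assumes "T \<subseteq> P" shows "\<bar>sieve_weight T\<bar> \<le> real (\<Prod>T)"
proof -
  let ?s = "\<Sum>K\<in>sieve_sets. if T \<subseteq> K then 1 / (sieve_phi K * sieve_sum) else 0"
  have nn: "1 / (sieve_phi K * sieve_sum) \<ge> 0" if "K \<in> sieve_sets" for K
    using sieve_phi_pos[OF sieve_setsD(1)[OF that]] sieve_sum_pos by simp
  have "0 \<le> ?s" using nn by (intro sum_nonneg) auto
  moreover have "?s \<le> (\<Sum>K\<in>sieve_sets. 1 / (sieve_phi K * sieve_sum))" using nn by (intro sum_mono) auto
  moreover have "\<dots> = 1" using sieve_sum_pos
    by (simp add: sieve_sum_def flip: divide_divide_eq_left sum_divide_distrib)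
  ultimately have "\<bar>?s\<bar> \<le> 1" by linarith
  then show ?thesis
    using real_prod_pos[OF assms] unfolding sieve_weight_def abs_mult power_abs
    by (simp del: of_nat_prod add: mult_left_le)
qed

text \<open>Moebius inversion on the lattice of finite sets: the sum factors over the elements of L
  - K, each contributing 1 - 1 = 0.\<close>

lemma alternating_sum_interval:
  fixes K L :: "nat set"
  assumes "finite L" "K \<subseteq> L"
  shows "(\<Sum>T | K \<subseteq> T \<and> T \<subseteq> L. (-1) ^ card T :: real) = (if K = L then (-1) ^ card K else 0)"
proof -
  have finK: "finite K" using assms finite_subset by auto
  have "(\<Sum>T | K \<subseteq> T \<and> T \<subseteq> L. (-1) ^ card T :: real) = (\<Sum>S\<in>Pow (L - K). (-1) ^ card (K \<union> S))"
    by (rule sum.reindex_bij_witness[where i = "\<lambda>S. K \<union> S" and j = "\<lambda>T. T - K"])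
      (use assms in \<open>auto simp: Un_absorb1\<close>)
  also have "\<dots> = (\<Sum>S\<in>Pow (L - K). (-1) ^ card K * (\<Prod>p\<in>S. -1))"
  proof (intro sum.cong refl)
    fix S assume "S \<in> Pow (L - K)"
    then have "card (K \<union> S) = card K + card S" using assms finK finite_subset[of S "L - K"]
      by (intro card_Un_disjoint) auto
    then show "(-1) ^ card (K \<union> S) = (-1) ^ card K * (\<Prod>p\<in>S. -1 :: real)" by (simp add: power_add)
  qed
  also have "\<dots> = (-1) ^ card K * 0 ^ card (L - K)"
    using assms sum_Pow_prod[of "L - K" "\<lambda>_. -1"] by (simp flip: sum_distrib_left)
  also have "\<dots> = (if K = L then (-1) ^ card K else 0)"
    using assms by (auto simp: card_eq_0_iff)
  finally show ?thesis .
qed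

text \<open>Moebius inversion applied to the definition of the weights. The left side is the
  variable in which the quadratic form becomes diagonal.\<close>

lemma sieve_dual:
  assumes K: "K \<in> sieve_sets"
  shows "(\<Sum>T\<in>sieve_sets. if K \<subseteq> T then sieve_weight T / real (\<Prod>T) else 0)
    = (-1) ^ card K / (sieve_phi K * sieve_sum)"
proof -
  let ?a = "\<lambda>L. 1 / (sieve_phi L * sieve_sum)"
  have "(\<Sum>T\<in>sieve_sets. if K \<subseteq> T then sieve_weight T / real (\<Prod>T) else 0)
      = (\<Sum>T\<in>sieve_sets. \<Sum>L\<in>sieve_sets. if K \<subseteq> T \<and> T \<subseteq> L then ?a L * (-1) ^ card T else 0)"
  proof (intro sum.cong refl)
    fix T assume "T \<in> sieve_sets"
    then have "real (\<Prod>T) \<noteq> 0" using real_prod_pos sieve_setsD by (metis less_irrefl)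
    then have "sieve_weight T / real (\<Prod>T) = (-1) ^ card T * (\<Sum>L\<in>sieve_sets. if T \<subseteq> L then ?a L else 0)"
      unfolding sieve_weight_def by (simp del: of_nat_prod)
    then show "(if K \<subseteq> T then sieve_weight T / real (\<Prod>T) else 0) =
        (\<Sum>L\<in>sieve_sets. if K \<subseteq> T \<and> T \<subseteq> L then ?a L * (-1) ^ card T else 0)"
      by (auto simp: sum_distrib_left intro!: sum.cong)
  qed
  also have "\<dots> = (\<Sum>L\<in>sieve_sets. \<Sum>T\<in>sieve_sets. if K \<subseteq> T \<and> T \<subseteq> L then ?a L * (-1) ^ card T else 0)"
    by (rule sum.swap)
  also have "\<dots> = (\<Sum>L\<in>sieve_sets. if K = L then ?a L * (-1) ^ card K else 0)"
  proof (intro sum.cong refl)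
    fix L assume L: "L \<in> sieve_sets"
    have "(\<Sum>T\<in>sieve_sets. if K \<subseteq> T \<and> T \<subseteq> L then ?a L * (-1) ^ card T else 0)
       = (\<Sum>T | K \<subseteq> T \<and> T \<subseteq> L. ?a L * (-1) ^ card T)"
      using sieve_sets_down[OF L] by (intro sum.mono_neutral_cong_right) auto
    also have "\<dots> = (if K = L then ?a L * (-1) ^ card K else 0)"
    proof (cases "K \<subseteq> L")
      case True
      then show ?thesis using alternating_sum_interval[of L K] sieve_setsD(2)[OF L]
        by (simp flip: sum_divide_distrib)
    next
      case False
      then have e: "{T. K \<subseteq> T \<and> T \<subseteq> L} = {}" "K \<noteq> L" by auto
      then show ?thesis unfolding e by simp
    qed
    finally show "(\<Sum>T\<in>sieve_sets. if K \<subseteq> T \<and> T \<subseteq> L then ?a L * (-1) ^ card T else 0) =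
      (if K = L then ?a L * (-1) ^ card K else 0)" .
  qed
  also have "\<dots> = (-1) ^ card K / (sieve_phi K * sieve_sum)" using K by (simp add: sum.delta)
  finally show ?thesis .
qed

text \<open>Since \<Prod>(T \<union> U) \<Prod>(T \<inter> U) = \<Prod>T \<Prod>U and \<Prod>(T
  \<inter> U) is the sum of \<open>sieve_phi K\<close> over K \<subseteq> T \<inter> U, the form is
  a sum of squares with coefficients \<open>sieve_phi K\<close>. \<open>sieve_dual\<close> evaluates
  the squares.\<close>

lemma sieve_quadratic_form:
  "(\<Sum>T\<in>sieve_sets. \<Sum>U\<in>sieve_sets. sieve_weight T * sieve_weight U / real (\<Prod>(T \<union> U))) = 1 / sieve_sum"
proof -
  let ?w = "\<lambda>T. sieve_weight T / real (\<Prod>T)"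
  have "(\<Sum>T\<in>sieve_sets. \<Sum>U\<in>sieve_sets. sieve_weight T * sieve_weight U / real (\<Prod>(T \<union> U)))
    = (\<Sum>T\<in>sieve_sets. \<Sum>U\<in>sieve_sets. \<Sum>K\<in>sieve_sets.
        sieve_phi K * ((if K \<subseteq> T then ?w T else 0) * (if K \<subseteq> U then ?w U else 0)))"
  proof (intro sum.cong refl)
    fix T U assume TU: "T \<in> sieve_sets" "U \<in> sieve_sets"
    have fin: "finite T" "finite U" using TU sieve_setsD by auto
    have pos: "real (\<Prod>T) > 0" "real (\<Prod>U) > 0" "real (\<Prod>(T \<union> U)) > 0" "real (\<Prod>(T \<inter> U)) > 0"
      by (rule real_prod_pos; use TU sieve_setsD in blast)+
    have "\<Prod>(T \<union> U) * \<Prod>(T \<inter> U) = \<Prod>T * \<Prod>U"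
      using fin by (simp add: prod.union_inter)
    then have "real (\<Prod>(T \<union> U)) * real (\<Prod>(T \<inter> U)) = real (\<Prod>T) * real (\<Prod>U)"
      by (simp only: of_nat_mult[symmetric])
    then have "1 / real (\<Prod>(T \<union> U)) = real (\<Prod>(T \<inter> U)) / (real (\<Prod>T) * real (\<Prod>U))"
      using pos by (simp add: field_simps del: of_nat_prod)
    then have "sieve_weight T * sieve_weight U * (1 / real (\<Prod>(T \<union> U))) = real (\<Prod>(T \<inter> U)) * (?w T * ?w U)"
      by (simp del: of_nat_prod)
    then have "sieve_weight T * sieve_weight U / real (\<Prod>(T \<union> U)) = real (\<Prod>(T \<inter> U)) * (?w T * ?w U)"
      by (simp del: of_nat_prod)
    also have "real (\<Prod>(T \<inter> U)) = (\<Sum>K\<in>Pow (T \<inter> U). sieve_phi K)"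
      using sum_Pow_prod[of "T \<inter> U" "\<lambda>p. real p - 1"] fin by (simp add: sieve_phi_def)
    also have "\<dots> = (\<Sum>K\<in>sieve_sets. if K \<subseteq> T \<and> K \<subseteq> U then sieve_phi K else 0)"
      using sieve_sets_down[OF TU(1)] by (intro sum.mono_neutral_cong_left) auto
    also have "\<dots> * (?w T * ?w U) =
        (\<Sum>K\<in>sieve_sets. sieve_phi K * ((if K \<subseteq> T then ?w T else 0) * (if K \<subseteq> U then ?w U else 0)))"
      by (subst sum_distrib_right) (auto intro!: sum.cong simp del: of_nat_prod)
    finally show "sieve_weight T * sieve_weight U / real (\<Prod>(T \<union> U)) = \<dots>" .
  qed
  also have "\<dots> = (\<Sum>K\<in>sieve_sets. \<Sum>T\<in>sieve_sets. \<Sum>U\<in>sieve_sets.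
        sieve_phi K * ((if K \<subseteq> T then ?w T else 0) * (if K \<subseteq> U then ?w U else 0)))"
    by (subst sum.swap[of _ sieve_sets sieve_sets]) (subst (2) sum.swap, rule refl)
  also have "\<dots> = (\<Sum>K\<in>sieve_sets. sieve_phi K * (\<Sum>T\<in>sieve_sets. if K \<subseteq> T then ?w T else 0)\<^sup>2)"
    unfolding power2_eq_square sum_product by (simp only: sum_distrib_left)
  also have "\<dots> = (\<Sum>K\<in>sieve_sets. 1 / sieve_phi K / sieve_sum ^ 2)"
  proof (intro sum.cong refl)
    fix K assume K: "K \<in> sieve_sets"
    have "sieve_phi K > 0" using sieve_phi_pos sieve_setsD K by blast
    then show "sieve_phi K * (\<Sum>T\<in>sieve_sets. if K \<subseteq> T then ?w T else 0)\<^sup>2 = 1 / sieve_phi K / sieve_sum ^ 2"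
      unfolding sieve_dual[OF K] using sieve_sum_pos by (simp add: power2_eq_square field_simps)
  qed
  also have "\<dots> = sieve_sum / sieve_sum ^ 2" unfolding sum_divide_distrib[symmetric] by (simp only: sieve_sum_def)
  also have "\<dots> = 1 / sieve_sum" using sieve_sum_pos by (simp add: power2_eq_square)
  finally show ?thesis .
qed

text \<open>Distinct sets have distinct products in [1, D], so there are at most D of them, each
  with weight at most D in absolute value.\<close>

lemma sum_abs_sieve_weight: "(\<Sum>T\<in>sieve_sets. \<bar>sieve_weight T\<bar>) \<le> D ^ 2"
proof -
  have "(\<Sum>T\<in>sieve_sets. \<bar>sieve_weight T\<bar>) \<le> (\<Sum>T\<in>sieve_sets. D)"
  proof (rule sum_mono)
    fix T assume T: "T \<in> sieve_sets"
    have "\<bar>sieve_weight T\<bar> \<le> real (\<Prod>T)" using T by (intro sieve_weight_abs_le sieve_setsD)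
    also have "\<dots> \<le> D" using T unfolding sieve_sets_def by blast
    finally show "\<bar>sieve_weight T\<bar> \<le> D" .
  qed
  also have "\<dots> = real (card sieve_sets) * D" by simp
  also have "real (card sieve_sets) \<le> D"
  proof -
    have "card sieve_sets \<le> card {1..nat \<lfloor>D\<rfloor>}"
    proof (rule card_inj_on_le[where f = "\<lambda>T. \<Prod>T"])
      show "inj_on (\<lambda>T. \<Prod>T) sieve_sets"
        using sieve_setsD(2,3) by (intro inj_onI prod_set_primes_inj) blast+
      show "(\<lambda>T. \<Prod>T) ` sieve_sets \<subseteq> {1..nat \<lfloor>D\<rfloor>}"
      proof clarify
        fix T assume T: "T \<in> sieve_sets"
        have "\<Prod>T > 0" using T by (rule sieve_setsD)
        moreover have "\<Prod>T \<le> nat \<lfloor>D\<rfloor>" using T unfolding sieve_sets_def by (intro le_nat_floor) auto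
        ultimately show "\<Prod>T \<in> {1..nat \<lfloor>D\<rfloor>}" by simp
      qed
    qed simp
    then have "card sieve_sets \<le> nat \<lfloor>D\<rfloor>" by simp
    then show ?thesis using D by linarith
  qed
  finally show ?thesis using D by (simp add: power2_eq_square mult_right_mono)
qed

text \<open>The indicator of the unsieved elements is majorized by the square of the sum of the
  weights over all sets T whose primes divide s, which is 1 when T can only be empty. After
  expanding, the main terms form the quadratic form, and the errors, each at most 1, add up to at
  most the square of the total weight.\<close>

theorem selberg_sieve:
  fixes X :: "nat set" and J :: real
  assumes X: "finite X" and J: "J \<ge> 0"
    and cnt: "\<And>U. U \<subseteq> P \<Longrightarrow> \<bar>real (card {s \<in> X. \<forall>p\<in>U. p dvd s}) - J / real (\<Prod>U)\<bar> \<le> 1"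
  shows "real (card {s \<in> X. \<forall>p\<in>P. \<not> p dvd s}) \<le> J / sieve_sum + D ^ 4"
proof -
  let ?l = "\<lambda>T s. if \<forall>p\<in>T. p dvd s then sieve_weight T else 0"
  have "real (card {s \<in> X. \<forall>p\<in>P. \<not> p dvd s}) = (\<Sum>s | s \<in> X \<and> (\<forall>p\<in>P. \<not> p dvd s). 1)" by simp
  also have "\<dots> \<le> (\<Sum>s | s \<in> X \<and> (\<forall>p\<in>P. \<not> p dvd s). (\<Sum>T\<in>sieve_sets. ?l T s)\<^sup>2)"
  proof (intro sum_mono)
    fix s assume s: "s \<in> {s. s \<in> X \<and> (\<forall>p\<in>P. \<not> p dvd s)}"
    have "?l T s = 0" if "T \<in> sieve_sets" "T \<noteq> {}" for T
      using that s sieve_setsD(1)[OF that(1)] by auto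
    then have "(\<Sum>T\<in>sieve_sets. ?l T s) = (\<Sum>T\<in>{{}}. sieve_weight T)"
      using empty_sieve_set by (intro sum.mono_neutral_cong_right) auto
    then show "1 \<le> (\<Sum>T\<in>sieve_sets. ?l T s)\<^sup>2" by (simp add: sieve_weight_empty)
  qed
  also have "\<dots> \<le> (\<Sum>s\<in>X. (\<Sum>T\<in>sieve_sets. ?l T s)\<^sup>2)"
    using X by (intro sum_mono2) auto
  also have "\<dots> = (\<Sum>s\<in>X. \<Sum>T\<in>sieve_sets. \<Sum>U\<in>sieve_sets. ?l T s * ?l U s)"
    by (simp add: power2_eq_square sum_product)
  also have "\<dots> = (\<Sum>T\<in>sieve_sets. \<Sum>U\<in>sieve_sets. \<Sum>s\<in>X. ?l T s * ?l U s)"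
    by (subst sum.swap) (subst (2) sum.swap, rule refl)
  also have "\<dots> = (\<Sum>T\<in>sieve_sets. \<Sum>U\<in>sieve_sets.
      sieve_weight T * sieve_weight U * real (card {s \<in> X. \<forall>p\<in>T \<union> U. p dvd s}))"
  proof (intro sum.cong refl)
    fix T U
    have "(\<Sum>s\<in>X. ?l T s * ?l U s) = (\<Sum>s | s \<in> X \<and> (\<forall>p\<in>T \<union> U. p dvd s). sieve_weight T * sieve_weight U)"
      using X by (intro sum.mono_neutral_cong_right) auto
    then show "(\<Sum>s\<in>X. ?l T s * ?l U s) = sieve_weight T * sieve_weight U * real (card {s \<in> X. \<forall>p\<in>T \<union> U. p dvd s})"
      by simp
  qed
  also have "\<dots> \<le> (\<Sum>T\<in>sieve_sets. \<Sum>U\<in>sieve_sets.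
      J * (sieve_weight T * sieve_weight U / real (\<Prod>(T \<union> U))) + \<bar>sieve_weight T\<bar> * \<bar>sieve_weight U\<bar>)"
  proof (intro sum_mono)
    fix T U assume TU: "T \<in> sieve_sets" "U \<in> sieve_sets"
    let ?n = "real (card {s \<in> X. \<forall>p\<in>T \<union> U. p dvd s})" and ?w = "sieve_weight T * sieve_weight U"
    have "?w * ?n - J * (?w / real (\<Prod>(T \<union> U))) = ?w * (?n - J / real (\<Prod>(T \<union> U)))"
      by (simp add: algebra_simps del: of_nat_prod)
    also have "\<dots> \<le> \<bar>?w\<bar> * \<bar>?n - J / real (\<Prod>(T \<union> U))\<bar>" by (subst abs_mult[symmetric]) (rule abs_ge_self)
    also have "\<dots> \<le> \<bar>?w\<bar> * 1" using TU sieve_setsD by (intro mult_left_mono cnt) auto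
    finally show "?w * ?n \<le> J * (?w / real (\<Prod>(T \<union> U))) + \<bar>sieve_weight T\<bar> * \<bar>sieve_weight U\<bar>"
      by (simp add: abs_mult del: of_nat_prod)
  qed
  also have "\<dots> = J * (1 / sieve_sum) + (\<Sum>T\<in>sieve_sets. \<bar>sieve_weight T\<bar>)\<^sup>2"
    unfolding sieve_quadratic_form[symmetric] power2_eq_square sum_product
    by (simp only: sum.distrib sum_distrib_left)
  also have "\<dots> \<le> J / sieve_sum + (D ^ 2)\<^sup>2"
    using sum_abs_sieve_weight by (intro add_mono power_mono) (auto intro: sum_nonneg)
  finally show ?thesis by simp
qed

lemma sieve_sum_ge: "sieve_sum \<ge> (\<Sum>T\<in>sieve_sets. 1 / real (\<Prod>T))"
  unfolding sieve_sum_def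
proof (intro sum_mono)
  fix T assume T: "T \<in> sieve_sets"
  have "sieve_phi T \<le> real (\<Prod>T)" unfolding sieve_phi_def of_nat_prod
    using T sieve_setsD primeP prime_ge_1_nat by (intro prod_mono) fastforce
  then show "1 / real (\<Prod>T) \<le> 1 / sieve_phi T"
    using sieve_phi_pos sieve_setsD(1)[OF T] by (intro divide_left_mono mult_pos_pos real_prod_pos) auto
qed

end

section \<open>Rough numbers in residue classes\<close>

lemma card_residue_class:
  fixes M b Y :: nat
  assumes "b < M"
  shows "\<bar>real (card {s \<in> {1..Y}. s mod M = b}) - real Y / real M\<bar> \<le> 1"
proof -
  let ?S = "{s \<in> {1..Y}. s mod M = b}"
  have "card ?S \<le> card {0..Y div M}"
  proof (rule card_inj_on_le[where f = "\<lambda>s. s div M"])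
    show "inj_on (\<lambda>s. s div M) ?S"
    proof (rule inj_onI)
      fix s t assume "s \<in> ?S" "t \<in> ?S" "s div M = t div M"
      then show "s = t" using div_mult_mod_eq[of s M] div_mult_mod_eq[of t M] by simp
    qed
  qed (auto intro: div_le_mono)
  then have 1: "real (card ?S) \<le> real (Y div M) + 1" by simp
  have 2: "Y div M \<le> card ?S"
  proof -
    \<comment> \<open>The range starts at 1, so for b = 0 the first member of the class is M and the
      index is shifted by one.\<close>
    let ?I = "if b = 0 then {1..Y div M} else {0..<Y div M}"
    have "card ?I \<le> card ?S"
    proof (rule card_inj_on_le[where f = "\<lambda>k. b + M * k"])
      show "inj_on (\<lambda>k. b + M * k) ?I" using assms by (auto simp: inj_on_def)
      show "(\<lambda>k. b + M * k) ` ?I \<subseteq> ?S"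
      proof clarify
        fix k assume k: "k \<in> ?I"
        have "b + M * k \<le> M * (Y div M)"
        proof (cases "b = 0")
          case True then show ?thesis using k by simp
        next
          case False
          then have "Suc k \<le> Y div M" using k by simp
          then have "M * Suc k \<le> M * (Y div M)" by (rule mult_le_mono2)
          then show ?thesis using assms by simp
        qed
        also have "\<dots> \<le> Y" by simp
        finally have "b + M * k \<le> Y" .
        moreover have "b + M * k \<ge> 1" using k assms by (cases "b = 0") (auto simp: Suc_le_eq)
        ultimately show "b + M * k \<in> {1..Y} \<and> (b + M * k) mod M = b" using assms by simp
      qed
    qed simp
    then show ?thesis by (simp split: if_splits)
  qed
  have M: "real M > 0" using assms by simp
  have dm: "Y div M * M + Y mod M = Y" "Y mod M < M" using assms by auto
  then have "real (Y div M) * real M + real (Y mod M) = real Y" "real (Y mod M) < real M"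
    by (simp_all only: of_nat_less_iff flip: of_nat_mult of_nat_add)
  then have "real (Y div M) * real M \<le> real Y" "real Y \<le> (real (Y div M) + 1) * real M"
    by (simp_all add: distrib_right)
  then have "real (Y div M) \<le> real Y / real M" "real Y / real M \<le> real (Y div M) + 1"
    using M by (simp_all add: pos_le_divide_eq pos_divide_le_eq)
  then show ?thesis using 1 2 by linarith
qed

text \<open>A substitute for r / \<phi>(r), to which it is comparable up to a constant factor. It is
  the loss incurred because primes dividing r cannot be sieved inside a residue class modulo
  r.\<close>

definition radical_factor :: "nat \<Rightarrow> real" where
  "radical_factor r = (\<Prod>p\<in>prime_factors r. 1 + 1 / real p)"

lemma radical_factor_ge_1: "radical_factor r \<ge> 1"
  unfolding radical_factor_def by (rule prod_ge_1) simp

lemma sum_inverse_squares_le: "(\<Sum>k=1..N. 1 / (real k)\<^sup>2) \<le> 2"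
proof -
  have "(\<Sum>k=1..Suc N. 1 / (real k)\<^sup>2) \<le> 2 - 1 / real (Suc N)" for N
  proof (induction N)
    case (Suc N)
    have "1 / (real (Suc (Suc N)))\<^sup>2 \<le> 1 / real (Suc N) - 1 / real (Suc (Suc N))"
    proof -
      define t where "t = real (Suc N)"
      have t: "t > 0" "real (Suc (Suc N)) = t + 1" by (simp_all add: t_def)
      have "1 / (t + 1)\<^sup>2 \<le> 1 / (t * (t + 1))"
        using t by (intro divide_left_mono) (auto simp: power2_eq_square intro!: mult_right_mono)
      also have "\<dots> = 1 / t - 1 / (t + 1)" using t by (simp add: field_simps)
      finally show ?thesis unfolding t(2) by (simp add: t_def)
    qed
    then show ?case using Suc by simp
  qed simp
  then have bound: "(\<Sum>k=1..Suc m. 1 / (real k)\<^sup>2) \<le> 2" for m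
    by (rule order_trans) simp
  show ?thesis using bound by (cases N) auto
qed

lemma squarefree_part_eq_prod:
  fixes n :: nat assumes "n > 0"
  shows "squarefree_part n = \<Prod>(prime_factors (squarefree_part n))"
proof -
  let ?m = "squarefree_part n"
  have "?m = (\<Prod>p\<in>prime_factors ?m. p ^ multiplicity p ?m)"
    by (rule prime_factorization_nat) (metis gr0I squarefree_part_nonzero)
  also have "\<dots> = (\<Prod>p\<in>prime_factors ?m. p)"
  proof (intro prod.cong refl)
    fix p assume p: "p \<in> prime_factors ?m"
    then have "prime p" "p dvd ?m" by auto
    then have "multiplicity p ?m > 0" by (simp add: prime_multiplicity_gt_zero_iff)
    moreover have "multiplicity p ?m \<le> Suc 0" using \<open>prime p\<close> by (rule prime_multiplicity_squarefree_part_le_Suc_0)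
    ultimately have "multiplicity p ?m = 1" by simp
    then show "p ^ multiplicity p ?m = p" by simp
  qed
  finally show ?thesis by simp
qed

text \<open>Every n \<le> D is \<Prod>T \<Prod>U k^2 with T consisting of primes not dividing r and
  U of primes dividing r, from its squarefree and square parts. Hence the harmonic sum, at least ln
  D, is bounded by the product of three sums: over T by \<open>sieve_sum\<close>, over U equal to
  \<open>radical_factor r\<close>, over k at most 2.\<close>

lemma sieve_sum_lower:
  fixes r :: nat
  assumes "D > 1"
  defines "P \<equiv> {p \<in> primes_le D. \<not> p dvd r}"
  assumes "r > 0"
  shows "ln D \<le> 2 * radical_factor r * sieve_sum P D"
proof -
  define N where "N = nat \<lfloor>D\<rfloor>"
  have fin: "finite P" and pr: "\<forall>p\<in>P. prime p" by (auto simp: P_def primes_le_def[of D] intro: finite_subset[OF _ finite_primes_le[of D]])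
  have D: "D \<ge> 1" using assms by simp
  note finS = finite_sieve_sets[OF fin pr D]
  have "real N = of_int \<lfloor>D\<rfloor>" using assms(1) by (simp add: N_def)
  then have "D \<le> real N + 1" by linarith
  then have "ln D \<le> ln (real N + 1)" using assms(1) by simp
  also have "\<dots> \<le> harm N" by (rule ln_le_harm)
  also have "\<dots> = (\<Sum>n=1..N. 1 / real n)" by (simp add: harm_def inverse_eq_divide)
  also have "\<dots> \<le> (\<Sum>(T,U,k)\<in>sieve_sets P D \<times> Pow (prime_factors r) \<times> {1..N}.
      1 / real (\<Prod>T) * (1 / real (\<Prod>U) * (1 / (real k)\<^sup>2)))"
  proof (rule sum_le_included[where i = "\<lambda>(T,U,k). \<Prod>T * (\<Prod>U * k ^ 2)"], goal_cases)
    case 4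
    show ?case
    proof
      fix n assume n: "n \<in> {1..N}"
      let ?m = "squarefree_part n" and ?k = "square_part n"
      define T where "T = prime_factors ?m - prime_factors r"
      define U where "U = prime_factors ?m \<inter> prime_factors r"
      have dec: "n = ?m * ?k ^ 2" by (rule squarefree_decompose)
      have n0: "n > 0" using n by simp
      have "T \<union> U = prime_factors ?m" by (auto simp: T_def U_def)
      then have "?m = \<Prod>(T \<union> U)" using squarefree_part_eq_prod[OF n0] by simp
      also have "\<dots> = \<Prod>T * \<Prod>U" by (rule prod.union_disjoint) (auto simp: T_def U_def)
      finally have m: "?m = \<Prod>T * \<Prod>U" .
      then have eq: "\<Prod>T * (\<Prod>U * ?k ^ 2) = n" using dec by (simp only: mult.assoc)
      have k: "?k \<in> {1..N}"
      proof -
        have "?k > 0" using n0 square_part_0_iff[of n] by (metis gr0I less_irrefl)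
        moreover have "?k dvd n" by (metis dvd_def dvd_trans square_part_square_dvd power2_eq_square dvd_triv_left)
        ultimately show ?thesis using n dvd_imp_le[of ?k n] by auto
      qed
      have nD: "real n \<le> D" using n D by (auto simp: N_def) linarith
      have mn: "?m dvd n" by (metis dec dvd_triv_left)
      have "\<Prod>T dvd n" by (metis eq dvd_triv_left)
      then have "\<Prod>T \<le> n" using n0 by (rule dvd_imp_le)
      then have "real (\<Prod>T) \<le> real n" by (simp only: of_nat_le_iff)
      then have TD: "real (\<Prod>T) \<le> D" using nD by linarith
      have "p \<in> P" if p: "p \<in> T" for p
      proof -
        have pp: "prime p" "p dvd ?m" "\<not> p dvd r"
          using p \<open>r > 0\<close> by (auto simp: T_def prime_factors_dvd)
        then have "p \<le> n" using mn n0 by (meson dvd_imp_le dvd_trans)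
        then have "real p \<le> D" using nD by linarith
        then show ?thesis using pp by (simp add: P_def primes_le_def)
      qed
      then have "T \<subseteq> P" by blast
      then have TS: "T \<in> sieve_sets P D" by (rule sieve_setsI[OF fin pr D _ TD])
      have rn: "real n = real (\<Prod>T) * (real (\<Prod>U) * (real ?k)\<^sup>2)"
        using arg_cong[OF eq[symmetric], of real] by (simp only: of_nat_mult of_nat_power)
      show "\<exists>y\<in>sieve_sets P D \<times> Pow (prime_factors r) \<times> {1..N}.
          (case y of (T, U, k) \<Rightarrow> \<Prod>T * (\<Prod>U * k\<^sup>2)) = n \<and>
          1 / real n \<le> (case y of (T, U, k) \<Rightarrow> 1 / real (\<Prod>T) * (1 / real (\<Prod>U) * (1 / (real k)\<^sup>2)))"
      proof (intro bexI[of _ "(T, U, ?k)"] conjI)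
        show "(T, U, ?k) \<in> sieve_sets P D \<times> Pow (prime_factors r) \<times> {1..N}"
          using TS k by (auto simp: U_def)
        show "(case (T, U, ?k) of (T, U, k) \<Rightarrow> \<Prod>T * (\<Prod>U * k\<^sup>2)) = n" using eq by simp
        show "1 / real n \<le> (case (T, U, ?k) of (T, U, k) \<Rightarrow> 1 / real (\<Prod>T) * (1 / real (\<Prod>U) * (1 / (real k)\<^sup>2)))"
          unfolding rn by (simp del: of_nat_prod)
      qed
    qed
  qed (use finS in \<open>auto intro!: mult_nonneg_nonneg prod_nonneg\<close>)
  also have "\<dots> = (\<Sum>T\<in>sieve_sets P D. 1 / real (\<Prod>T)) *
      ((\<Sum>U\<in>Pow (prime_factors r). 1 / real (\<Prod>U)) * (\<Sum>k=1..N. 1 / (real k)\<^sup>2))"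
    by (simp only: sum_product sum.cartesian_product split_def)
  also have "(\<Sum>U\<in>Pow (prime_factors r). 1 / real (\<Prod>U)) = radical_factor r"
    using sum_Pow_prod[of "prime_factors r" "\<lambda>p. 1 / real p"]
    by (simp add: radical_factor_def prod_dividef)
  also have "(\<Sum>T\<in>sieve_sets P D. 1 / real (\<Prod>T)) * (radical_factor r * (\<Sum>k=1..N. 1 / (real k)\<^sup>2))
     \<le> sieve_sum P D * (radical_factor r * 2)"
    using sum_inverse_squares_le[of N] radical_factor_ge_1[of r] sieve_sum_ge[OF fin pr D] sieve_sum_pos[OF fin pr D]
    by (intro mult_mono) (auto intro!: sum_nonneg mult_nonneg_nonneg)
  finally show ?thesis by (simp add: mult_ac)
qed

text \<open>Only primes not dividing r are sieved, which weakens the condition on s. For these the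
  Chinese remainder theorem merges the class modulo r and the divisibility by \<Prod>U into one
  class modulo r \<Prod>U, counted with error at most 1. The bound z serves both as sieving limit
  and as level D.\<close>

theorem card_rough_residue_class_le:
  fixes r b Y :: nat and z :: real
  assumes z: "z > 1" and r: "r > 0"
  shows "real (card {s \<in> {1..Y}. [s = b] (mod r) \<and> (\<forall>p. prime p \<and> real p \<le> z \<longrightarrow> \<not> p dvd s)})
    \<le> real Y / real r * (2 * radical_factor r / ln z) + z ^ 4"
proof -
  define P where "P = {p \<in> primes_le z. \<not> p dvd r}"
  have fin: "finite P" and pr: "\<forall>p\<in>P. prime p"
    by (auto simp: P_def primes_le_def[of z] intro: finite_subset[OF _ finite_primes_le[of z]])
  have z1: "z \<ge> 1" using z by simp
  define X where "X = {s \<in> {1..Y}. [s = b] (mod r)}"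
  have cnt: "\<bar>real (card {s \<in> X. \<forall>p\<in>U. p dvd s}) - real Y / real r / real (\<Prod>U)\<bar> \<le> 1" if U: "U \<subseteq> P" for U
  proof -
    have finU: "finite U" using U fin finite_subset by blast
    have prU: "prime p" if "p \<in> U" for p using that U pr by blast
    have U0: "\<Prod>U > 0" using prU by (rule prod_set_primes_pos)
    have cop: "coprime r (\<Prod>U)"
    proof (rule prod_coprime_right)
      fix p assume "p \<in> U"
      then have "\<not> p dvd r" "prime p" using U pr by (auto simp: P_def)
      then show "coprime r p" by (simp add: prime_imp_coprime coprime_commute)
    qed
    obtain b' where b': "[b' = b] (mod r)" "[b' = 0] (mod \<Prod>U)"
      using binary_chinese_remainder_nat[OF cop] by blast
    have "{s \<in> X. \<forall>p\<in>U. p dvd s} = {s \<in> {1..Y}. s mod (r * \<Prod>U) = b' mod (r * \<Prod>U)}"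
    proof -
      have "[s = b] (mod r) \<and> (\<forall>p\<in>U. p dvd s) \<longleftrightarrow> [s = b'] (mod r * \<Prod>U)" for s
      proof -
        have "(\<forall>p\<in>U. p dvd s) \<longleftrightarrow> \<Prod>U dvd s"
        proof
          assume a: "\<forall>p\<in>U. p dvd s"
          show "\<Prod>U dvd s"
          proof (rule prod_dvd_of_coprime[OF finU])
            show "\<And>p q. p \<in> U \<Longrightarrow> q \<in> U \<Longrightarrow> p \<noteq> q \<Longrightarrow> coprime p q" using prU by (intro primes_coprime)
          qed (use a in auto)
        next
          assume "\<Prod>U dvd s"
          moreover have "p dvd \<Prod>U" if "p \<in> U" for p using finU that by (rule dvd_prodI[where f = "\<lambda>p. p"])
          ultimately show "\<forall>p\<in>U. p dvd s" by (blast intro: dvd_trans)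
        qed
        also have "\<dots> \<longleftrightarrow> [s = 0] (mod \<Prod>U)" by (simp add: cong_0_iff)
        also have "\<dots> \<longleftrightarrow> [s = b'] (mod \<Prod>U)"
          using b'(2) by (blast intro: cong_sym cong_trans)
        finally have 1: "(\<forall>p\<in>U. p dvd s) \<longleftrightarrow> [s = b'] (mod \<Prod>U)" .
        have 2: "[s = b] (mod r) \<longleftrightarrow> [s = b'] (mod r)" using b'(1) by (blast intro: cong_sym cong_trans)
        show ?thesis unfolding 1 2
          using coprime_cong_mult_nat[OF _ _ cop, of s b'] cong_modulus_mult_nat[of s b' r "\<Prod>U"]
            cong_modulus_mult_nat[of s b' "\<Prod>U" r] by (auto simp: mult.commute)
      qed
      then show ?thesis by (auto simp: X_def cong_def)
    qed
    moreover have "b' mod (r * \<Prod>U) < r * \<Prod>U" using r U0 by simp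
    ultimately show ?thesis
      using card_residue_class[of "b' mod (r * \<Prod>U)" "r * \<Prod>U" Y] by (simp del: of_nat_prod)
  qed
  have "{s \<in> {1..Y}. [s = b] (mod r) \<and> (\<forall>p. prime p \<and> real p \<le> z \<longrightarrow> \<not> p dvd s)} \<subseteq> {s \<in> X. \<forall>p\<in>P. \<not> p dvd s}"
    by (auto simp: X_def P_def primes_le_def)
  then have "card {s \<in> {1..Y}. [s = b] (mod r) \<and> (\<forall>p. prime p \<and> real p \<le> z \<longrightarrow> \<not> p dvd s)}
      \<le> card {s \<in> X. \<forall>p\<in>P. \<not> p dvd s}" by (intro card_mono) (auto simp: X_def)
  then have "real (card {s \<in> {1..Y}. [s = b] (mod r) \<and> (\<forall>p. prime p \<and> real p \<le> z \<longrightarrow> \<not> p dvd s)})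
      \<le> real (card {s \<in> X. \<forall>p\<in>P. \<not> p dvd s})" by simp
  also have "\<dots> \<le> real Y / real r / sieve_sum P z + z ^ 4"
    using cnt by (intro selberg_sieve[OF fin pr z1]) (auto simp: X_def)
  also have "real Y / real r / sieve_sum P z \<le> real Y / real r * (2 * radical_factor r / ln z)"
  proof -
    have "1 / sieve_sum P z \<le> 2 * radical_factor r / ln z"
      using sieve_sum_lower[OF z r] sieve_sum_pos[OF fin pr z1] z by (simp add: field_simps P_def)
    then have "real Y / real r * (1 / sieve_sum P z) \<le> real Y / real r * (2 * radical_factor r / ln z)"
      by (intro mult_left_mono) auto
    then show ?thesis by simp
  qed
  finally show ?thesis by simp
qed

section \<open>Finite Fourier analysis\<close>

definition ee :: "nat \<Rightarrow> int \<Rightarrow> complex" where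
  "ee r k = cis (2 * pi * (of_int k / real r))"

lemma norm_ee [simp]: "norm (ee r k) = 1"
  by (simp add: ee_def)

lemma ee_0 [simp]: "ee r 0 = 1"
  by (simp add: ee_def)

lemma ee_add: "ee r (a + b) = ee r a * ee r b"
  by (simp add: ee_def cis_mult add_divide_distrib distrib_left)

lemma ee_sum: "finite I \<Longrightarrow> ee r (\<Sum>i\<in>I. f i) = (\<Prod>i\<in>I. ee r (f i))"
  by (induction I rule: finite_induct) (auto simp: ee_add)

lemma ee_power: "ee r k ^ n = ee r (int n * k)"
  unfolding ee_def Complex.DeMoivre by (simp add: mult_ac)

lemma cnj_ee: "cnj (ee r k) = ee r (- k)"
  by (simp add: ee_def cis_cnj)

lemma ee_multiple: "r > 0 \<Longrightarrow> int r dvd k \<Longrightarrow> ee r k = 1"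
proof -
  assume "r > 0" "int r dvd k"
  then obtain m where "k = int r * m" by (auto simp: dvd_def)
  then have "ee r k = cis (2 * pi * of_int m)" using \<open>r > 0\<close> by (simp add: ee_def)
  then show ?thesis by (simp only: cis_multiple_2pi Ints_of_int)
qed

text \<open>A weak form of Jordan's inequality. Up to \<pi>/3 the derivative of the difference is at
  least 1/2 - 1/2 = 0; beyond that the value at \<pi>/3 already exceeds \<pi>/4.\<close>

lemma sin_ge_half:
  fixes x :: real
  assumes "0 \<le> x" "x \<le> pi / 2"
  shows "x / 2 \<le> sin x"
proof (cases "x \<le> pi / 3")
  case True
  have "sin 0 - 0 / 2 \<le> sin x - x / 2"
  proof (rule DERIV_nonneg_imp_nondecreasing[OF assms(1)])
    fix t :: real assume t: "0 \<le> t" "t \<le> x"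
    have "cos (pi / 3) \<le> cos t" using t True pi_gt_zero by (intro cos_monotone_0_pi_le) auto
    then have "0 \<le> cos t - 1 / 2" by (simp add: cos_60)
    moreover have "((\<lambda>t. sin t - t / 2) has_real_derivative cos t - 1 / 2) (at t)"
      by (auto intro!: derivative_eq_intros)
    ultimately show "\<exists>y. ((\<lambda>t. sin t - t / 2) has_real_derivative y) (at t) \<and> 0 \<le> y" by blast
  qed
  then show ?thesis by simp
next
  case False
  have "sin (pi / 3) \<le> sin x" using False assms by (intro sin_monotone_2pi_le) auto
  moreover have "sin (pi / 3) = sqrt 3 / 2" by (rule sin_60)
  moreover have "(8/5 :: real) \<le> sqrt 3" by (rule real_le_rsqrt) (simp add: power2_eq_square)
  moreover have "pi < 16/5" using pi_approx by simp
  ultimately show ?thesis using assms by linarith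
qed

lemma norm_one_minus_cis: "norm (1 - cis (2 * t)) = 2 * \<bar>sin t\<bar>"
proof -
  have "(norm (1 - cis (2 * t)))\<^sup>2 = (1 - cos (2 * t))\<^sup>2 + (sin (2 * t))\<^sup>2"
    by (simp add: cmod_power2)
  also have "\<dots> = (2 * \<bar>sin t\<bar>)\<^sup>2"
    using sin_cos_squared_add[of "2 * t"] cos_double_sin[of t] 
    by (simp add: power2_eq_square algebra_simps)
  finally show ?thesis by (rule power2_eq_imp_eq) auto
qed

text \<open>For representatives 0 \<le> h < r this is the distance from h to the nearest multiple of
  r, so that frequencies just below r count as small.\<close>

definition circ_dist :: "nat \<Rightarrow> int \<Rightarrow> int" where
  "circ_dist r h = min h (int r - h)"

lemma norm_one_minus_ee:
  assumes "0 < h" "h < int r"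
  shows "norm (1 - ee r h) \<ge> 2 * of_int (circ_dist r h) / real r"
proof -
  define k where "k = circ_dist r h"
  have k: "k > 0" "2 * k \<le> int r" using assms by (auto simp: k_def circ_dist_def min_def)
  have r: "real r > 0" using assms by simp
  have "\<bar>sin (pi * (of_int h / real r))\<bar> = \<bar>sin (pi * (of_int k / real r))\<bar>"
  proof (cases "h \<le> int r - h")
    case False
    have "pi * (of_int k / real r) = pi - pi * (of_int h / real r)"
      using False r by (simp add: k_def circ_dist_def field_simps)
    then show ?thesis by (simp add: sin_diff)
  qed (simp add: k_def circ_dist_def)
  moreover have "sin (pi * (of_int k / real r)) \<ge> pi * (of_int k / real r) / 2"
  proof (rule sin_ge_half)
    have "real_of_int (2 * k) \<le> real_of_int (int r)" using k(2) by (simp only: of_int_le_iff)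
    then have "of_int k / real r \<le> 1 / 2" using r by (simp add: field_simps)
    then show "pi * (of_int k / real r) \<le> pi / 2" using mult_left_mono[of "of_int k / real r" "1/2" pi] by simp
  qed (use k r in simp)
  moreover have "pi * (of_int k / real r) / 2 \<ge> of_int k / real r"
    using k r pi_ge_two mult_right_mono[of 2 pi "of_int k / real r"] by simp
  ultimately have "of_int k / real r \<le> \<bar>sin (pi * (of_int h / real r))\<bar>" by linarith
  then show ?thesis using norm_one_minus_cis[of "pi * (of_int h / real r)"]
    by (simp add: ee_def k_def mult_ac)
qed

lemma norm_geometric_ee:
  assumes "0 < h" "h < int r"
  shows "norm (\<Sum>j<M. ee r (- h * int j)) \<le> real r / of_int (circ_dist r h)"
proof -
  have k: "circ_dist r h > 0" "real r > 0" using assms by (auto simp: circ_dist_def)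
  have n: "norm (1 - ee r (- h)) \<ge> 2 * of_int (circ_dist r h) / real r"
  proof -
    have "norm (1 - ee r (- h)) = norm (cnj (1 - ee r h))" by (simp add: cnj_ee)
    then show ?thesis using norm_one_minus_ee[OF assms] by (simp only: complex_mod_cnj)
  qed
  moreover have "2 * of_int (circ_dist r h) / real r > 0" using k by simp
  ultimately have n0: "norm (1 - ee r (- h)) > 0" by linarith
  have "(\<Sum>j<M. ee r (- h * int j)) = (\<Sum>j<M. ee r (- h) ^ j)"
    by (simp add: ee_power mult_ac)
  also have "\<dots> = (1 - ee r (- h) ^ M) / (1 - ee r (- h))"
    using n0 by (subst sum_gp_strict) auto
  also have "norm \<dots> \<le> 2 / norm (1 - ee r (- h))"
  proof -
    have "norm (1 - ee r (- h) ^ M) \<le> 2"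
      using norm_triangle_ineq4[of 1 "ee r (- h) ^ M"] by (simp add: norm_power)
    then show ?thesis by (simp add: norm_divide divide_right_mono)
  qed
  also have "\<dots> \<le> 2 / (2 * of_int (circ_dist r h) / real r)"
    using n n0 k by (intro divide_left_mono) auto
  also have "\<dots> = real r / of_int (circ_dist r h)" by simp
  finally show ?thesis .
qed

lemma sum_ee_orthogonal:
  assumes r: "r > 0"
  shows "(\<Sum>h\<in>{0..<int r}. ee r (h * k)) = (if int r dvd k then of_nat r else 0)"
proof (cases "int r dvd k")
  case True
  then have "(\<Sum>h\<in>{0..<int r}. ee r (h * k)) = (\<Sum>h\<in>{0..<int r}. 1)"
    using r by (intro sum.cong refl ee_multiple) auto
  then show ?thesis using True by simp
next
  case False
  define h where "h = k mod int r"
  have "h \<noteq> 0" using False by (simp add: h_def dvd_eq_mod_eq_0)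
  moreover have "0 \<le> h" "h < int r" using r by (simp_all add: h_def)
  ultimately have h: "0 < h" "h < int r" by simp_all
  have per: "ee r k = ee r h"
  proof -
    have "ee r k = ee r (int r * (k div int r)) * ee r h" unfolding h_def ee_add[symmetric] by simp
    then show ?thesis using r by (simp add: ee_multiple)
  qed
  have "ee r h \<noteq> 1"
  proof
    assume "ee r h = 1"
    then have "2 * of_int (circ_dist r h) / real r \<le> 0" using norm_one_minus_ee[OF h] by simp
    moreover have "circ_dist r h > 0" using h by (auto simp: circ_dist_def)
    ultimately show False using r by (simp add: divide_le_0_iff)
  qed
  then have ne: "ee r k \<noteq> 1" using per by simp
  have "(\<Sum>h\<in>{0..<int r}. ee r (h * k)) = (\<Sum>j<r. ee r (int j * k))"
    by (rule sum.reindex_bij_witness[of _ int nat]) auto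
  also have "\<dots> = (\<Sum>j<r. ee r k ^ j)" by (simp add: ee_power)
  also have "\<dots> = (1 - ee r k ^ r) / (1 - ee r k)" using ne by (subst sum_gp_strict) auto
  also have "ee r k ^ r = 1" using r by (simp add: ee_power ee_multiple)
  finally show ?thesis using False by simp
qed

text \<open>
  Convolving an arc with the uniform distribution on \<open>{0..<T}\<close> makes its Fourier coefficients
  decay quadratically so that they are summable up to a logarithm; this plays the role of the Erdos-Turan inequality.
\<close>

definition arc :: "nat \<Rightarrow> int \<Rightarrow> nat \<Rightarrow> int \<Rightarrow> real" where
  "arc r u M x = (if (x - u) mod int r < int M then 1 else 0)"

definition trapezoid :: "nat \<Rightarrow> nat \<Rightarrow> int \<Rightarrow> nat \<Rightarrow> int \<Rightarrow> real" where
  "trapezoid r T u M x = (\<Sum>t<T. arc r u M (x - int t)) / real T"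

lemma trapezoid_bounds: "0 \<le> trapezoid r T u M x" "trapezoid r T u M x \<le> 1"
proof -
  show "0 \<le> trapezoid r T u M x" unfolding trapezoid_def by (intro divide_nonneg_nonneg sum_nonneg) (auto simp: arc_def)
  have "(\<Sum>t<T. arc r u M (x - int t)) \<le> (\<Sum>t<T. 1)" by (intro sum_mono) (simp add: arc_def)
  then show "trapezoid r T u M x \<le> 1" unfolding trapezoid_def by (simp add: divide_le_eq)
qed

lemma arc_of_frac_interval:
  fixes a l :: real
  assumes r: "r > 0" and l: "0 \<le> l" "l \<le> 1"
  obtains u M where "M \<le> r" "\<bar>real M - l * real r\<bar> \<le> 1"
    "\<And>x. (if frac (of_int x / real r - a) \<le> l then 1 else 0) = arc r u M x"
proof -
  \<comment> \<open>The integer \<open>u\<close> is the first numerator not before the left end and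
    \<open>\<theta>\<close> the gap to it. The numerator j steps further lies on the arc exactly
    when j + \<theta> \<le> l r.\<close>
  define u where "u = \<lceil>real r * a\<rceil>"
  define \<theta> where "\<theta> = of_int u - real r * a"
  have \<theta>: "0 \<le> \<theta>" "\<theta> < 1" unfolding \<theta>_def u_def by linarith+
  define M' where "M' = \<lfloor>l * real r - \<theta>\<rfloor> + 1"
  have r0: "real r > 0" using r by simp
  have lr: "0 \<le> l * real r" "l * real r \<le> real r" using l r0 by (auto simp: mult_left_le_one_le)
  have M': "M' \<ge> 0" using \<theta> lr unfolding M'_def by linarith
  have M'2: "\<bar>of_int M' - l * real r\<bar> \<le> 1" using \<theta> unfolding M'_def by linarith
  \<comment> \<open>For l = 1 and \<theta> = 0 the count \<open>M'\<close> is r + 1, one more than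
    there are residues.\<close>
  define M where "M = min r (nat M')"
  have 1: "M \<le> r" by (simp add: M_def)
  have 2: "\<bar>real M - l * real r\<bar> \<le> 1"
  proof (cases "nat M' \<le> r")
    case True
    then have "real M = of_int M'" using M' by (simp add: M_def min_def)
    then show ?thesis using M'2 by simp
  next
    case False
    then have "real M = real r" "real_of_int M' \<ge> real r" using M' by (auto simp: M_def min_def)
    then show ?thesis using lr M'2 by linarith
  qed
  have 3: "(if frac (of_int x / real r - a) \<le> l then 1 else 0) = arc r u M x" for x
  proof -
    define j where "j = (x - u) mod int r"
    have j: "0 \<le> j" "j < int r" using r by (auto simp: j_def)
    then have j': "real_of_int j \<le> real r - 1" by linarith
    have "x - u = int r * ((x - u) div int r) + j" by (simp add: j_def)
    then have "real_of_int (x - u) = real r * of_int ((x - u) div int r) + of_int j"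
      by (metis of_int_add of_int_mult of_int_of_nat_eq)
    then have "of_int x / real r - a - (of_int j + \<theta>) / real r = of_int ((x - u) div int r)"
      using r0 by (simp add: \<theta>_def field_simps)
    then have "frac (of_int x / real r - a) = (of_int j + \<theta>) / real r"
      using j j' \<theta> r0 by (subst frac_unique_iff) auto
    then have "frac (of_int x / real r - a) \<le> l \<longleftrightarrow> of_int j \<le> l * real r - \<theta>"
      using r0 by (simp add: divide_le_eq) linarith
    also have "\<dots> \<longleftrightarrow> j < M'" unfolding M'_def by (simp add: le_floor_iff[symmetric])
    also have "\<dots> \<longleftrightarrow> j < int M" using j M' by (auto simp: M_def)
    finally show ?thesis by (simp add: arc_def j_def)
  qed
  show thesis by (rule that[OF 1 2 3])
qed

lemma abs_divide_diff_le:
  fixes m l r t :: real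
  assumes "r > 0" "\<bar>m - l * r\<bar> \<le> t"
  shows "\<bar>m / r - l\<bar> \<le> t / r"
proof -
  have "m / r - l = (m - l * r) / r" using assms by (simp add: diff_divide_distrib)
  then have "\<bar>m / r - l\<bar> = \<bar>m - l * r\<bar> / r" using assms by simp
  then show ?thesis using assms by (simp add: divide_right_mono)
qed

text \<open>The discrete arc is extended to the left by T - 1 points, so that each of its T
  translates to the right still covers the original arc. If the extension would exceed r points, the
  full circle is taken.\<close>

lemma trapezoid_majorant:
  fixes a l :: real
  assumes r: "r > 0" and l: "0 \<le> l" "l \<le> 1" and T: "T \<ge> 1"
  obtains u M where "M \<le> r" "\<bar>real M / real r - l\<bar> \<le> real T / real r"
    "\<And>x. (if frac (of_int x / real r - a) \<le> l then 1 else 0) \<le> trapezoid r T u M x"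
proof -
  obtain u0 M0 where 0: "M0 \<le> r" "\<bar>real M0 - l * real r\<bar> \<le> 1"
    "\<And>x. (if frac (of_int x / real r - a) \<le> l then 1 else 0) = arc r u0 M0 x"
    by (rule arc_of_frac_interval[OF r l, of a]) (rule that)
  define M where "M = min r (M0 + T - 1)"
  define u where "u = u0 - (int T - 1)"
  have r0: "real r > 0" using r by simp
  have M: "M \<le> r" by (simp add: M_def)
  have lr: "l * real r \<le> real r" using l r0 by (auto simp: mult_left_le_one_le)
  have "\<bar>real M - l * real r\<bar> \<le> real T"
  proof (cases "M0 + T - 1 \<le> r")
    case True
    then have "real M = real M0 + real T - 1" using T by (simp add: M_def min_def of_nat_diff)
    then show ?thesis using 0(2) T by linarith
  next
    case False
    then have "real M = real r" "real r \<le> real M0 + real T - 1" using T by (auto simp: M_def min_def)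
    then show ?thesis using 0(2) lr by linarith
  qed
  with r0 have 2: "\<bar>real M / real r - l\<bar> \<le> real T / real r" by (rule abs_divide_diff_le)
  have "arc r u0 M0 x \<le> trapezoid r T u M x" for x
  proof (cases "(x - u0) mod int r < int M0")
    case True
    have "arc r u M (x - int t) = 1" if t: "t < T" for t
    proof (cases "M = r")
      case True
      then show ?thesis using r by (simp add: arc_def)
    next
      case False
      then have M': "M = M0 + T - 1" "M0 + T - 1 \<le> r" by (auto simp: M_def min_def split: if_splits)
      define j where "j = (x - u0) mod int r"
      have j: "0 \<le> j" "j < int M0" using True r by (auto simp: j_def)
      have "x - int t - u = (x - u0) + (int T - 1 - int t)" by (simp add: u_def)
      then have "(x - int t - u) mod int r = (j + (int T - 1 - int t)) mod int r"
        unfolding j_def by (simp only: mod_add_left_eq)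
      also have "\<dots> = j + (int T - 1 - int t)" using j t M' by (intro mod_pos_pos_trivial) auto
      also have "\<dots> < int M" using j t M' T by (simp add: of_nat_diff)
      finally show ?thesis by (simp add: arc_def)
    qed
    then show ?thesis using T True by (simp add: trapezoid_def arc_def)
  next
    case False
    then show ?thesis using trapezoid_bounds(1)[of r T u M x] by (simp add: arc_def)
  qed
  then show thesis by (intro that[OF M 2]) (simp only: 0(3))
qed

text \<open>The discrete arc is shortened by T - 1 points at its right end, so that all T translates
  remain inside it. Truncated subtraction yields the empty arc, and thus the zero function, when the
  arc is too short.\<close>

lemma trapezoid_minorant:
  fixes a l :: real
  assumes r: "r > 0" and l: "0 \<le> l" "l \<le> 1" and T: "T \<ge> 1"
  obtains u M where "M \<le> r" "\<bar>real M / real r - l\<bar> \<le> real T / real r"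
    "\<And>x. trapezoid r T u M x \<le> (if frac (of_int x / real r - a) \<le> l then 1 else 0)"
proof -
  obtain u M0 where 0: "M0 \<le> r" "\<bar>real M0 - l * real r\<bar> \<le> 1"
    "\<And>x. (if frac (of_int x / real r - a) \<le> l then 1 else 0) = arc r u M0 x"
    by (rule arc_of_frac_interval[OF r l, of a]) (rule that)
  define M where "M = M0 - (T - 1)"
  have r0: "real r > 0" using r by simp
  have M: "M \<le> r" using 0(1) by (simp add: M_def)
  have lr: "0 \<le> l * real r" using l r0 by simp
  have "\<bar>real M - l * real r\<bar> \<le> real T"
  proof (cases "T - 1 \<le> M0")
    case True
    then have "real M = real M0 - (real T - 1)" using T by (simp add: M_def of_nat_diff)
    then show ?thesis using 0(2) T by linarith
  next
    case False
    then have "real M = 0" "real M0 \<le> real T - 1" using T by (auto simp: M_def)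
    then show ?thesis using 0(2) lr by linarith
  qed
  with r0 have 2: "\<bar>real M / real r - l\<bar> \<le> real T / real r" by (rule abs_divide_diff_le)
  have "trapezoid r T u M x \<le> arc r u M0 x" for x
  proof (cases "(x - u) mod int r < int M0")
    case True
    then show ?thesis using trapezoid_bounds(2)[of r T u M x] by (simp add: arc_def)
  next
    case False
    have "arc r u M (x - int t) = 0" if t: "t < T" for t
    proof (rule ccontr)
      assume "arc r u M (x - int t) \<noteq> 0"
      then have lt: "(x - int t - u) mod int r < int M" by (auto simp: arc_def split: if_splits)
      define j where "j = (x - int t - u) mod int r"
      have j: "0 \<le> j" "j < int M" using lt r by (auto simp: j_def)
      have "(x - u) mod int r = (j + int t) mod int r" unfolding j_def by (simp add: mod_simps)
      also have "\<dots> = j + int t" using j t 0(1) M_def by (intro mod_pos_pos_trivial) auto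
      also have "\<dots> < int M0" using j t M_def by linarith
      finally show False using False by simp
    qed
    then have "trapezoid r T u M x = 0" by (simp add: trapezoid_def)
    then show ?thesis by (simp add: arc_def)
  qed
  then show thesis by (intro that[OF M 2]) (simp only: 0(3))
qed

text \<open>The Fourier coefficient of \<open>trapezoid\<close> at h: convolution becomes the
  product of the coefficient of the arc (with a phase for its starting point) and that of the
  uniform distribution on T points.\<close>

definition fcoef :: "nat \<Rightarrow> nat \<Rightarrow> int \<Rightarrow> nat \<Rightarrow> int \<Rightarrow> complex" where
  "fcoef r T u M h = ee r (- h * u) * ((\<Sum>j<M. ee r (- h * int j)) / of_nat r)
     * ((\<Sum>t<T. ee r (- h * int t)) / of_nat T)"

text \<open>A bound for \<open>fcoef\<close> that does not depend on the position or the length of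
  the arc. The first factor bounds the geometric sum of the arc, the minimum bounds the averaging
  over T points trivially or by its geometric sum.\<close>

definition fweight :: "nat \<Rightarrow> nat \<Rightarrow> int \<Rightarrow> real" where
  "fweight r T h = (if h = 0 then 1 else
     1 / of_int (circ_dist r h) * min 1 (real r / (real T * of_int (circ_dist r h))))"

lemma fcoef_0: "r > 0 \<Longrightarrow> T \<ge> 1 \<Longrightarrow> fcoef r T u M 0 = of_real (real M / real r)"
  by (simp add: fcoef_def)

lemma norm_fcoef_le:
  assumes "M \<le> r" "r > 0" "T \<ge> 1" "0 \<le> h" "h < int r"
  shows "norm (fcoef r T u M h) \<le> fweight r T h"
proof (cases "h = 0")
  case True
  then show ?thesis using assms by (simp add: fcoef_0 fweight_def norm_divide)
next
  case False
  then have h: "0 < h" "h < int r" using assms by auto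
  define k where "k = real_of_int (circ_dist r h)"
  have k: "k > 0" using h by (simp add: k_def circ_dist_def)
  have r0: "real r > 0" "real T > 0" using assms by auto
  have a: "norm (\<Sum>j<M. ee r (- h * int j)) / real r \<le> 1 / k"
  proof -
    have "norm (\<Sum>j<M. ee r (- h * int j)) / real r \<le> (real r / k) / real r"
      using norm_geometric_ee[OF h, of M] by (intro divide_right_mono) (auto simp: k_def)
    then show ?thesis using r0 by simp
  qed
  have b: "norm (\<Sum>t<T. ee r (- h * int t)) / real T \<le> real r / (real T * k)"
  proof -
    have "norm (\<Sum>t<T. ee r (- h * int t)) / real T \<le> (real r / k) / real T"
      using norm_geometric_ee[OF h, of T] by (intro divide_right_mono) (auto simp: k_def)
    then show ?thesis by (simp add: mult.commute)
  qed
  have c: "norm (\<Sum>t<T. ee r (- h * int t)) / real T \<le> 1"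
  proof -
    have "norm (\<Sum>t<T. ee r (- h * int t)) \<le> (\<Sum>t<T. 1)"
      by (rule order_trans[OF norm_sum]) simp
    then show ?thesis using r0 by (simp add: divide_le_eq)
  qed
  have "norm (fcoef r T u M h) = (norm (\<Sum>j<M. ee r (- h * int j)) / real r) * (norm (\<Sum>t<T. ee r (- h * int t)) / real T)"
    by (simp add: fcoef_def norm_mult norm_divide)
  also have "\<dots> \<le> (1 / k) * min 1 (real r / (real T * k))"
    using a b c k by (intro mult_mono) auto
  finally show ?thesis using False by (simp add: fweight_def k_def)
qed

text \<open>Brings the arc into a shape to which orthogonality of characters applies. Because M
  \<le> r, at most one of the summands is nonzero.\<close>

lemma arc_eq_sum:
  assumes "M \<le> r" "r > 0"
  shows "arc r u M x = (\<Sum>j<M. if int r dvd (x - u - int j) then 1 else 0)"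
proof -
  define i where "i = nat ((x - u) mod int r)"
  have i: "int i = (x - u) mod int r" using assms by (simp add: i_def)
  have eq: "int r dvd (x - u - int j) \<longleftrightarrow> j = i" if "j < M" for j
  proof -
    have "int r dvd (x - u - int j) \<longleftrightarrow> (x - u) mod int r = int j mod int r" by (simp add: mod_eq_dvd_iff)
    also have "int j mod int r = int j" using that assms by simp
    finally show ?thesis using i by auto
  qed
  have "(\<Sum>j<M. if int r dvd (x - u - int j) then 1 else 0 :: real) = (\<Sum>j<M. if j = i then 1 else 0)"
    using eq by (intro sum.cong) auto
  also have "\<dots> = (if i < M then 1 else 0)" by simp
  also have "\<dots> = arc r u M x" using i by (simp add: arc_def flip: i)
  finally show ?thesis by simp
qed

lemma trapezoid_fourier:
  assumes "M \<le> r" "r > 0" "T \<ge> 1"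
  shows "complex_of_real (trapezoid r T u M x) = (\<Sum>h\<in>{0..<int r}. fcoef r T u M h * ee r (h * x))"
proof -
  have r0: "(of_nat r :: complex) \<noteq> 0" using assms by simp
  have "complex_of_real (arc r u M y) = (\<Sum>h\<in>{0..<int r}. \<Sum>j<M. ee r (h * (y - u - int j)) / of_nat r)" for y
  proof -
    have "complex_of_real (arc r u M y) = (\<Sum>j<M. if int r dvd (y - u - int j) then 1 else 0)"
      using arc_eq_sum[OF assms(1,2)] by (simp add: if_distrib cong: if_cong)
    also have "\<dots> = (\<Sum>j<M. (\<Sum>h\<in>{0..<int r}. ee r (h * (y - u - int j))) / of_nat r)"
      using r0 by (intro sum.cong refl) (simp add: sum_ee_orthogonal[OF assms(2)])
    also have "\<dots> = (\<Sum>h\<in>{0..<int r}. \<Sum>j<M. ee r (h * (y - u - int j)) / of_nat r)"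
      by (subst sum.swap) (simp add: sum_divide_distrib)
    finally show ?thesis .
  qed
  then have "complex_of_real (trapezoid r T u M x) =
      (\<Sum>t<T. \<Sum>h\<in>{0..<int r}. \<Sum>j<M. ee r (h * (x - int t - u - int j)) / of_nat r) / of_nat T"
    by (simp add: trapezoid_def)
  also have "\<dots> = (\<Sum>h\<in>{0..<int r}. (\<Sum>t<T. \<Sum>j<M. ee r (h * (x - int t - u - int j)) / of_nat r) / of_nat T)"
    by (subst sum.swap) (simp add: sum_divide_distrib)
  also have "\<dots> = (\<Sum>h\<in>{0..<int r}. fcoef r T u M h * ee r (h * x))"
  proof (intro sum.cong refl)
    fix h
    have "ee r (h * (x - int t - u - int j)) = ee r (h * x) * ee r (- h * u) * (ee r (- h * int t) * ee r (- h * int j))" for t j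
    proof -
      have "h * (x - int t - u - int j) = (h * x + - h * u) + (- h * int t + - h * int j)" by (simp add: algebra_simps)
      then show ?thesis by (simp only: ee_add)
    qed
    then have "(\<Sum>t<T. \<Sum>j<M. ee r (h * (x - int t - u - int j)) / of_nat r) =
       ee r (h * x) * ee r (- h * u) * ((\<Sum>t<T. ee r (- h * int t)) * (\<Sum>j<M. ee r (- h * int j))) / of_nat r"
      unfolding sum_product by (simp only: sum_distrib_left sum_divide_distrib)
    then show "(\<Sum>t<T. \<Sum>j<M. ee r (h * (x - int t - u - int j)) / of_nat r) / of_nat T = fcoef r T u M h * ee r (h * x)"
      by (simp add: fcoef_def)
  qed
  finally show ?thesis .
qed

section \<open>Fourier expansion of box masses in dimension n\<close>

abbreviation freqs :: "nat \<Rightarrow> ('n::finite \<Rightarrow> int) set" where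
  "freqs r \<equiv> PiE UNIV (\<lambda>_. {0..<int r})"

definition expsum :: "(nat \<Rightarrow> (int ^ 'n::finite) set) \<Rightarrow> nat \<Rightarrow> ('n \<Rightarrow> int) \<Rightarrow> int \<Rightarrow> complex" where
  "expsum A r h c = (\<Sum>x\<in>crt_set A r. ee r (c * (\<Sum>i\<in>UNIV. h i * x $ i))) / of_nat (rho A r)"

lemma finite_freqs [simp]: "finite (freqs r :: ('n::finite \<Rightarrow> int) set)"
  by (intro finite_PiE) auto

lemma norm_expsum_le: "norm (expsum A r h c) \<le> 1"
proof -
  have "norm (\<Sum>x\<in>crt_set A r. ee r (c * (\<Sum>i\<in>UNIV. h i * x $ i))) \<le> (\<Sum>x\<in>crt_set A r. 1)"
    by (rule order_trans[OF norm_sum]) simp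
  then show ?thesis by (simp add: expsum_def norm_divide rho_def divide_le_eq)
qed

lemma trapezoid_prod_fourier:
  fixes A :: "nat \<Rightarrow> (int ^ 'n::finite) set"
  assumes M: "\<And>i. M i \<le> r" and r: "r > 0" and T: "T \<ge> 1"
  shows "complex_of_real ((\<Sum>x\<in>crt_set A r. \<Prod>i\<in>UNIV. trapezoid r T (u i) (M i) (c * x $ i)) / real (rho A r))
    = (\<Sum>h\<in>freqs r. (\<Prod>i\<in>UNIV. fcoef r T (u i) (M i) (h i)) * expsum A r h c)"
proof -
  have "complex_of_real (\<Sum>x\<in>crt_set A r. \<Prod>i\<in>UNIV. trapezoid r T (u i) (M i) (c * x $ i))
      = (\<Sum>x\<in>crt_set A r. \<Sum>h\<in>freqs r. (\<Prod>i\<in>UNIV. fcoef r T (u i) (M i) (h i)) * ee r (c * (\<Sum>i\<in>UNIV. h i * x $ i)))"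
    unfolding of_real_sum
  proof (intro sum.cong refl)
    fix x :: "int ^ 'n"
    have "complex_of_real (\<Prod>i\<in>UNIV. trapezoid r T (u i) (M i) (c * x $ i))
      = (\<Prod>i\<in>UNIV. \<Sum>k\<in>{0..<int r}. fcoef r T (u i) (M i) k * ee r (k * (c * x $ i)))"
      unfolding of_real_prod using M r T by (intro prod.cong refl trapezoid_fourier)
    also have "\<dots> = (\<Sum>h\<in>freqs r. \<Prod>i\<in>UNIV. fcoef r T (u i) (M i) (h i) * ee r (h i * (c * x $ i)))"
      by (rule prod_sum_PiE) auto
    also have "\<dots> = (\<Sum>h\<in>freqs r. (\<Prod>i\<in>UNIV. fcoef r T (u i) (M i) (h i)) * ee r (c * (\<Sum>i\<in>UNIV. h i * x $ i)))"
    proof (intro sum.cong refl)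
      fix h :: "'n \<Rightarrow> int"
      have "c * (\<Sum>i\<in>UNIV. h i * x $ i) = (\<Sum>i\<in>UNIV. h i * (c * x $ i))"
        by (simp add: sum_distrib_left mult_ac)
      then show "(\<Prod>i\<in>UNIV. fcoef r T (u i) (M i) (h i) * ee r (h i * (c * x $ i))) =
          (\<Prod>i\<in>UNIV. fcoef r T (u i) (M i) (h i)) * ee r (c * (\<Sum>i\<in>UNIV. h i * x $ i))"
        by (simp only: prod.distrib ee_sum[OF finite])
    qed
    finally show "complex_of_real (\<Prod>i\<in>UNIV. trapezoid r T (u i) (M i) (c * x $ i)) = \<dots>" .
  qed
  also have "\<dots> = (\<Sum>h\<in>freqs r. \<Sum>x\<in>crt_set A r. (\<Prod>i\<in>UNIV. fcoef r T (u i) (M i) (h i)) * ee r (c * (\<Sum>i\<in>UNIV. h i * x $ i)))"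
    by (rule sum.swap)
  finally show ?thesis
    unfolding of_real_divide of_real_of_nat_eq expsum_def
    by (simp only: sum_distrib_left sum_divide_distrib times_divide_eq_right)
qed

text \<open>The zero frequency carries the main term, the product of the densities M i / r, since
  the normalized exponential sum there equals 1. All other frequencies are estimated
  absolutely.\<close>

lemma trapezoid_prod_mean:
  fixes A :: "nat \<Rightarrow> (int ^ 'n::finite) set"
  assumes M: "\<And>i. M i \<le> r" and r: "r > 0" and T: "T \<ge> 1" and rho: "rho A r \<ge> 1"
  shows "\<bar>(\<Sum>x\<in>crt_set A r. \<Prod>i\<in>UNIV. trapezoid r T (u i) (M i) (c * x $ i)) / real (rho A r)
      - (\<Prod>i\<in>UNIV. real (M i) / real r)\<bar>
    \<le> (\<Sum>h\<in>freqs r - {\<lambda>_. 0}. (\<Prod>i\<in>UNIV. fweight r T (h i)) * norm (expsum A r h c))"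
proof -
  let ?t = "\<lambda>h. (\<Prod>i\<in>UNIV. fcoef r T (u i) (M i) (h i)) * expsum A r h c"
  have z: "(\<lambda>_. 0) \<in> (freqs r :: ('n \<Rightarrow> int) set)" using r by auto
  have e0: "expsum A r (\<lambda>_. 0) c = 1" using rho
    by (cases "crt_set A r = {}") (simp_all add: expsum_def rho_def)
  have "complex_of_real ((\<Sum>x\<in>crt_set A r. \<Prod>i\<in>UNIV. trapezoid r T (u i) (M i) (c * x $ i)) / real (rho A r)
      - (\<Prod>i\<in>UNIV. real (M i) / real r)) = (\<Sum>h\<in>freqs r. ?t h) - (\<Prod>i\<in>UNIV. complex_of_real (real (M i) / real r))"
    unfolding of_real_diff trapezoid_prod_fourier[where M = M, OF M r T] of_real_prod ..
  also have "(\<Sum>h\<in>freqs r. ?t h) = ?t (\<lambda>_. 0) + (\<Sum>h\<in>freqs r - {\<lambda>_. 0}. ?t h)"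
    using z by (intro sum.remove) auto
  also have "?t (\<lambda>_. 0) = (\<Prod>i\<in>UNIV. complex_of_real (real (M i) / real r))"
    using e0 r T by (simp add: fcoef_0)
  finally have eq: "complex_of_real ((\<Sum>x\<in>crt_set A r. \<Prod>i\<in>UNIV. trapezoid r T (u i) (M i) (c * x $ i)) / real (rho A r)
      - (\<Prod>i\<in>UNIV. real (M i) / real r)) = (\<Sum>h\<in>freqs r - {\<lambda>_. 0}. ?t h)" by simp
  have "\<bar>(\<Sum>x\<in>crt_set A r. \<Prod>i\<in>UNIV. trapezoid r T (u i) (M i) (c * x $ i)) / real (rho A r)
      - (\<Prod>i\<in>UNIV. real (M i) / real r)\<bar> = norm (\<Sum>h\<in>freqs r - {\<lambda>_. 0}. ?t h)"
    unfolding eq[symmetric] by (simp only: norm_of_real)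
  also have "\<dots> \<le> (\<Sum>h\<in>freqs r - {\<lambda>_. 0}. norm (?t h))" by (rule norm_sum)
  also have "\<dots> \<le> (\<Sum>h\<in>freqs r - {\<lambda>_. 0}. (\<Prod>i\<in>UNIV. fweight r T (h i)) * norm (expsum A r h c))"
  proof (intro sum_mono)
    fix h :: "'n \<Rightarrow> int" assume "h \<in> freqs r - {\<lambda>_. 0}"
    then have h: "0 \<le> h i" "h i < int r" for i by (auto simp: PiE_iff)
    have "norm (\<Prod>i\<in>UNIV. fcoef r T (u i) (M i) (h i)) \<le> (\<Prod>i\<in>UNIV. fweight r T (h i))"
      unfolding prod_norm[symmetric] using M r T h by (intro prod_mono conjI norm_ge_zero norm_fcoef_le)
    then show "norm (?t h) \<le> (\<Prod>i\<in>UNIV. fweight r T (h i)) * norm (expsum A r h c)"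
      unfolding norm_mult by (intro mult_right_mono) auto
  qed
  finally show ?thesis .
qed

text \<open>The indicator of the box lies between two products of trapezoids; these are nonnegative,
  so the coordinatewise inequalities can be multiplied. Their mean densities differ from the side
  lengths by at most T / r in each coordinate, which accounts for the first error term.\<close>

lemma dil_mass_approx:
  fixes A :: "nat \<Rightarrow> (int ^ 'n::finite) set" and a l :: "real ^ 'n"
  assumes r: "r > 0" and T: "T \<ge> 1" and rho: "rho A r \<ge> 1" and l: "\<And>i. 0 \<le> l $ i \<and> l $ i \<le> 1"
  shows "\<bar>dil_mass A r c a l - (\<Prod>i\<in>UNIV. l $ i)\<bar> \<le> real CARD('n) * (real T / real r)
    + (\<Sum>h\<in>freqs r - {\<lambda>_. 0}. (\<Prod>i\<in>UNIV. fweight r T (h i)) * norm (expsum A r h c))"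
proof -
  let ?S = "\<Sum>h\<in>freqs r - {\<lambda>_. 0}. (\<Prod>i\<in>UNIV. fweight r T (h i)) * norm (expsum A r h c)"
  let ?I = "\<lambda>i x. (if frac (of_int (c * x $ i) / real r - a $ i) \<le> l $ i then 1 else 0 :: real)"
  let ?m = "\<lambda>u M. (\<Sum>x\<in>crt_set A r. \<Prod>i\<in>UNIV. trapezoid r T (u i) (M i) (c * x $ i)) / real (rho A r)"
  have rho0: "real (rho A r) > 0" using rho by simp
  have dm: "dil_mass A r c a l = (\<Sum>x\<in>crt_set A r. \<Prod>i\<in>UNIV. ?I i x) / real (rho A r)"
  proof -
    have "(\<Prod>i\<in>UNIV. ?I i x) = (if \<forall>i. frac (of_int (c * x $ i) / real r - a $ i) \<le> l $ i then 1 else 0)" for x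
    proof (cases "\<forall>i. frac (of_int (c * x $ i) / real r - a $ i) \<le> l $ i")
      case False
      then obtain i where "\<not> frac (of_int (c * x $ i) / real r - a $ i) \<le> l $ i" by blast
      then have "(\<Prod>i\<in>UNIV. ?I i x) = 0" by (intro prod_zero bexI[of _ i]) auto
      then show ?thesis using False by simp
    qed simp
    then have "(\<Sum>x\<in>crt_set A r. \<Prod>i\<in>UNIV. ?I i x) = real (card {x \<in> crt_set A r. \<forall>i. frac (of_int (c * x $ i) / real r - a $ i) \<le> l $ i})"
      by (simp only: sum.If_cases[OF finite_crt_set]) (simp add: Int_def)
    then show ?thesis by (simp add: dil_mass_def)
  qed
  have vol: "\<bar>(\<Prod>i\<in>UNIV. real (M i) / real r) - (\<Prod>i\<in>UNIV. l $ i)\<bar> \<le> real CARD('n) * (real T / real r)"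
    if M: "\<And>i. M i \<le> r" "\<And>i. \<bar>real (M i) / real r - l $ i\<bar> \<le> real T / real r" for M :: "'n \<Rightarrow> nat"
  proof -
    have "norm ((\<Prod>i\<in>UNIV. real (M i) / real r) - (\<Prod>i\<in>UNIV. l $ i)) \<le> (\<Sum>i\<in>UNIV. norm (real (M i) / real r - l $ i))"
      using M(1) l r by (intro norm_prod_diff) (auto simp: divide_le_eq)
    also have "\<dots> \<le> (\<Sum>i\<in>(UNIV :: 'n set). real T / real r)" using M(2) by (intro sum_mono) simp
    finally show ?thesis by simp
  qed
  have "\<exists>u M. M \<le> r \<and> \<bar>real M / real r - l $ i\<bar> \<le> real T / real r \<and>
      (\<forall>x. (if frac (of_int x / real r - a $ i) \<le> l $ i then 1 else 0) \<le> trapezoid r T u M x)" for i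
    by (rule trapezoid_majorant[OF r conjunct1[OF l[of i]] conjunct2[OF l[of i]] T, of "a $ i"]) blast
  then obtain u M where up: "\<And>i. M i \<le> r" "\<And>i. \<bar>real (M i) / real r - l $ i\<bar> \<le> real T / real r"
    "\<And>i x. (if frac (of_int x / real r - a $ i) \<le> l $ i then 1 else 0) \<le> trapezoid r T (u i) (M i) x" by metis
  have "\<exists>u M. M \<le> r \<and> \<bar>real M / real r - l $ i\<bar> \<le> real T / real r \<and>
      (\<forall>x. trapezoid r T u M x \<le> (if frac (of_int x / real r - a $ i) \<le> l $ i then 1 else 0))" for i
    by (rule trapezoid_minorant[OF r conjunct1[OF l[of i]] conjunct2[OF l[of i]] T, of "a $ i"]) blast
  then obtain u' M' where lo: "\<And>i. M' i \<le> r" "\<And>i. \<bar>real (M' i) / real r - l $ i\<bar> \<le> real T / real r"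
    "\<And>i x. trapezoid r T (u' i) (M' i) x \<le> (if frac (of_int x / real r - a $ i) \<le> l $ i then 1 else 0)" by metis
  have "dil_mass A r c a l \<le> ?m u M"
    unfolding dm using rho0
    by (intro divide_right_mono sum_mono prod_mono conjI) (rule up(3) | simp)+
  moreover have "?m u' M' \<le> dil_mass A r c a l"
    unfolding dm using rho0
    by (intro divide_right_mono sum_mono prod_mono conjI) (rule lo(3) trapezoid_bounds(1) | simp)+
  moreover note trapezoid_prod_mean[where M = M and u = u and c = c, OF up(1) r T rho]
    trapezoid_prod_mean[where M = M' and u = u' and c = c, OF lo(1) r T rho] vol[OF up(1,2)] vol[OF lo(1,2)]
  ultimately show ?thesis by linarith
qed

lemma harm_le_ln: "n \<ge> 1 \<Longrightarrow> (harm n :: real) \<le> 1 + ln (real n)"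
  using euler_mascheroni_sequence_decreasing[of 1 n] by (simp add: harm_expand)

text \<open>Bounds the total of \<open>fweight\<close> over one coordinate: 1 for the zero frequency
  and 2 (1 + ln (1/\<delta>^2) + 2 \<delta>) for the rest, with \<delta> \<le> 1.\<close>

definition wconst :: "real \<Rightarrow> real" where
  "wconst \<delta> = 7 + 2 * ln (1 / \<delta>\<^sup>2)"

text \<open>\<open>\<delta>\<close> is the width of the smoothing and \<open>1 / \<delta>\<^sup>2\<close> the frequency cutoff.\<close>

context
  fixes r T :: nat and \<delta> :: real
  assumes rT: "r > 0" "T \<ge> 1" and \<delta>: "0 < \<delta>" "\<delta> \<le> 1" and \<delta>T: "\<delta> * real r \<le> real T"
begin

definition gw :: "nat \<Rightarrow> real" where "gw k = 1 / real k * min 1 (1 / (\<delta> * real k))"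

lemma fweight_nonneg: "0 \<le> h \<Longrightarrow> h < int r \<Longrightarrow> fweight r T h \<ge> 0"
  by (auto simp: fweight_def circ_dist_def)

lemma fweight_le_gw:
  assumes "1 \<le> h" "h < int r"
  shows "fweight r T h \<le> gw (nat (circ_dist r h))"
proof -
  define k where "k = real_of_int (circ_dist r h)"
  have k: "k > 0" "real (nat (circ_dist r h)) = k" using assms by (auto simp: k_def circ_dist_def)
  have "real r / (real T * k) \<le> 1 / (\<delta> * k)"
    using rT k(1) \<delta> \<delta>T by (simp add: field_simps)
  then have "1 / k * min 1 (real r / (real T * k)) \<le> 1 / k * min 1 (1 / (\<delta> * k))"
    using k(1) by (intro mult_left_mono) auto
  then show ?thesis using assms k unfolding gw_def k(2) by (simp add: fweight_def k_def)
qed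

lemma gw_nonneg: "gw k \<ge> 0"
  using \<delta> by (simp add: gw_def)

text \<open>Here gw k \<le> 1 / (\<delta> k^2), and the sum of 1/k^2 beyond 1/\<delta>^2 is at most
  2 \<delta>^2. This explains the cutoff 1/\<delta>^2: the tail becomes as small as the smoothing
  error.\<close>

lemma gw_tail: "(\<Sum>k | k \<in> {1..<r} \<and> real k > 1 / \<delta>\<^sup>2. gw k) \<le> 2 * \<delta>"
proof -
  define N where "N = nat \<lfloor>1 / \<delta>\<^sup>2\<rfloor>"
  have d: "1 / \<delta>\<^sup>2 \<ge> 1" using \<delta> by (simp add: power_le_one)
  have fl: "\<lfloor>1 / \<delta>\<^sup>2\<rfloor> \<ge> 1" using d by linarith
  then have rN: "real N = of_int \<lfloor>1 / \<delta>\<^sup>2\<rfloor>" by (simp add: N_def)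
  have N1: "N \<ge> 1" using fl by (simp add: N_def nat_le_iff le_nat_iff)
  moreover have "1 / \<delta>\<^sup>2 \<le> 2 * real N" using N1 rN by linarith
  ultimately have N: "N \<ge> 1" "1 / \<delta>\<^sup>2 \<le> 2 * real N" .
  have sub: "{k. k \<in> {1..<r} \<and> real k > 1 / \<delta>\<^sup>2} \<subseteq> {N<..r}"
  proof
    fix k assume k: "k \<in> {k. k \<in> {1..<r} \<and> real k > 1 / \<delta>\<^sup>2}"
    have "real N \<le> 1 / \<delta>\<^sup>2" using d by (simp add: N_def)
    moreover have "1 / \<delta>\<^sup>2 < real k" using k by blast
    ultimately have "real N < real k" by linarith
    then show "k \<in> {N<..r}" using k by simp
  qed
  have tele: "(\<Sum>k\<in>{N<..m}. 1 / (real k)\<^sup>2) \<le> 1 / real N - 1 / real m" if "m \<ge> N" for m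
    using that
  proof (induction m rule: dec_induct)
    case (step m)
    have "{N<..Suc m} = insert (Suc m) {N<..m}" using step by auto
    moreover have "1 / (real (Suc m))\<^sup>2 \<le> 1 / real m - 1 / real (Suc m)"
    proof -
      have m: "real m > 0" using step N by simp
      have "1 / (real m + 1)\<^sup>2 \<le> 1 / (real m * (real m + 1))"
        using m by (intro divide_left_mono) (auto simp: power2_eq_square intro!: mult_right_mono)
      also have "\<dots> = 1 / real m - 1 / (real m + 1)" using m by (simp add: field_simps)
      finally show ?thesis by (simp add: add.commute)
    qed
    ultimately show ?case using step by simp
  qed simp
  have "(\<Sum>k | k \<in> {1..<r} \<and> real k > 1 / \<delta>\<^sup>2. gw k) \<le> (\<Sum>k\<in>{N<..r}. 1 / \<delta> * (1 / (real k)\<^sup>2))"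
  proof (rule sum_le_included[where i = id])
    show "\<forall>k\<in>{k. k \<in> {1..<r} \<and> real k > 1 / \<delta>\<^sup>2}. \<exists>y\<in>{N<..r}. id y = k \<and> gw k \<le> 1 / \<delta> * (1 / (real y)\<^sup>2)"
    proof
      fix k assume k: "k \<in> {k. k \<in> {1..<r} \<and> real k > 1 / \<delta>\<^sup>2}"
      have "gw k \<le> 1 / real k * (1 / (\<delta> * real k))" unfolding gw_def by (intro mult_left_mono) auto
      also have "\<dots> = 1 / \<delta> * (1 / (real k)\<^sup>2)" by (simp add: power2_eq_square)
      finally show "\<exists>y\<in>{N<..r}. id y = k \<and> gw k \<le> 1 / \<delta> * (1 / (real y)\<^sup>2)" using sub k by auto
    qed
  qed (use \<delta> in auto)
  also have "\<dots> = 1 / \<delta> * (\<Sum>k\<in>{N<..r}. 1 / (real k)\<^sup>2)" by (simp only: sum_distrib_left)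
  also have "\<dots> \<le> 1 / \<delta> * (1 / real N)"
  proof (intro mult_left_mono)
    show "(\<Sum>k\<in>{N<..r}. 1 / (real k)\<^sup>2) \<le> 1 / real N"
    proof (cases "N \<le> r")
      case True
      then show ?thesis using tele[of r] by (smt (verit) divide_nonneg_nonneg of_nat_0_le_iff)
    qed simp
  qed (use \<delta> in simp)
  also have "\<dots> \<le> 2 * \<delta>"
  proof -
    have "1 \<le> 2 * real N * \<delta>\<^sup>2" using N(2) \<delta> by (simp add: field_simps)
    then have "1 / real N \<le> 2 * \<delta>\<^sup>2" using N(1) by (simp add: field_simps)
    then have "1 / \<delta> * (1 / real N) \<le> 1 / \<delta> * (2 * \<delta>\<^sup>2)" using \<delta> by (intro mult_left_mono) auto
    also have "\<dots> = 2 * \<delta>" using \<delta> by (simp add: power2_eq_square)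
    finally show ?thesis .
  qed
  finally show ?thesis .
qed

lemma gw_sum: "(\<Sum>k\<in>{1..<r}. gw k) \<le> 1 + ln (1 / \<delta>\<^sup>2) + 2 * \<delta>"
proof -
  define N where "N = nat \<lfloor>1 / \<delta>\<^sup>2\<rfloor>"
  have d: "1 / \<delta>\<^sup>2 \<ge> 1" using \<delta> by (simp add: power_le_one)
  then have N: "N \<ge> 1" "real N \<le> 1 / \<delta>\<^sup>2" unfolding N_def by (simp_all add: le_nat_iff)
  have "(\<Sum>k\<in>{1..<r}. gw k) = (\<Sum>k | k \<in> {1..<r} \<and> real k \<le> 1 / \<delta>\<^sup>2. gw k) + (\<Sum>k | k \<in> {1..<r} \<and> real k > 1 / \<delta>\<^sup>2. gw k)"
    by (subst sum.union_disjoint[symmetric]) (auto intro!: sum.cong)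
  moreover have "(\<Sum>k | k \<in> {1..<r} \<and> real k \<le> 1 / \<delta>\<^sup>2. gw k) \<le> (\<Sum>k=1..N. 1 / real k)"
  proof (rule sum_le_included[where i = id])
    show "\<forall>k\<in>{k. k \<in> {1..<r} \<and> real k \<le> 1 / \<delta>\<^sup>2}. \<exists>y\<in>{1..N}. id y = k \<and> gw k \<le> 1 / real y"
    proof
      fix k assume k: "k \<in> {k. k \<in> {1..<r} \<and> real k \<le> 1 / \<delta>\<^sup>2}"
      have "gw k \<le> 1 / real k * 1" unfolding gw_def by (intro mult_left_mono) auto
      moreover have "k \<le> N" using k unfolding N_def by (intro le_nat_floor) auto
      ultimately show "\<exists>y\<in>{1..N}. id y = k \<and> gw k \<le> 1 / real y" using k by auto
    qed
  qed auto
  moreover have "(\<Sum>k=1..N. 1 / real k) \<le> 1 + ln (1 / \<delta>\<^sup>2)"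
  proof -
    have "(\<Sum>k=1..N. 1 / real k) = harm N" by (simp add: harm_def inverse_eq_divide)
    also have "\<dots> \<le> 1 + ln (real N)" using N(1) by (rule harm_le_ln)
    also have "ln (real N) \<le> ln (1 / \<delta>\<^sup>2)" using N d by (subst ln_le_cancel_iff) auto
    finally show ?thesis by simp
  qed
  ultimately show ?thesis using gw_tail by linarith
qed

text \<open>A distance k is attained only at h = k and h = r - k; the boolean in the index set tells
  which of the two.\<close>

lemma sum_circ_dist_le:
  fixes Q :: "nat \<Rightarrow> bool"
  shows "(\<Sum>h | h \<in> {1..<int r} \<and> Q (nat (circ_dist r h)). gw (nat (circ_dist r h))) \<le> 2 * (\<Sum>k | k \<in> {1..<r} \<and> Q k. gw k)"
proof -
  let ?S = "{h. h \<in> {1..<int r} \<and> Q (nat (circ_dist r h))}"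
  let ?K = "{k. k \<in> {1..<r} \<and> Q k}"
  have "(\<Sum>h\<in>?S. gw (nat (circ_dist r h))) \<le> (\<Sum>y\<in>?K \<times> (UNIV :: bool set). gw (fst y))"
  proof (rule sum_le_included[where i = "\<lambda>(k, b). if b then int k else int r - int k"])
    show "\<forall>h\<in>?S. \<exists>y\<in>?K \<times> UNIV. (case y of (k, b) \<Rightarrow> if b then int k else int r - int k) = h \<and>
        gw (nat (circ_dist r h)) \<le> gw (fst y)"
    proof
      fix h assume h: "h \<in> ?S"
      then have "nat (circ_dist r h) \<in> ?K" by (auto simp: circ_dist_def)
      moreover have "(if h \<le> int r - h then int (nat (circ_dist r h)) else int r - int (nat (circ_dist r h))) = h"
        using h by (auto simp: circ_dist_def)
      ultimately show "\<exists>y\<in>?K \<times> UNIV. (case y of (k, b) \<Rightarrow> if b then int k else int r - int k) = h \<and>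
        gw (nat (circ_dist r h)) \<le> gw (fst y)"
        by (intro bexI[of _ "(nat (circ_dist r h), h \<le> int r - h)"]) auto
    qed
  qed (auto simp: gw_nonneg intro: finite_subset[of _ "{1..<int r}"])
  also have "\<dots> = (\<Sum>k\<in>?K. \<Sum>b\<in>(UNIV :: bool set). gw k)"
    by (simp only: sum.cartesian_product split_def)
  also have "\<dots> = 2 * (\<Sum>k\<in>?K. gw k)" by (simp add: sum_distrib_left)
  finally show ?thesis .
qed

lemma fweight_sum: "(\<Sum>h\<in>{0..<int r}. fweight r T h) \<le> wconst \<delta>"
proof -
  have "{0..<int r} = insert 0 {1..<int r}" using rT by auto
  then have "(\<Sum>h\<in>{0..<int r}. fweight r T h) = 1 + (\<Sum>h\<in>{1..<int r}. fweight r T h)"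
    by (simp add: fweight_def)
  also have "(\<Sum>h\<in>{1..<int r}. fweight r T h) \<le> (\<Sum>h\<in>{1..<int r}. gw (nat (circ_dist r h)))"
    by (intro sum_mono fweight_le_gw) auto
  also have "\<dots> \<le> 2 * (\<Sum>k\<in>{1..<r}. gw k)" 
    using sum_circ_dist_le[of "\<lambda>_. True"] by (simp only: simp_thms Collect_mem_eq)
  also have "\<dots> \<le> 2 * (1 + ln (1 / \<delta>\<^sup>2) + 2 * \<delta>)" using gw_sum by simp
  finally show ?thesis using \<delta> by (simp add: wconst_def)
qed

lemma fweight_tail: "(\<Sum>h | h \<in> {0..<int r} \<and> of_int (circ_dist r h) > 1 / \<delta>\<^sup>2. fweight r T h) \<le> 4 * \<delta>"
proof -
  let ?Q = "\<lambda>k. real k > 1 / \<delta>\<^sup>2"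
  have d: "1 / \<delta>\<^sup>2 > 0" using \<delta> by simp
  have "{h. h \<in> {0..<int r} \<and> of_int (circ_dist r h) > 1 / \<delta>\<^sup>2} = {h. h \<in> {1..<int r} \<and> ?Q (nat (circ_dist r h))}"
  proof -
    have "h \<ge> 1 \<and> real (nat (circ_dist r h)) = of_int (circ_dist r h)" if "h \<in> {0..<int r}" "of_int (circ_dist r h) > 1 / \<delta>\<^sup>2" for h
    proof -
      have "real_of_int (circ_dist r h) > 0" using that(2) d by linarith
      then show ?thesis using that(1) by (auto simp: circ_dist_def)
    qed
    moreover have "real (nat (circ_dist r h)) = of_int (circ_dist r h)" if "h \<in> {1..<int r}" for h
      using that by (auto simp: circ_dist_def)
    ultimately show ?thesis by fastforce
  qed
  then have "(\<Sum>h | h \<in> {0..<int r} \<and> of_int (circ_dist r h) > 1 / \<delta>\<^sup>2. fweight r T h)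
     = (\<Sum>h | h \<in> {1..<int r} \<and> ?Q (nat (circ_dist r h)). fweight r T h)" by simp
  also have "\<dots> \<le> (\<Sum>h | h \<in> {1..<int r} \<and> ?Q (nat (circ_dist r h)). gw (nat (circ_dist r h)))"
    by (intro sum_mono fweight_le_gw) auto
  also have "\<dots> \<le> 2 * (\<Sum>k | k \<in> {1..<r} \<and> ?Q k. gw k)" by (rule sum_circ_dist_le)
  also have "\<dots> \<le> 4 * \<delta>" using gw_tail by simp
  finally show ?thesis .
qed

lemma wconst_ge_1: "wconst \<delta> \<ge> 1"
proof -
  have "1 / \<delta>\<^sup>2 \<ge> 1" using \<delta> by (simp add: power_le_one)
  then have "ln (1 / \<delta>\<^sup>2) \<ge> 0" by (rule ln_ge_zero)
  then show ?thesis by (simp add: wconst_def)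
qed

lemma fweight_prod_sum:
  "(\<Sum>h\<in>(freqs r :: ('n::finite \<Rightarrow> int) set). \<Prod>i\<in>UNIV. fweight r T (h i)) \<le> wconst \<delta> ^ CARD('n)"
proof -
  have "(\<Sum>h\<in>(freqs r :: ('n \<Rightarrow> int) set). \<Prod>i\<in>UNIV. fweight r T (h i)) = (\<Prod>i\<in>(UNIV :: 'n set). \<Sum>k\<in>{0..<int r}. fweight r T k)"
    by (rule prod_sum_PiE[symmetric]) auto
  also have "\<dots> \<le> (\<Prod>i\<in>(UNIV :: 'n set). wconst \<delta>)"
    using fweight_sum by (intro prod_mono) (auto intro!: sum_nonneg fweight_nonneg)
  finally show ?thesis by simp
qed

text \<open>Union over the coordinate i at which the frequency is large: that coordinate contributes
  a tail of at most 4 \<delta>, each of the others at most \<open>wconst \<delta>\<close>.\<close>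

lemma fweight_prod_tail:
  "(\<Sum>h | h \<in> (freqs r :: ('n::finite \<Rightarrow> int) set) \<and> (\<exists>i. of_int (circ_dist r (h i)) > 1 / \<delta>\<^sup>2). \<Prod>i\<in>UNIV. fweight r T (h i))
    \<le> real CARD('n) * (4 * \<delta> * wconst \<delta> ^ CARD('n))"
proof -
  let ?B = "\<lambda>i j. if j = i then {h. h \<in> {0..<int r} \<and> of_int (circ_dist r h) > 1 / \<delta>\<^sup>2} else {0..<int r}"
  let ?w = "\<lambda>h :: 'n \<Rightarrow> int. \<Prod>i\<in>UNIV. fweight r T (h i)"
  have w0: "?w h \<ge> 0" if "h \<in> freqs r" for h
    using that by (intro prod_nonneg) (auto simp: PiE_iff intro!: fweight_nonneg)
  have f0: "finite {h. h \<in> {0..<int r} \<and> of_int (circ_dist r h) > 1 / \<delta>\<^sup>2}"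
    by (rule finite_subset[of _ "{0..<int r}"]) auto
  then have fin: "finite (?B i j)" for i j by (cases "j = i") (simp_all only: if_True if_False refl simp_thms finite_atLeastLessThan_int)
  have sub: "PiE UNIV (?B i) \<subseteq> freqs r" for i by (intro PiE_mono) auto
  have "(\<Sum>h | h \<in> freqs r \<and> (\<exists>i. of_int (circ_dist r (h i)) > 1 / \<delta>\<^sup>2). ?w h) \<le> (\<Sum>(i,h)\<in>(SIGMA i:UNIV. PiE UNIV (?B i)). ?w h)"
  proof (rule sum_le_included[where i = snd])
    show "finite (SIGMA i:UNIV. PiE (UNIV :: 'n set) (?B i))" by (rule finite_SigmaI[OF finite finite_PiE[OF finite fin]])
    show "\<forall>y\<in>(SIGMA i:UNIV. PiE UNIV (?B i)). 0 \<le> (case y of (i, h) \<Rightarrow> ?w h)"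
    proof
      fix y assume "y \<in> (SIGMA i:UNIV. PiE (UNIV :: 'n set) (?B i))"
      then obtain i h where y: "y = (i, h)" "h \<in> PiE UNIV (?B i)" by (rule SigmaE)
      then show "0 \<le> (case y of (i, h) \<Rightarrow> ?w h)" using w0[OF subsetD[OF sub y(2)]] by simp
    qed
    show "\<forall>h\<in>{h. h \<in> freqs r \<and> (\<exists>i. of_int (circ_dist r (h i)) > 1 / \<delta>\<^sup>2)}.
       \<exists>y\<in>(SIGMA i:UNIV. PiE UNIV (?B i)). snd y = h \<and> ?w h \<le> (case y of (i, h) \<Rightarrow> ?w h)"
    proof
      fix h :: "'n \<Rightarrow> int" assume h: "h \<in> {h. h \<in> freqs r \<and> (\<exists>i. of_int (circ_dist r (h i)) > 1 / \<delta>\<^sup>2)}"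
      then obtain i where i: "of_int (circ_dist r (h i)) > 1 / \<delta>\<^sup>2" by blast
      have "h \<in> PiE UNIV (?B i)" using h i by (auto simp: PiE_iff)
      then show "\<exists>y\<in>(SIGMA i:UNIV. PiE UNIV (?B i)). snd y = h \<and> ?w h \<le> (case y of (i, h) \<Rightarrow> ?w h)"
        by (intro bexI[of _ "(i, h)"]) auto
    qed
  qed simp
  also have "\<dots> = (\<Sum>i\<in>UNIV. \<Sum>h\<in>PiE UNIV (?B i). ?w h)"
    by (rule sum.Sigma[symmetric, OF finite]) (rule ballI, rule finite_PiE[OF finite fin])
  also have "\<dots> \<le> (\<Sum>i\<in>(UNIV :: 'n set). 4 * \<delta> * wconst \<delta> ^ CARD('n))"
  proof (intro sum_mono)
    fix i :: 'n
    have "(\<Sum>h\<in>PiE UNIV (?B i). ?w h) = (\<Prod>j\<in>UNIV. \<Sum>k\<in>?B i j. fweight r T k)"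
      by (rule prod_sum_PiE[symmetric]) (rule finite fin)+
    also have "\<dots> = (\<Sum>k\<in>?B i i. fweight r T k) * (\<Prod>j\<in>UNIV - {i}. \<Sum>k\<in>?B i j. fweight r T k)"
      by (intro prod.remove) auto
    also have "(\<Prod>j\<in>UNIV - {i}. \<Sum>k\<in>?B i j. fweight r T k) = (\<Prod>j\<in>UNIV - {i}. \<Sum>k\<in>{0..<int r}. fweight r T k)"
      by (intro prod.cong) auto
    also have "(\<Sum>k\<in>?B i i. fweight r T k) * (\<Prod>j\<in>UNIV - {i}. \<Sum>k\<in>{0..<int r}. fweight r T k) \<le> (4 * \<delta>) * (\<Prod>j\<in>UNIV - {i}. wconst \<delta>)"
    proof (rule mult_mono)
      have s0: "0 \<le> (\<Sum>k\<in>{0..<int r}. fweight r T k)" by (intro sum_nonneg fweight_nonneg) auto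
      show "(\<Sum>k\<in>?B i i. fweight r T k) \<le> 4 * \<delta>" using fweight_tail by simp
      show "(\<Prod>j\<in>UNIV - {i}. \<Sum>k\<in>{0..<int r}. fweight r T k) \<le> (\<Prod>j\<in>UNIV - {i}. wconst \<delta>)"
        using fweight_sum s0 by (intro prod_mono) simp
      show "0 \<le> (\<Prod>j\<in>UNIV - {i}. \<Sum>k\<in>{0..<int r}. fweight r T k)" using s0 by (intro prod_nonneg) simp
      show "0 \<le> 4 * \<delta>" using \<delta> by simp
    qed
    also have "(\<Prod>j\<in>UNIV - {i}. wconst \<delta>) \<le> wconst \<delta> ^ CARD('n)"
      using wconst_ge_1 by (simp add: power_increasing)
    finally show "(\<Sum>h\<in>PiE UNIV (?B i). ?w h) \<le> 4 * \<delta> * wconst \<delta> ^ CARD('n)" using \<delta> by simp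
  qed
  also have "\<dots> = real CARD('n) * (4 * \<delta> * wconst \<delta> ^ CARD('n))" by simp
  finally show ?thesis .
qed

end

section \<open>The second moment of the exponential sums\<close>

definition cong_pairs :: "(nat \<Rightarrow> (int ^ 'n::finite) set) \<Rightarrow> nat \<Rightarrow> ('n \<Rightarrow> int) \<Rightarrow> nat" where
  "cong_pairs A r h = card {(x, y) \<in> crt_set A r \<times> crt_set A r.
     [(\<Sum>i\<in>UNIV. h i * x $ i) = (\<Sum>i\<in>UNIV. h i * y $ i)] (mod int r)}"

text \<open>Expanding the square and summing over c, orthogonality keeps precisely the pairs on
  which the linear form h agrees modulo r.\<close>

lemma sum_norm_expsum_square:
  assumes r: "r > 0" and rho: "rho A r \<ge> 1"
  shows "(\<Sum>c\<in>{0..<int r}. (norm (expsum A r h c))\<^sup>2) = real r * real (cong_pairs A r h) / (real (rho A r))\<^sup>2"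
proof -
  let ?X = "crt_set A r"
  let ?s = "\<lambda>x. (\<Sum>i\<in>UNIV. h i * x $ i)"
  have "complex_of_real (\<Sum>c\<in>{0..<int r}. (norm (expsum A r h c))\<^sup>2) * (of_nat (rho A r))\<^sup>2
     = (\<Sum>c\<in>{0..<int r}. \<Sum>x\<in>?X. \<Sum>y\<in>?X. ee r (c * (?s x - ?s y)))"
    unfolding of_real_sum sum_distrib_right
  proof (intro sum.cong refl)
    fix c
    have "complex_of_real ((norm (expsum A r h c))\<^sup>2) = expsum A r h c * cnj (expsum A r h c)"
      by (rule complex_norm_square)
    then have "complex_of_real ((norm (expsum A r h c))\<^sup>2) * (of_nat (rho A r))\<^sup>2 =
       (\<Sum>x\<in>?X. ee r (c * ?s x)) * (\<Sum>y\<in>?X. ee r (- (c * ?s y)))"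
      using rho by (simp add: expsum_def power2_eq_square cnj_sum cnj_ee)
    also have "\<dots> = (\<Sum>x\<in>?X. \<Sum>y\<in>?X. ee r (c * ?s x) * ee r (- (c * ?s y)))"
      by (rule sum_product)
    also have "\<dots> = (\<Sum>x\<in>?X. \<Sum>y\<in>?X. ee r (c * (?s x - ?s y)))"
      by (simp add: right_diff_distrib flip: ee_add)
    finally show "complex_of_real ((norm (expsum A r h c))\<^sup>2) * (of_nat (rho A r))\<^sup>2 = \<dots>" .
  qed
  also have "\<dots> = (\<Sum>x\<in>?X. \<Sum>y\<in>?X. \<Sum>c\<in>{0..<int r}. ee r (c * (?s x - ?s y)))"
    by (subst sum.swap) (subst (2) sum.swap, rule refl)
  also have "\<dots> = (\<Sum>x\<in>?X. \<Sum>y\<in>?X. if [?s x = ?s y] (mod int r) then of_nat r else 0)"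
    by (simp add: sum_ee_orthogonal[OF r] cong_iff_dvd_diff)
  also have "\<dots> = (\<Sum>p\<in>?X \<times> ?X. if [?s (fst p) = ?s (snd p)] (mod int r) then of_nat r else 0)"
    by (simp only: sum.cartesian_product split_def)
  also have "\<dots> = (\<Sum>p\<in>{p \<in> ?X \<times> ?X. [?s (fst p) = ?s (snd p)] (mod int r)}. of_nat r)"
    by (rule sum.inter_filter[symmetric]) simp
  also have "{p \<in> ?X \<times> ?X. [?s (fst p) = ?s (snd p)] (mod int r)} = {(x, y) \<in> ?X \<times> ?X. [?s x = ?s y] (mod int r)}"
    by auto
  also have "(\<Sum>p\<in>\<dots>. of_nat r) = of_nat r * (of_nat (cong_pairs A r h) :: complex)"
    by (simp only: sum_constant cong_pairs_def mult.commute)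
  finally have "complex_of_real ((\<Sum>c\<in>{0..<int r}. (norm (expsum A r h c))\<^sup>2) * (real (rho A r))\<^sup>2)
     = complex_of_real (real r * real (cong_pairs A r h))" by (simp del: of_real_sum)
  then have "(\<Sum>c\<in>{0..<int r}. (norm (expsum A r h c))\<^sup>2) * (real (rho A r))\<^sup>2 = real r * real (cong_pairs A r h)"
    by (simp only: of_real_eq_iff)
  then show ?thesis using rho by (simp add: eq_divide_eq)
qed

lemma finite_cong_pairs_set:
  "finite {(x, y) \<in> crt_set A r \<times> crt_set (A :: nat \<Rightarrow> (int ^ 'n::finite) set) r. Q x y}"
  by (rule finite_subset[of _ "crt_set A r \<times> crt_set A r"]) auto

text \<open>Reduction modulo r and modulo s maps pairs to pairs of the same kind and is injective by
  the Chinese remainder theorem.\<close>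

lemma cong_pairs_mult_le:
  fixes A :: "nat \<Rightarrow> (int ^ 'n::finite) set"
  assumes "coprime r s" "r > 0" "s > 0"
  shows "cong_pairs A (r * s) h \<le> cong_pairs A r h * cong_pairs A s h"
proof -
  let ?s = "\<lambda>x :: int ^ 'n. (\<Sum>i\<in>UNIV. h i * x $ i)"
  let ?S = "\<lambda>r. {(x, y) \<in> crt_set A r \<times> crt_set A r. [?s x = ?s y] (mod int r)}"
  have red: "[?s (reduce_mod d x) = ?s x] (mod int d)" for d x
    by (intro cong_sum cong_mult cong_refl) (simp add: reduce_mod_def)
  have step: "[?s (reduce_mod d x) = ?s (reduce_mod d y)] (mod int d)"
    if "[?s x = ?s y] (mod int (r * s))" "d dvd r * s" for d x y
  proof -
    have "[?s x = ?s y] (mod int d)" using that by (meson cong_dvd_modulus int_dvd_int_iff)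
    then show ?thesis using red by (meson cong_sym cong_trans)
  qed
  have "card (?S (r * s)) \<le> card (?S r \<times> ?S s)"
  proof (rule card_inj_on_le[where f = "\<lambda>(x, y). ((reduce_mod r x, reduce_mod r y), (reduce_mod s x, reduce_mod s y))"])
    obtain c where c: "[c * int s = 1] (mod int r)" using coprime_inverses_exist assms by blast
    obtain d where d: "[d * int r = 1] (mod int s)"
      using coprime_inverses_exist[of s r] assms by (auto simp: coprime_commute)
    have inj: "x = x'" if "x \<in> crt_set A (r * s)" "x' \<in> crt_set A (r * s)"
      "reduce_mod r x = reduce_mod r x'" "reduce_mod s x = reduce_mod s x'" for x x'
    proof -
      have "x \<in> zmod_vecs (r * s)" "x' \<in> zmod_vecs (r * s)" using that by (auto simp: crt_set_def)
      then show ?thesis using crt_combine_reduce_mod[OF assms c d] that(3,4) by metis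
    qed
    then show "inj_on (\<lambda>(x, y). ((reduce_mod r x, reduce_mod r y), (reduce_mod s x, reduce_mod s y))) (?S (r * s))"
      by (auto simp: inj_on_def)
    show "(\<lambda>(x, y). ((reduce_mod r x, reduce_mod r y), (reduce_mod s x, reduce_mod s y))) ` ?S (r * s) \<subseteq> ?S r \<times> ?S s"
    proof (rule image_subsetI)
      fix z assume "z \<in> ?S (r * s)"
      then obtain x y where z: "z = (x, y)"
        and xy: "x \<in> crt_set A (r * s)" "y \<in> crt_set A (r * s)" "[?s x = ?s y] (mod int (r * s))"
        by (auto simp del: of_nat_mult)
      have "reduce_mod r x \<in> crt_set A r" "reduce_mod r y \<in> crt_set A r"
        "reduce_mod s x \<in> crt_set A s" "reduce_mod s y \<in> crt_set A s"
        using xy(1,2) crt_set_mult_iff[OF assms] by blast+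
      then show "(case z of (x, y) \<Rightarrow> ((reduce_mod r x, reduce_mod r y), (reduce_mod s x, reduce_mod s y))) \<in> ?S r \<times> ?S s"
        using step[OF xy(3), of r] step[OF xy(3), of s] by (simp add: z)
    qed
    show "finite (?S r \<times> ?S s)" by (intro finite_cartesian_product finite_cong_pairs_set)
  qed
  then show ?thesis by (simp add: cong_pairs_def card_cartesian_product)
qed

lemma cong_pairs_le: "cong_pairs A r h \<le> rho A r * rho A r"
proof -
  have "cong_pairs A r h \<le> card (crt_set A r \<times> crt_set A r)"
    unfolding cong_pairs_def by (intro card_mono) auto
  then show ?thesis by (simp add: card_cartesian_product rho_def)
qed

lemma finite_affine_hyperplanes: "finite (affine_hyperplanes p :: (int ^ 'n::finite) set set)"
  by (rule finite_subset[of _ "Pow (zmod_vecs p)"]) (auto simp: affine_hyperplanes_def)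

text \<open>For fixed y the admissible x lie on the affine hyperplane through y with normal vector h
  modulo p, which is nonzero because p does not divide the i-th coordinate of h.\<close>

lemma cong_pairs_prime_le:
  fixes A :: "nat \<Rightarrow> (int ^ 'n::finite) set"
  assumes p: "prime p" and h: "\<not> int p dvd h i"
  shows "cong_pairs A p h \<le> rho A p * max_hyperplane A p"
proof -
  let ?s = "\<lambda>x :: int ^ 'n. (\<Sum>i\<in>UNIV. h i * x $ i)"
  let ?S = "{(x, y) \<in> crt_set A p \<times> crt_set A p. [?s x = ?s y] (mod int p)}"
  have p0: "int p > 0" using p by (simp add: prime_gt_0_nat)
  have le: "card {x \<in> crt_set A p. [?s x = ?s y] (mod int p)} \<le> max_hyperplane A p" for y
  proof -
    define g :: "int ^ 'n" where "g = (\<chi> i. h i mod int p)"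
    define a where "a = ?s y mod int p"
    define H where "H = {x \<in> zmod_vecs p. [(\<Sum>i\<in>UNIV. g $ i * x $ i) = a] (mod int p)}"
    have gh: "[(\<Sum>i\<in>UNIV. g $ i * x $ i) = ?s x] (mod int p)" for x :: "int ^ 'n"
      by (intro cong_sum cong_mult cong_refl) (simp add: g_def)
    have "g \<in> zmod_vecs p" using p0 by (simp add: g_def zmod_vecs_def)
    moreover have "g \<noteq> 0"
    proof
      assume "g = 0"
      then have "g $ i = 0" by simp
      then show False using h by (simp add: g_def dvd_eq_mod_eq_0)
    qed
    moreover have "a \<in> {0..<int p}" using p0 by (simp add: a_def)
    ultimately have "H \<in> affine_hyperplanes p" unfolding affine_hyperplanes_def H_def by blast
    moreover have "{x \<in> crt_set A p. [?s x = ?s y] (mod int p)} = H \<inter> crt_set A p"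
    proof -
      have "[?s x = ?s y] (mod int p) \<longleftrightarrow> [(\<Sum>i\<in>UNIV. g $ i * x $ i) = a] (mod int p)" for x
        using gh[of x] by (simp add: a_def cong_def)
      moreover have "x \<in> zmod_vecs p" if "x \<in> crt_set A p" for x using that by (simp add: crt_set_def)
      ultimately show ?thesis unfolding H_def by blast
    qed
    ultimately show ?thesis
      unfolding max_hyperplane_def using finite_affine_hyperplanes by (auto intro!: Max_ge)
  qed
  have "?S = (\<lambda>(y, x). (x, y)) ` (SIGMA y:crt_set A p. {x \<in> crt_set A p. [?s x = ?s y] (mod int p)})" by auto
  moreover have "finite (SIGMA y:crt_set A p. {x \<in> crt_set A p. [?s x = ?s y] (mod int p)})"
    by (intro finite_SigmaI) auto
  ultimately have "card ?S \<le> card (SIGMA y:crt_set A p. {x \<in> crt_set A p. [?s x = ?s y] (mod int p)})"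
    by (simp only: card_image_le)
  also have "\<dots> = (\<Sum>y\<in>crt_set A p. card {x \<in> crt_set A p. [?s x = ?s y] (mod int p)})"
    by (subst card_SigmaI) auto
  also have "\<dots> \<le> (\<Sum>y\<in>crt_set A p. max_hyperplane A p)" using le by (intro sum_mono)
  finally show ?thesis by (simp add: cong_pairs_def rho_def)
qed

text \<open>The saving is available only at primes exactly dividing the modulus, as
  \<open>max_hyperplane\<close> concerns A_p alone, and only above the frequency cutoff H, where p
  cannot divide all coordinates of the frequency. Elsewhere the trivial factor 1 is used.\<close>

definition hyper_ratio :: "(nat \<Rightarrow> (int ^ 'n::finite) set) \<Rightarrow> real \<Rightarrow> nat \<Rightarrow> nat \<Rightarrow> real" where
  "hyper_ratio A H p v = (if v = 1 \<and> real p > H then real (max_hyperplane A p) / real (rho A p) else 1)"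

lemma hyper_ratio_nonneg: "hyper_ratio A H p v \<ge> 0"
  by (simp add: hyper_ratio_def)

lemma cong_pairs_le_mfun:
  fixes A :: "nat \<Rightarrow> (int ^ 'n::finite) set"
  shows "r > 0 \<Longrightarrow> (\<And>p. p \<in> prime_factors r \<Longrightarrow> real p > H \<Longrightarrow> \<exists>i. \<not> int p dvd h i) \<Longrightarrow>
    real (cong_pairs A r h) \<le> (real (rho A r))\<^sup>2 * mfun (hyper_ratio A H) r"
proof (induction r rule: less_induct)
  case (less r)
  show ?case
  proof (cases "r = 1")
    case True
    then show ?thesis using cong_pairs_le[of A 1 h] by simp
  next
    case False
    then obtain p where p: "prime p" "p dvd r" using prime_factor_nat by blast
    obtain v m where vm: "v = multiplicity p r" "r = p ^ v * m" "m > 0" "m \<le> r" "coprime (p ^ v) m"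
      "\<not> p dvd m" "prime_factors m = prime_factors r - {p}"
      "mfun (hyper_ratio A H) r = (if p dvd r then hyper_ratio A H p v else 1) * mfun (hyper_ratio A H) m"
      by (rule split_prime_power[OF p(1) less.prems(1), where F = "hyper_ratio A H"])
    have "m \<noteq> r" using vm(6) p(2) by blast
    then have mr: "m < r" using vm(4) by simp
    have pr: "p \<in> prime_factors r" using p less.prems(1) by (simp add: prime_factors_dvd)
    have pv: "p ^ v > 0" using p by (simp add: prime_gt_0_nat)
    have IH: "real (cong_pairs A m h) \<le> (real (rho A m))\<^sup>2 * mfun (hyper_ratio A H) m"
      using less.prems(2) vm(7) by (intro less.IH[OF mr vm(3)]) auto
    have P: "real (cong_pairs A (p ^ v) h) \<le> (real (rho A (p ^ v)))\<^sup>2 * hyper_ratio A H p v"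
    proof (cases "v = 1 \<and> real p > H")
      case True
      then obtain i where i: "\<not> int p dvd h i" using less.prems(2)[OF pr] by blast
      have "real (cong_pairs A p h) \<le> real (rho A p * max_hyperplane A p)"
        using cong_pairs_prime_le[where A = A and h = h and i = i, OF p(1) i] by (simp only: of_nat_le_iff)
      also have "\<dots> \<le> (real (rho A p))\<^sup>2 * (real (max_hyperplane A p) / real (rho A p))"
        by (cases "rho A p = 0") (simp_all add: power2_eq_square)
      finally show ?thesis using True by (simp add: hyper_ratio_def)
    next
      case False
      have "real (cong_pairs A (p ^ v) h) \<le> real (rho A (p ^ v) * rho A (p ^ v))"
        using cong_pairs_le by (simp only: of_nat_le_iff)
      moreover have "hyper_ratio A H p v = 1" using False unfolding hyper_ratio_def by (rule if_not_P)
      ultimately show ?thesis by (simp add: power2_eq_square)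
    qed
    have "cong_pairs A r h \<le> cong_pairs A (p ^ v) h * cong_pairs A m h"
      using cong_pairs_mult_le[where A = A and h = h, OF vm(5) pv vm(3)] vm(2) by (simp only:)
    then have "real (cong_pairs A r h) \<le> real (cong_pairs A (p ^ v) h) * real (cong_pairs A m h)"
      by (simp only: of_nat_le_iff flip: of_nat_mult)
    also have "\<dots> \<le> ((real (rho A (p ^ v)))\<^sup>2 * hyper_ratio A H p v) * ((real (rho A m))\<^sup>2 * mfun (hyper_ratio A H) m)"
      using P IH by (intro mult_mono) (auto simp: hyper_ratio_nonneg)
    also have "\<dots> = (real (rho A (p ^ v) * rho A m))\<^sup>2 * mfun (hyper_ratio A H) r"
      using vm(8) p(2) by (simp add: power_mult_distrib mult_ac)
    also have "rho A (p ^ v) * rho A m = rho A r"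
      using rho_mult[OF vm(5) pv vm(3), of A] vm(2) by (simp only:)
    finally show ?thesis .
  qed
qed

text \<open>Cauchy-Schwarz in c passes from the second moment to the first; the square root taken
  here later halves the exponent of the saving.\<close>

lemma sum_norm_expsum_le:
  fixes A :: "nat \<Rightarrow> (int ^ 'n::finite) set"
  assumes r: "r > 0" and rho: "rho A r \<ge> 1"
    and h: "\<And>p. p \<in> prime_factors r \<Longrightarrow> real p > H \<Longrightarrow> \<exists>i. \<not> int p dvd h i"
  shows "(\<Sum>c\<in>{0..<int r}. norm (expsum A r h c)) \<le> real r * sqrt (mfun (hyper_ratio A H) r)"
proof -
  have rho0: "real (rho A r) > 0" using rho by simp
  have "(\<Sum>c\<in>{0..<int r}. norm (expsum A r h c))\<^sup>2 \<le> (\<Sum>c\<in>{0..<int r}. (norm (expsum A r h c))\<^sup>2) * real (card {0..<int r})"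
    by (rule sum_squared_le_sum_of_squares)
  also have "\<dots> = (real r)\<^sup>2 * (real (cong_pairs A r h) / (real (rho A r))\<^sup>2)"
    unfolding sum_norm_expsum_square[OF r rho] by (simp add: power2_eq_square)
  also have "\<dots> \<le> (real r)\<^sup>2 * mfun (hyper_ratio A H) r"
  proof (intro mult_left_mono)
    show "real (cong_pairs A r h) / (real (rho A r))\<^sup>2 \<le> mfun (hyper_ratio A H) r"
      using cong_pairs_le_mfun[where A = A and h = h and H = H, OF r h] rho0 by (simp add: divide_le_eq mult.commute)
  qed simp
  finally have "sqrt ((\<Sum>c\<in>{0..<int r}. norm (expsum A r h c))\<^sup>2) \<le> sqrt ((real r)\<^sup>2 * mfun (hyper_ratio A H) r)"
    by (rule real_sqrt_le_mono)
  then show ?thesis by (simp add: real_sqrt_mult real_sqrt_abs sum_nonneg)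
qed

section \<open>Discrepancy bounds for a dilated set\<close>

definition low_freqs :: "nat \<Rightarrow> real \<Rightarrow> ('n::finite \<Rightarrow> int) set" where
  "low_freqs r H = {h \<in> freqs r - {\<lambda>_. 0}. \<forall>i. of_int (circ_dist r (h i)) \<le> H}"

text \<open>Let h i be nonzero. As p divides r, divisibility of h i by p would pass to r - h i and
  hence to the circular distance, a positive integer that is at most H and thus less than p.\<close>

lemma low_freqs_not_dvd:
  assumes h: "h \<in> low_freqs r H" and p: "p \<in> prime_factors r" "real p > H"
  shows "\<exists>i. \<not> int p dvd h i"
proof -
  obtain i where i: "h i \<noteq> 0" using h by (auto simp: low_freqs_def fun_eq_iff)
  have "h \<in> freqs r" using h by (simp add: low_freqs_def)
  then have "h i \<in> {0..<int r}" by (rule PiE_mem) simp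
  then have hi: "0 < h i" "h i < int r" using i by simp_all
  have "\<not> int p dvd h i"
  proof
    assume d: "int p dvd h i"
    have "int p dvd int r" using p by (auto simp: prime_factors_dvd)
    then have "int p dvd circ_dist r (h i)" using d by (auto simp: circ_dist_def min_def)
    moreover have pos: "circ_dist r (h i) > 0" using hi by (auto simp: circ_dist_def)
    ultimately have "int p \<le> circ_dist r (h i)" by (rule zdvd_imp_le)
    then have "real p \<le> of_int (circ_dist r (h i))" by linarith
    moreover have "of_int (circ_dist r (h i)) \<le> H" using h by (auto simp: low_freqs_def)
    ultimately show False using p by linarith
  qed
  then show ?thesis by blast
qed

definition smooth_width :: "nat \<Rightarrow> real \<Rightarrow> nat" where
  "smooth_width r \<delta> = nat \<lceil>\<delta> * real r\<rceil>"

text \<open>The three terms are the smoothing error, the frequencies beyond the cutoff and the low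
  frequencies. Box and translation have disappeared, and only the last term depends on c, so only it
  has to be averaged.\<close>

definition dil_bound :: "(nat \<Rightarrow> (int ^ 'n::finite) set) \<Rightarrow> real \<Rightarrow> nat \<Rightarrow> int \<Rightarrow> real" where
  "dil_bound A \<delta> r c = real CARD('n) * (\<delta> + 1 / real r) + real CARD('n) * (4 * \<delta> * wconst \<delta> ^ CARD('n))
     + (\<Sum>h\<in>low_freqs r (1 / \<delta>\<^sup>2). (\<Prod>i\<in>UNIV. fweight r (smooth_width r \<delta>) (h i)) * norm (expsum A r h c))"

context
  fixes r :: nat and \<delta> :: real and A :: "nat \<Rightarrow> (int ^ 'n::finite) set"
  assumes r: "r > 0" and \<delta>: "0 < \<delta>" "\<delta> \<le> 1" and rho: "rho A r \<ge> 1"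
begin

lemma smooth_width: "smooth_width r \<delta> \<ge> 1" "\<delta> * real r \<le> real (smooth_width r \<delta>)"
  "real (smooth_width r \<delta>) / real r \<le> \<delta> + 1 / real r"
proof -
  have p: "\<delta> * real r > 0" using r \<delta> by simp
  then have e: "real (smooth_width r \<delta>) = of_int \<lceil>\<delta> * real r\<rceil>" by (simp add: smooth_width_def)
  then show "\<delta> * real r \<le> real (smooth_width r \<delta>)" by linarith
  then show "smooth_width r \<delta> \<ge> 1" using p by (intro leI notI) simp
  have "real (smooth_width r \<delta>) \<le> \<delta> * real r + 1" using e by linarith
  then have "real (smooth_width r \<delta>) / real r \<le> (\<delta> * real r + 1) / real r" by (intro divide_right_mono) auto
  also have "\<dots> = \<delta> + 1 / real r" using r by (simp add: add_divide_distrib)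
  finally show "real (smooth_width r \<delta>) / real r \<le> \<delta> + 1 / real r" .
qed

lemma fweight_prod_nonneg:
  "h \<in> freqs r \<Longrightarrow> (\<Prod>i\<in>UNIV. fweight r (smooth_width r \<delta>) (h i)) \<ge> 0" for h :: "'n \<Rightarrow> int"
  using fweight_nonneg[OF r smooth_width(1) \<delta> smooth_width(2)]
  by (intro prod_nonneg) (auto simp: PiE_iff)

text \<open>Nonzero frequencies are split at the cutoff 1/\<delta>^2. For the high ones the
  exponential sums are bounded by 1 and \<open>fweight_prod_tail\<close> applies; the low ones are
  kept as they are.\<close>

lemma dil_mass_le_dil_bound:
  assumes l: "\<And>i. 0 \<le> l $ i \<and> l $ i \<le> 1"
  shows "\<bar>dil_mass A r c a l - (\<Prod>i\<in>UNIV. l $ i)\<bar> \<le> dil_bound A \<delta> r c"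
proof -
  let ?T = "smooth_width r \<delta>"
  let ?w = "\<lambda>h :: 'n \<Rightarrow> int. \<Prod>i\<in>UNIV. fweight r ?T (h i)"
  let ?t = "\<lambda>h. ?w h * norm (expsum A r h c)"
  let ?B = "{h. h \<in> (freqs r :: ('n \<Rightarrow> int) set) \<and> (\<exists>i. of_int (circ_dist r (h i)) > 1 / \<delta>\<^sup>2)}"
  have "(\<Sum>h\<in>freqs r - {\<lambda>_. 0}. ?t h) \<le> (\<Sum>h\<in>low_freqs r (1 / \<delta>\<^sup>2) \<union> ?B. ?t h)"
  proof (rule sum_mono2)
    show "finite (low_freqs r (1 / \<delta>\<^sup>2) \<union> ?B)" by (rule finite_subset[of _ "freqs r"]) (auto simp: low_freqs_def)
    show "freqs r - {\<lambda>_. 0} \<subseteq> low_freqs r (1 / \<delta>\<^sup>2) \<union> ?B" unfolding low_freqs_def by (auto simp: not_less)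
    fix h :: "'n \<Rightarrow> int" assume "h \<in> low_freqs r (1 / \<delta>\<^sup>2) \<union> ?B - (freqs r - {\<lambda>_. 0})"
    then have "h \<in> freqs r" by (auto simp: low_freqs_def)
    then show "0 \<le> ?t h" by (intro mult_nonneg_nonneg fweight_prod_nonneg) auto
  qed
  also have "\<dots> = (\<Sum>h\<in>low_freqs r (1 / \<delta>\<^sup>2). ?t h) + (\<Sum>h\<in>?B. ?t h)"
  proof (rule sum.union_disjoint)
    show "finite (low_freqs r (1 / \<delta>\<^sup>2) :: ('n \<Rightarrow> int) set)" by (rule finite_subset[of _ "freqs r"]) (auto simp: low_freqs_def)
    show "finite ?B" by (rule finite_subset[of _ "freqs r"]) auto
    have False if h: "h \<in> low_freqs r (1 / \<delta>\<^sup>2)" "h \<in> ?B" for h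
    proof -
      obtain i where "of_int (circ_dist r (h i)) > 1 / \<delta>\<^sup>2" using h(2) by blast
      moreover have "of_int (circ_dist r (h i)) \<le> 1 / \<delta>\<^sup>2" using h(1) unfolding low_freqs_def by blast
      ultimately show False by linarith
    qed
    then show "low_freqs r (1 / \<delta>\<^sup>2) \<inter> ?B = {}" by blast
  qed
  also have "(\<Sum>h\<in>?B. ?t h) \<le> (\<Sum>h\<in>?B. ?w h)"
    by (intro sum_mono mult_left_le norm_expsum_le fweight_prod_nonneg) blast
  also have "\<dots> \<le> real CARD('n) * (4 * \<delta> * wconst \<delta> ^ CARD('n))"
    by (rule fweight_prod_tail[OF r smooth_width(1) \<delta> smooth_width(2)])
  finally have "(\<Sum>h\<in>freqs r - {\<lambda>_. 0}. ?t h) \<le> (\<Sum>h\<in>low_freqs r (1 / \<delta>\<^sup>2). ?t h) + real CARD('n) * (4 * \<delta> * wconst \<delta> ^ CARD('n))"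
    by simp
  moreover have "real CARD('n) * (real ?T / real r) \<le> real CARD('n) * (\<delta> + 1 / real r)"
    using smooth_width(3) by (intro mult_left_mono) auto
  moreover note dil_mass_approx[OF r smooth_width(1) rho l, where a = a and c = c]
  ultimately show ?thesis unfolding dil_bound_def by linarith
qed

lemma dil_bound_nonneg: "dil_bound A \<delta> r c \<ge> 0"
proof -
  have "\<bar>dil_mass A r c 0 0 - (\<Prod>i\<in>UNIV. (0 :: real ^ 'n) $ i)\<bar> \<le> dil_bound A \<delta> r c"
    by (rule dil_mass_le_dil_bound) simp
  then show ?thesis by (rule order_trans[OF abs_ge_zero])
qed

lemma sum_dil_bound_le:
  "(\<Sum>c\<in>{0..<int r}. dil_bound A \<delta> r c) \<le> real r * (real CARD('n) * (\<delta> + 1 / real r)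
     + real CARD('n) * (4 * \<delta> * wconst \<delta> ^ CARD('n))
     + wconst \<delta> ^ CARD('n) * sqrt (mfun (hyper_ratio A (1 / \<delta>\<^sup>2)) r))"
proof -
  let ?T = "smooth_width r \<delta>" and ?H = "1 / \<delta>\<^sup>2"
  let ?w = "\<lambda>h :: 'n \<Rightarrow> int. \<Prod>i\<in>UNIV. fweight r ?T (h i)"
  let ?s = "sqrt (mfun (hyper_ratio A ?H) r)"
  have fin: "finite (low_freqs r ?H :: ('n \<Rightarrow> int) set)" by (rule finite_subset[of _ "freqs r"]) (auto simp: low_freqs_def)
  have sub: "(low_freqs r ?H :: ('n \<Rightarrow> int) set) \<subseteq> freqs r" by (auto simp: low_freqs_def)
  have s0: "?s \<ge> 0" using mfun_nonneg[OF hyper_ratio_nonneg] by simp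
  have "(\<Sum>c\<in>{0..<int r}. \<Sum>h\<in>low_freqs r ?H. ?w h * norm (expsum A r h c))
     = (\<Sum>h\<in>low_freqs r ?H. ?w h * (\<Sum>c\<in>{0..<int r}. norm (expsum A r h c)))"
    by (subst sum.swap) (simp add: sum_distrib_left)
  also have "\<dots> \<le> (\<Sum>h\<in>low_freqs r ?H. ?w h * (real r * ?s))"
  proof (intro sum_mono mult_left_mono)
    fix h :: "'n \<Rightarrow> int" assume h: "h \<in> low_freqs r ?H"
    show "(\<Sum>c\<in>{0..<int r}. norm (expsum A r h c)) \<le> real r * ?s"
      using low_freqs_not_dvd[OF h] by (intro sum_norm_expsum_le r rho)
    show "?w h \<ge> 0" using h sub by (intro fweight_prod_nonneg) auto
  qed
  also have "\<dots> = (\<Sum>h\<in>low_freqs r ?H. ?w h) * (real r * ?s)" by (simp only: sum_distrib_right)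
  also have "\<dots> \<le> wconst \<delta> ^ CARD('n) * (real r * ?s)"
  proof (intro mult_right_mono)
    have "(\<Sum>h\<in>low_freqs r ?H. ?w h) \<le> (\<Sum>h\<in>freqs r. ?w h)"
      using sub fweight_prod_nonneg by (intro sum_mono2) auto
    also have "\<dots> \<le> wconst \<delta> ^ CARD('n)"
      by (rule fweight_prod_sum[OF r smooth_width(1) \<delta> smooth_width(2)])
    finally show "(\<Sum>h\<in>low_freqs r ?H. ?w h) \<le> wconst \<delta> ^ CARD('n)" .
  qed (use s0 in simp)
  finally have "(\<Sum>c\<in>{0..<int r}. \<Sum>h\<in>low_freqs r ?H. ?w h * norm (expsum A r h c))
     \<le> real r * (wconst \<delta> ^ CARD('n) * ?s)" by (simp add: mult_ac)
  then show ?thesis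
    unfolding dil_bound_def by (simp add: sum.distrib distrib_left)
qed

end

section \<open>Moduli with a large smooth part\<close>

lemma mfun_distrib: "mfun (\<lambda>p v. F p v * G p v) q = mfun F q * mfun G q"
  by (simp add: mfun_def prod.distrib)

lemma sqrt_mfun: "sqrt (mfun F q) = mfun (\<lambda>p v. sqrt (F p v)) q"
proof -
  have "sqrt (prod f I) = (\<Prod>i\<in>I. sqrt (f i))" for f :: "nat \<Rightarrow> real" and I
    by (induction I rule: infinite_finite_induct) (auto simp: real_sqrt_mult)
  then show ?thesis by (simp add: mfun_def)
qed

lemma mfun_inverse: "q > 0 \<Longrightarrow> mfun (\<lambda>p v. 1 / real (p ^ v)) q = 1 / real q"
  by (rule multiplicative_eq_mfun[where G = "\<lambda>q. 1 / real q", symmetric]) auto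

lemma radical_factor_eq_mfun: "radical_factor r = mfun (\<lambda>p v. 1 + 1 / real p) r"
  by (simp add: radical_factor_def mfun_def)

text \<open>The indicator of the moduli in multiplicative form. Inserting it as a factor restricts
  Euler product bounds to the moduli, so that only admissible primes enter the exponent.\<close>

definition adm_ind :: "(nat \<Rightarrow> (int ^ 'n::finite) set) \<Rightarrow> nat \<Rightarrow> nat \<Rightarrow> real" where
  "adm_ind A p v = (if rho A (p ^ v) \<ge> 1 then 1 else 0)"

lemma mfun_adm_ind: "q > 0 \<Longrightarrow> mfun (adm_ind A) q = (if rho A q \<ge> 1 then 1 else 0)"
proof -
  assume q: "q > 0"
  have "rho A q \<ge> 1 \<longleftrightarrow> real (rho A q) \<noteq> 0" by (simp add: Suc_le_eq)
  also have "\<dots> \<longleftrightarrow> (\<forall>p\<in>prime_factors q. rho A (p ^ multiplicity p q) \<ge> 1)"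
    unfolding rho_eq_mfun[OF q] mfun_def by (simp add: Suc_le_eq)
  finally have iff: "rho A q \<ge> 1 \<longleftrightarrow> (\<forall>p\<in>prime_factors q. rho A (p ^ multiplicity p q) \<ge> 1)" .
  show ?thesis
  proof (cases "rho A q \<ge> 1")
    case True
    then have "adm_ind A p (multiplicity p q) = 1" if "p \<in> prime_factors q" for p
      using that iff by (simp add: adm_ind_def)
    then show ?thesis using True by (simp add: mfun_def)
  next
    case False
    then obtain p where p: "p \<in> prime_factors q" "\<not> rho A (p ^ multiplicity p q) \<ge> 1" using iff by blast
    have "adm_ind A p (multiplicity p q) = 0" unfolding adm_ind_def by (rule if_not_P[OF p(2)])
    then have "mfun (adm_ind A) q = 0" unfolding mfun_def using p(1) by (intro prod_zero bexI[of _ p]) auto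
    then show ?thesis using False by simp
  qed
qed

section \<open>Smooth parts of moduli and Rankin's trick\<close>

definition smooth_part :: "real \<Rightarrow> nat \<Rightarrow> nat" where
  "smooth_part z q = (\<Prod>p\<in>{p \<in> prime_factors q. real p \<le> z}. p ^ multiplicity p q)"

lemma smooth_part:
  fixes q :: nat and z :: real
  assumes q: "q > 0"
  defines "r \<equiv> smooth_part z q"
  obtains s where "q = r * s" "r > 0" "s > 0" "coprime r s" "prime_factors r \<subseteq> primes_le z"
    "\<And>p. prime p \<Longrightarrow> real p \<le> z \<Longrightarrow> \<not> p dvd s"
proof -
  define s where "s = (\<Prod>p\<in>{p \<in> prime_factors q. \<not> real p \<le> z}. p ^ multiplicity p q)"
  let ?R = "{p \<in> prime_factors q. real p \<le> z}" and ?S = "{p \<in> prime_factors q. \<not> real p \<le> z}"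
  have qrs: "q = r * s"
  proof -
    have "q = (\<Prod>p\<in>prime_factors q. p ^ multiplicity p q)" using q by (rule prime_factorization_nat)
    also have "prime_factors q = ?R \<union> ?S" by auto
    also have "(\<Prod>p\<in>?R \<union> ?S. p ^ multiplicity p q) = r * s"
      unfolding r_def smooth_part_def s_def by (rule prod.union_disjoint) auto
    finally show ?thesis .
  qed
  then have pos: "r > 0" "s > 0" using q by (auto intro: gr0I)
  have cop: "coprime r s"
    unfolding r_def smooth_part_def s_def
  proof (intro prod_coprime_left prod_coprime_right)
    fix p p' assume "p \<in> ?R" "p' \<in> ?S"
    then have "prime p" "prime p'" "p \<noteq> p'" by auto
    then show "coprime (p ^ multiplicity p q) (p' ^ multiplicity p' q)" by (simp add: primes_coprime)
  qed
  have dr: "p \<in> ?R" if "prime p" "p dvd r" for p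
  proof -
    have "\<exists>p'\<in>?R. p dvd p' ^ multiplicity p' q"
      using that unfolding r_def smooth_part_def by (subst (asm) prime_dvd_prod_iff) auto
    then obtain p' where p': "p' \<in> ?R" "p dvd p' ^ multiplicity p' q" by blast
    have "p = p'" using p' that(1) by (intro primes_dvd_imp_eq prime_dvd_power[OF that(1) p'(2)]) auto
    then show ?thesis using p' by simp
  qed
  have ds: "p \<in> ?S" if "prime p" "p dvd s" for p
  proof -
    have "\<exists>p'\<in>?S. p dvd p' ^ multiplicity p' q"
      using that unfolding s_def by (subst (asm) prime_dvd_prod_iff) auto
    then obtain p' where p': "p' \<in> ?S" "p dvd p' ^ multiplicity p' q" by blast
    have "p = p'" using p' that(1) by (intro primes_dvd_imp_eq prime_dvd_power[OF that(1) p'(2)]) auto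
    then show ?thesis using p' by simp
  qed
  have "prime_factors r \<subseteq> primes_le z"
  proof
    fix p assume "p \<in> prime_factors r"
    then have "prime p" "p dvd r" by auto
    then show "p \<in> primes_le z" using dr[of p] by (simp add: primes_le_def)
  qed
  moreover have "\<not> p dvd s" if "prime p" "real p \<le> z" for p using ds[of p] that by auto
  ultimately show thesis using that qrs pos cop by blast
qed

lemma smooth_part_powr:
  "real (smooth_part z q) powr \<epsilon> = mfun (\<lambda>p v. if real p \<le> z then real (p ^ v) powr \<epsilon> else 1) q"
proof -
  have "real (smooth_part z q) powr \<epsilon> = (\<Prod>p\<in>{p \<in> prime_factors q. real p \<le> z}. real (p ^ multiplicity p q) powr \<epsilon>)"
    by (simp add: smooth_part_def prod_powr_distrib prod_nonneg)
  also have "\<dots> = mfun (\<lambda>p v. if real p \<le> z then real (p ^ v) powr \<epsilon> else 1) q"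
    unfolding mfun_def by (intro prod.mono_neutral_cong_left) auto
  finally show ?thesis .
qed

text \<open>With exponent 1 / ln z the factor is exp t for some t in [0,1] whenever p \<le> z, so
  exp t \<le> 1 + t + t^2 applies. The assumption ln z \<ge> 4 keeps the exponent at most 1/4, which
  leaves the decay rate 3/4 at prime powers.\<close>

lemma rankin_factor_le:
  fixes p :: real
  assumes z: "ln z \<ge> 4" "z > 0" and p: "2 \<le> p" "p \<le> z"
  shows "p powr (1 / ln z) \<le> 1 + 2 * (ln p / ln z)" "p powr (1 / ln z) \<le> 3"
    "(p ^ v) powr (1 / ln z) / p ^ v \<le> p powr (- 3/4 * real v)"
proof -
  have lp: "0 \<le> ln p" "ln p \<le> ln z" using p by auto
  define t where "t = ln p / ln z"
  have lz: "ln z > 0" using z by linarith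
  have t: "0 \<le> t" "t \<le> 1" using lp lz by (simp_all add: t_def)
  have "p powr (1 / ln z) = exp t" using p by (simp add: powr_def t_def)
  also have "\<dots> \<le> 1 + t + t\<^sup>2" using t by (intro exp_bound)
  also have "\<dots> \<le> 1 + 2 * t" using t by (simp add: power2_eq_square mult_left_le_one_le)
  finally show 1: "p powr (1 / ln z) \<le> 1 + 2 * (ln p / ln z)" by (simp add: t_def)
  then show "p powr (1 / ln z) \<le> 3" using t by (simp add: t_def)
  have "(p ^ v) powr (1 / ln z) / p ^ v = p powr (real v * (1 / ln z) - real v)"
    using p by (simp add: powr_realpow[symmetric] powr_powr powr_diff)
  also have "\<dots> \<le> p powr (- 3/4 * real v)"
  proof (intro powr_mono)
    have "1 / ln z \<le> 1 / 4" using le_imp_inverse_le[of 4 "ln z"] z by (simp add: inverse_eq_divide)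
    then have "real v * (1 / ln z) \<le> real v * (1 / 4)" by (intro mult_left_mono) auto
    then show "real v * (1 / ln z) - real v \<le> - 3/4 * real v" by linarith
  qed (use p in simp)
  finally show "(p ^ v) powr (1 / ln z) / p ^ v \<le> p powr (- 3/4 * real v)" .
qed

text \<open>Prime power values of the function that is (smooth part of q) powr (1 / ln z) at moduli
  q and 0 elsewhere.\<close>

definition rankin_weight :: "(nat \<Rightarrow> (int ^ 'n::finite) set) \<Rightarrow> real \<Rightarrow> nat \<Rightarrow> nat \<Rightarrow> real" where
  "rankin_weight A z p v = adm_ind A p v * (if real p \<le> z then real (p ^ v) powr (1 / ln z) else 1)"

lemma rankin_weight_nonneg: "rankin_weight A z p v \<ge> 0"
  by (simp add: rankin_weight_def adm_ind_def)

lemma mfun_rankin_weight: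
  "q > 0 \<Longrightarrow> mfun (rankin_weight A z) q = (if rho A q \<ge> 1 then real (smooth_part z q) powr (1 / ln z) else 0)"
  unfolding rankin_weight_def mfun_distrib by (simp add: mfun_adm_ind smooth_part_powr[symmetric])

lemma powr_three_quarters: "p \<ge> (1::real) \<Longrightarrow> 1 / p ^ v \<le> p powr (- 3/4 * real v)"
proof -
  assume p: "p \<ge> 1"
  have "1 / p ^ v = p powr (- real v)" using p by (simp add: powr_minus powr_realpow divide_inverse)
  also have "\<dots> \<le> p powr (- 3/4 * real v)" using p by (intro powr_mono) auto
  finally show ?thesis .
qed

lemma rankin_weight_div_le:
  assumes z: "ln z \<ge> 4" "z > 0" and p: "prime p"
  shows "rankin_weight A z p v / real (p ^ v) \<le> real p powr (- 3/4 * real v)"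
proof -
  have p2: "real p \<ge> 2" using prime_ge_2_nat[OF p] by simp
  have le1: "rankin_weight A z p v \<le> (if real p \<le> z then real (p ^ v) powr (1 / ln z) else 1)"
    by (simp add: rankin_weight_def adm_ind_def)
  have "rankin_weight A z p v / real (p ^ v) \<le> (if real p \<le> z then real (p ^ v) powr (1 / ln z) else 1) / real (p ^ v)"
    using le1 by (intro divide_right_mono) auto
  also have "\<dots> \<le> real p powr (- 3/4 * real v)"
    using rankin_factor_le(3)[OF z p2, of v] powr_three_quarters[of "real p" v] p2 by (cases "real p \<le> z") simp_all
  finally show ?thesis .
qed

text \<open>Provides the Chebyshev hypothesis of \<open>sum_mfun_ln_le\<close>. First powers have
  weight at most 3 and give 3 * 4 y by \<open>theta_le\<close>; for higher powers p^v \<le> y is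
  factored out and the rest converges by \<open>prime_power_tail\<close>.\<close>

lemma sum_rankin_weight_prime_powers:
  assumes z: "ln z \<ge> 4" "z > 0" and y: "y \<ge> 1"
  shows "(\<Sum>(p,v)\<in>prime_powers_le y. rankin_weight A z p v * (real v * ln (real p))) \<le> (12 + 50 * zeta_const) * y"
proof -
  define N where "N = nat \<lfloor>y\<rfloor>"
  let ?f = "\<lambda>(p,v). rankin_weight A z p v * (real v * ln (real p))"
  let ?g = "\<lambda>(p,v). y * (real p powr (- 3/4 * real v) * (real v * ln (real p)))"
  let ?X = "primes_le y \<times> {1::nat}" and ?Y = "primes_le y \<times> {2..N}"
  have lnp: "ln (real p) \<ge> 0" if "prime p" for p using prime_ge_1_nat[OF that] by simp
  have w3: "rankin_weight A z p 1 \<le> 3" if "prime p" for p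
  proof -
    have "rankin_weight A z p 1 \<le> (if real p \<le> z then real p powr (1 / ln z) else 1)"
      by (simp add: rankin_weight_def adm_ind_def)
    also have "\<dots> \<le> 3" using rankin_factor_le(2)[OF z, of "real p"] prime_ge_2_nat[OF that] by simp
    finally show ?thesis .
  qed
  have "(\<Sum>x\<in>prime_powers_le y. ?f x) = (\<Sum>x\<in>prime_powers_le y \<inter> ?X. ?f x) + (\<Sum>x\<in>prime_powers_le y - ?X. ?f x)"
    by (rule sum.Int_Diff) simp
  also have "(\<Sum>x\<in>prime_powers_le y \<inter> ?X. ?f x) \<le> (\<Sum>x\<in>?X. 3 * ln (real (fst x)))"
  proof (rule sum_le_included[where i = id])
    show "\<forall>x\<in>prime_powers_le y \<inter> ?X. \<exists>y\<in>?X. id y = x \<and> ?f x \<le> 3 * ln (real (fst y))"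
    proof
      fix x assume x: "x \<in> prime_powers_le y \<inter> ?X"
      then have pr: "x = (fst x, 1)" "prime (fst x)" by (auto simp: primes_le_def)
      have "rankin_weight A z (fst x) 1 * ln (real (fst x)) \<le> 3 * ln (real (fst x))"
        using w3[OF pr(2)] lnp[OF pr(2)] by (rule mult_right_mono)
      then show "\<exists>y\<in>?X. id y = x \<and> ?f x \<le> 3 * ln (real (fst y))"
        using x pr(1) by (intro bexI[of _ x]) (auto simp: split_def)
    qed
    show "\<forall>x\<in>?X. 0 \<le> 3 * ln (real (fst x))" by (auto simp: primes_le_def intro: lnp)
  qed simp_all
  also have "(\<Sum>x\<in>?X. 3 * ln (real (fst x))) = (\<Sum>p\<in>primes_le y. 3 * ln (real p))"
    by (rule sum.reindex_bij_witness[of _ "\<lambda>p. (p, 1)" fst]) auto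
  also have "\<dots> = 3 * (\<Sum>p\<in>primes_le y. ln (real p))" by (rule sum_distrib_left[symmetric])
  also have "\<dots> \<le> 3 * (4 * y)" using theta_le[of y] y by simp
  also have "(\<Sum>x\<in>prime_powers_le y - ?X. ?f x) \<le> (\<Sum>x\<in>?Y. ?g x)"
  proof (rule sum_le_included[where i = id])
    show "\<forall>x\<in>?Y. 0 \<le> ?g x" using y lnp by (auto simp: primes_le_def intro!: mult_nonneg_nonneg)
    show "\<forall>x\<in>prime_powers_le y - ?X. \<exists>y\<in>?Y. id y = x \<and> ?f x \<le> ?g y"
    proof
      fix x assume x: "x \<in> prime_powers_le y - ?X"
      obtain p v where pv: "x = (p, v)" by (cases x)
      have h: "prime p" "v \<ge> 1" "real (p ^ v) \<le> y" using x pv by (auto simp: prime_powers_le_def)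
      have "p ^ 1 \<le> p ^ v" using h prime_ge_1_nat by (intro power_increasing) auto
      then have "real p \<le> real (p ^ v)" by (simp only: power_one_right of_nat_le_iff)
      then have py: "real p \<le> y" using h by linarith
      then have "v \<noteq> 1" using x pv h by (auto simp: primes_le_def)
      moreover have "v \<le> N"
      proof -
        have "v < 2 ^ v" by (rule less_exp)
        also have "2 ^ v \<le> p ^ v" using prime_ge_2_nat[OF h(1)] by (intro power_mono) auto
        also have "p ^ v \<le> N" unfolding N_def using h(3) by (rule le_nat_floor)
        finally show ?thesis by simp
      qed
      ultimately have "x \<in> ?Y" using h py pv by (auto simp: primes_le_def)
      moreover have "?f x \<le> ?g x"
      proof -
        have pv0: "real (p ^ v) > 0" using prime_gt_0_nat[OF h(1)] by simp
        have "rankin_weight A z p v = rankin_weight A z p v / real (p ^ v) * real (p ^ v)" using pv0 by simp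
        also have "\<dots> \<le> real p powr (- 3/4 * real v) * y"
          using rankin_weight_div_le[OF z h(1), of A v] h(3) by (intro mult_mono) auto
        finally have "rankin_weight A z p v * (real v * ln (real p)) \<le> real p powr (- 3/4 * real v) * y * (real v * ln (real p))"
          using lnp[OF h(1)] by (intro mult_right_mono) auto
        then show ?thesis by (simp add: pv mult_ac)
      qed
      ultimately show "\<exists>y\<in>?Y. id y = x \<and> ?f x \<le> ?g y" by auto
    qed
  qed auto
  also have "(\<Sum>x\<in>?Y. ?g x) = (\<Sum>p\<in>primes_le y. y * (\<Sum>v=2..N. real p powr (- 3/4 * real v) * (real v * ln (real p))))"
    unfolding sum_distrib_left by (simp only: sum.cartesian_product)
  also have "\<dots> \<le> (\<Sum>p\<in>primes_le y. y * (50 * real p powr (-5/4)))"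
    using y primes_leD(3) by (intro sum_mono mult_left_mono prime_power_tail(2)) auto
  also have "\<dots> = 50 * y * (\<Sum>p\<in>primes_le y. real p powr (-5/4))"
    by (simp add: sum_distrib_left mult_ac)
  also have "\<dots> \<le> 50 * y * zeta_const" using sum_le_zeta_const[of "primes_le y"] y by (intro mult_left_mono) auto
  finally show ?thesis by (simp add: algebra_simps)
qed

lemma admissible_primes_eq: "admissible_primes A y = {p \<in> primes_le y. rho A p \<ge> 1}"
  by (auto simp: admissible_primes_def primes_le_def)

lemma sum_admissible_primes:
  "(\<Sum>p\<in>admissible_primes A y. f p) = (\<Sum>p\<in>primes_le y. adm_ind A p 1 * (f p :: real))"
  unfolding admissible_primes_eq
  by (intro sum.mono_neutral_cong_left) (auto simp: adm_ind_def)

text \<open>At first powers the Rankin factor exceeds 1 by at most 2 ln p / ln z, and only for p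
  \<le> z. Summed against 1/p this excess is at most (2 / ln z) * 2 ln z = 4, so the weight inflates
  the sum of 1/m by a constant factor only.\<close>

lemma sum_rankin_weight_inverse:
  assumes z: "ln z \<ge> 4" "z > 0"
  shows "(\<Sum>m=1..N. mfun (rankin_weight A z) m / real m) \<le>
    exp ((\<Sum>p\<in>admissible_primes A (real N). 1 / real p) + 4 + 5/2 * zeta_const)"
proof -
  have "0 < ln z" using z(1) by linarith
  then have z1: "1 \<le> z" using z(2) by simp
  let ?F = "\<lambda>p v. rankin_weight A z p v * (1 / real (p ^ v))"
  let ?e = "\<lambda>p. adm_ind A p 1 * (1 / real p) + (if real p \<le> z then 2 / ln z * (ln (real p) / real p) else 0)"
  have F0: "?F p v \<ge> 0" for p v by (simp add: rankin_weight_nonneg)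
  have "(\<Sum>m=1..N. mfun (rankin_weight A z) m / real m) = (\<Sum>m=1..N. mfun ?F m)"
  proof (intro sum.cong refl)
    fix m assume "m \<in> {1..N}"
    then have "m > 0" by simp
    then show "mfun (rankin_weight A z) m / real m = mfun ?F m" unfolding mfun_distrib by (simp only: mfun_inverse) simp
  qed
  also have "\<dots> \<le> (\<Sum>r | r \<in> {1..N} \<and> prime_factors r \<subseteq> primes_le (real N). mfun ?F r)"
  proof (intro sum_mono2)
    show "{1..N} \<subseteq> {r. r \<in> {1..N} \<and> prime_factors r \<subseteq> primes_le (real N)}"
    proof clarify
      fix m p assume m: "m \<in> {1..N}" and p: "p \<in> prime_factors m"
      then have "prime p" "p dvd m" by auto
      then have "p \<le> m" using m by (intro dvd_imp_le) auto
      then show "p \<in> primes_le (real N)" using m \<open>prime p\<close> by (simp add: primes_le_def)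
    qed
  qed (auto intro!: mfun_nonneg F0)
  also have "\<dots> \<le> exp ((\<Sum>p\<in>primes_le (real N). ?e p) + 5/2 * zeta_const)"
  proof (rule sum_mfun_le_exp)
    fix p assume p: "p \<in> primes_le (real N)"
    have pp: "prime p" "real p \<ge> 2" using p by (auto dest: primes_leD)
    have "(\<Sum>v=1..N. ?F p v) = ?F p 1 + (\<Sum>v=2..N. ?F p v)"
    proof -
      have "N \<ge> 1" using p prime_ge_1_nat[OF pp(1)] by (auto simp: primes_le_def)
      then show ?thesis using sum.atLeast_Suc_atMost[of 1 N "?F p"] by (simp add: numeral_2_eq_2)
    qed
    also have "?F p 1 \<le> ?e p"
    proof (cases "real p \<le> z")
      case True
      have "?F p 1 = adm_ind A p 1 * (real p powr (1 / ln z) / real p)"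
        using True by (simp add: rankin_weight_def)
      also have "\<dots> \<le> adm_ind A p 1 * ((1 + 2 * (ln (real p) / ln z)) / real p)"
        using rankin_factor_le(1)[OF z pp(2) True] by (intro mult_left_mono divide_right_mono) (auto simp: adm_ind_def)
      also have "\<dots> = adm_ind A p 1 * (1 / real p) + adm_ind A p 1 * (2 / ln z * (ln (real p) / real p))"
        using pp(2) by (simp add: field_simps)
      also have "adm_ind A p 1 * (2 / ln z * (ln (real p) / real p)) \<le> 2 / ln z * (ln (real p) / real p)"
        using z z1 pp(2) by (intro mult_left_le_one_le mult_nonneg_nonneg divide_nonneg_nonneg ln_ge_zero) (auto simp: adm_ind_def)
      finally show ?thesis using True by simp
    qed (simp add: rankin_weight_def)
    also have "(\<Sum>v=2..N. ?F p v) \<le> (\<Sum>v=2..N. real p powr (- 3/4 * real v))"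
    proof (intro sum_mono)
      fix v show "?F p v \<le> real p powr (- 3/4 * real v)"
        using rankin_weight_div_le[OF z pp(1), of A v] by simp
    qed
    also have "\<dots> \<le> 5/2 * real p powr (-5/4)" by (rule prime_power_tail(1)[OF pp(2)])
    finally show "(\<Sum>v=1..N. ?F p v) \<le> ?e p + 5/2 * real p powr (-5/4)" by simp
  qed (use F0 primes_leD in auto)
  also have "\<dots> \<le> exp ((\<Sum>p\<in>admissible_primes A (real N). 1 / real p) + 4 + 5/2 * zeta_const)"
  proof -
    have "(\<Sum>p\<in>primes_le (real N). if real p \<le> z then 2 / ln z * (ln (real p) / real p) else 0)
      \<le> (\<Sum>p\<in>primes_le z. 2 / ln z * (ln (real p) / real p))"
    proof -
      have "(\<Sum>p\<in>primes_le (real N). if real p \<le> z then 2 / ln z * (ln (real p) / real p) else 0)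
        = (\<Sum>p\<in>{p \<in> primes_le (real N). real p \<le> z}. 2 / ln z * (ln (real p) / real p))"
        by (rule sum.inter_filter[symmetric]) simp
      also have "\<dots> \<le> (\<Sum>p\<in>primes_le z. 2 / ln z * (ln (real p) / real p))"
      proof (rule sum_mono2)
        fix p assume "p \<in> primes_le z - {p \<in> primes_le (real N). real p \<le> z}"
        then have "real p \<ge> 2" using primes_leD(3) by blast
        then show "0 \<le> 2 / ln z * (ln (real p) / real p)" using z z1
          by (intro mult_nonneg_nonneg divide_nonneg_nonneg ln_ge_zero) auto
      next
        show "{p \<in> primes_le (real N). real p \<le> z} \<subseteq> primes_le z" by (auto simp: primes_le_def)
      qed simp
      finally show ?thesis .
    qed
    also have "\<dots> = 2 / ln z * (\<Sum>p\<in>primes_le z. ln (real p) / real p)" by (simp only: sum_distrib_left)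
    also have "\<dots> \<le> 2 / ln z * (2 * ln z)"
      using z z1 by (intro mult_left_mono sum_ln_over_primes_le) auto
    also have "\<dots> = 4"
    proof -
      have "2 / L * (2 * L) = 4" if "L > 0" for L :: real using that by simp
      then show ?thesis using \<open>0 < ln z\<close> by blast
    qed
    finally show ?thesis by (simp add: sum.distrib sum_admissible_primes)
  qed
  finally show ?thesis .
qed

definition rankin_const :: real where
  "rankin_const = 2 * (12 + 50 * zeta_const) * exp (4 + 5/2 * zeta_const)"

lemma rankin_const_pos: "rankin_const > 0"
  using zeta_const_nonneg by (simp add: rankin_const_def add_pos_nonneg)

text \<open>
  Rankin's trick combined with \<open>\<Sum>f(q) log q \<le> C x \<Sum>f(m)/m\<close>; the second ingredient saves the
  factor \<open>ln x\<close> that a trivial count of the smooth parts would lose.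
\<close>

lemma card_large_smooth_part_le:
  fixes A :: "nat \<Rightarrow> (int ^ 'n::finite) set"
  assumes z: "ln z \<ge> 4" "z > 0" and x: "x > 1"
  shows "real (card {q \<in> moduli_upto A x. real (smooth_part z q) > x powr (1/4)}) \<le>
    sqrt x + rankin_const * (x / ln x) * exp (- ln x / (4 * ln z)) * exp (\<Sum>p\<in>admissible_primes A x. 1 / real p)"
proof -
  define N where "N = nat \<lfloor>x\<rfloor>"
  define \<epsilon> where "\<epsilon> = 1 / ln z"
  have lz: "ln z > 0" using z by linarith
  have lx: "ln x > 0" using x by simp
  have \<epsilon>: "\<epsilon> > 0" using lz by (simp only: \<epsilon>_def zero_less_divide_1_iff)
  have Nx: "real N \<le> x" using x by (simp add: N_def)
  let ?B = "{q \<in> moduli_upto A x. real (smooth_part z q) > x powr (1/4)}"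
  let ?S = "{1..nat \<lfloor>sqrt x\<rfloor>}"
  let ?g = "mfun (rankin_weight A z)"
  have B: "q > 0" "q \<le> N" "rho A q \<ge> 1" "real (smooth_part z q) > x powr (1/4)" if "q \<in> ?B" for q
    using that by (auto simp: moduli_upto_def moduli_def N_def le_nat_floor)
  have "?B \<subseteq> {..N}"
  proof
    fix q assume "q \<in> ?B"
    then show "q \<in> {..N}" unfolding atMost_iff by (rule B(2))
  qed
  then have finB: "finite ?B" by (rule finite_subset) simp
  have inner: "(\<Sum>q=1..N. ?g q * ln (real q)) \<le>
     (12 + 50 * zeta_const) * x * exp ((\<Sum>p\<in>admissible_primes A x. 1 / real p) + 4 + 5/2 * zeta_const)"
  proof -
  have "(\<Sum>q=1..N. ?g q * ln (real q)) \<le> (12 + 50 * zeta_const) * real N * (\<Sum>m=1..N. ?g m / real m)"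
    using z by (intro sum_mfun_ln_le rankin_weight_nonneg sum_rankin_weight_prime_powers)
  also have "\<dots> \<le> (12 + 50 * zeta_const) * x * exp ((\<Sum>p\<in>admissible_primes A x. 1 / real p) + 4 + 5/2 * zeta_const)"
  proof (intro mult_mono)
    have "admissible_primes A (real N) = admissible_primes A x"
      using x primes_le_floor[of x] by (simp add: admissible_primes_eq N_def)
    then show "(\<Sum>m=1..N. ?g m / real m) \<le> exp ((\<Sum>p\<in>admissible_primes A x. 1 / real p) + 4 + 5/2 * zeta_const)"
      using sum_rankin_weight_inverse[OF z, of A N] by simp
  qed (use x Nx zeta_const_nonneg in \<open>auto intro!: sum_nonneg divide_nonneg_nonneg mfun_nonneg rankin_weight_nonneg\<close>)
    finally show ?thesis .
  qed
  \<comment> \<open>Moduli up to sqrt x are counted trivially. The others satisfy 1 \<le> (2 / ln x)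
    ln q, which introduces the weight ln q that \<open>sum_mfun_ln_le\<close> requires.\<close>
  have "card ?B \<le> card (?S \<union> (?B - ?S))" using finB by (intro card_mono) auto
  also have "\<dots> \<le> card ?S + card (?B - ?S)" by (rule card_Un_le)
  finally have "real (card ?B) \<le> real (card ?S) + real (card (?B - ?S))" by linarith
  also have "real (card ?S) \<le> sqrt x" using x by simp
  also have "real (card (?B - ?S)) \<le> (\<Sum>q\<in>?B - ?S. x powr (- \<epsilon> / 4) * (2 / ln x) * (?g q * ln (real q)))"
  proof -
    have "real (card (?B - ?S)) = (\<Sum>q\<in>?B - ?S. 1)" by simp
    also have "\<dots> \<le> (\<Sum>q\<in>?B - ?S. x powr (- \<epsilon> / 4) * (2 / ln x) * (?g q * ln (real q)))"
    proof (intro sum_mono)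
      fix q assume q: "q \<in> ?B - ?S"
      then have qB: "q \<in> ?B" by blast
      note b = B[OF qB]
      have "\<not> q \<le> nat \<lfloor>sqrt x\<rfloor>" using q b(1) by auto
      then have "sqrt x < real q" by (metis le_nat_floor not_le)
      then have "ln (sqrt x) < ln (real q)" using x b(1) by (subst ln_less_cancel_iff) auto
      then have lq: "1 \<le> 2 / ln x * ln (real q)" using x lx by (simp add: ln_sqrt field_simps)
      have "1 = x powr (- \<epsilon> / 4) * (x powr (1/4)) powr \<epsilon>"
        using x by (simp add: powr_powr flip: powr_add)
      also have "\<dots> \<le> x powr (- \<epsilon> / 4) * real (smooth_part z q) powr \<epsilon>"
        using b(4) \<epsilon> by (intro mult_left_mono powr_mono2) auto
      also have "real (smooth_part z q) powr \<epsilon> = ?g q"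
        using mfun_rankin_weight[OF b(1), of A z] b(3) by (simp add: \<epsilon>_def)
      finally have gq: "1 \<le> x powr (- \<epsilon> / 4) * ?g q" .
      have "1 * 1 \<le> (x powr (- \<epsilon> / 4) * ?g q) * (2 / ln x * ln (real q))"
        using gq lq by (intro mult_mono) auto
      then show "1 \<le> x powr (- \<epsilon> / 4) * (2 / ln x) * (?g q * ln (real q))" by (simp add: mult_ac)
    qed
    finally show ?thesis .
  qed
  also have "\<dots> = x powr (- \<epsilon> / 4) * (2 / ln x) * (\<Sum>q\<in>?B - ?S. ?g q * ln (real q))"
    by (simp only: sum_distrib_left)
  also have "\<dots> \<le> x powr (- \<epsilon> / 4) * (2 / ln x) * (\<Sum>q=1..N. ?g q * ln (real q))"
  proof (intro mult_left_mono sum_mono2)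
    show "?B - ?S \<subseteq> {1..N}"
    proof
      fix q assume "q \<in> ?B - ?S"
      then have "q \<in> ?B" by blast
      then show "q \<in> {1..N}" using B(1)[of q] B(2)[of q] by (simp add: Suc_le_eq)
    qed
    show "0 \<le> ?g q * ln (real q)" if "q \<in> {1..N} - (?B - ?S)" for q
      using that by (intro mult_nonneg_nonneg mfun_nonneg rankin_weight_nonneg ln_ge_zero) simp
  qed (use lx in simp_all)
  also have "\<dots> \<le> x powr (- \<epsilon> / 4) * (2 / ln x) *
     ((12 + 50 * zeta_const) * x * exp ((\<Sum>p\<in>admissible_primes A x. 1 / real p) + 4 + 5/2 * zeta_const))"
    using lx inner by (intro mult_left_mono) auto
  finally have "real (card ?B) \<le> sqrt x + x powr (- \<epsilon> / 4) * (2 / ln x) *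
     ((12 + 50 * zeta_const) * x * exp ((\<Sum>p\<in>admissible_primes A x. 1 / real p) + 4 + 5/2 * zeta_const))"
    by simp
  also have "x powr (- \<epsilon> / 4) = exp (- ln x / (4 * ln z))"
    using x by (simp add: powr_def \<epsilon>_def field_simps)
  also have "exp (- ln x / (4 * ln z)) * (2 / ln x) *
     ((12 + 50 * zeta_const) * x * exp ((\<Sum>p\<in>admissible_primes A x. 1 / real p) + 4 + 5/2 * zeta_const))
     = rankin_const * (x / ln x) * exp (- ln x / (4 * ln z)) * exp (\<Sum>p\<in>admissible_primes A x. 1 / real p)"
  proof -
    have e: "exp ((\<Sum>p\<in>admissible_primes A x. 1 / real p) + 4 + 5/2 * zeta_const)
      = exp (\<Sum>p\<in>admissible_primes A x. 1 / real p) * exp (4 + 5/2 * zeta_const)"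
      by (simp only: add.assoc exp_add)
    show ?thesis unfolding rankin_const_def e by (simp add: field_simps)
  qed
  finally show ?thesis .
qed

section \<open>Assembling the bound\<close>

text \<open>At first powers the factor 1 + 1/p adds at most 1/p^2, absorbed once by p powr (-5/4);
  at higher powers it is at most 2, giving 2 * 5/2 = 5. Together this is the constant 6.\<close>

lemma sum_mfun_weighted_le:
  fixes W :: "nat \<Rightarrow> nat \<Rightarrow> real"
  assumes W: "\<And>p v. 0 \<le> W p v" "\<And>p v. prime p \<Longrightarrow> W p v \<le> 1"
  shows "(\<Sum>r | r \<in> {1..N} \<and> prime_factors r \<subseteq> primes_le z. mfun W r * radical_factor r / real r)
    \<le> exp ((\<Sum>p\<in>primes_le z. W p 1 / real p) + 6 * zeta_const)"
proof -
  let ?F = "\<lambda>p v. W p v * ((1 + 1 / real p) * (1 / real (p ^ v)))"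
  have F0: "?F p v \<ge> 0" for p v using W(1) by simp
  have "(\<Sum>r | r \<in> {1..N} \<and> prime_factors r \<subseteq> primes_le z. mfun W r * radical_factor r / real r)
     = (\<Sum>r | r \<in> {1..N} \<and> prime_factors r \<subseteq> primes_le z. mfun ?F r)"
  proof (intro sum.cong refl)
    fix r assume "r \<in> {r. r \<in> {1..N} \<and> prime_factors r \<subseteq> primes_le z}"
    then have "r > 0" by simp
    then show "mfun W r * radical_factor r / real r = mfun ?F r"
      unfolding mfun_distrib radical_factor_eq_mfun by (simp only: mfun_inverse) simp
  qed
  also have "\<dots> \<le> exp ((\<Sum>p\<in>primes_le z. W p 1 / real p) + 6 * zeta_const)"
  proof (rule sum_mfun_le_exp)
    fix p assume p: "p \<in> primes_le z"
    have p2: "real p \<ge> 2" and pp: "prime p" using p by (auto dest: primes_leD)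
    have "(\<Sum>v=1..N. ?F p v) \<le> ?F p 1 + (\<Sum>v=2..N. ?F p v)"
    proof (cases "N \<ge> 1")
      case True
      then show ?thesis using sum.atLeast_Suc_atMost[of 1 N "?F p"] by (simp add: numeral_2_eq_2)
    next
      case False
      then show ?thesis using F0[of p 1] by simp
    qed
    also have "?F p 1 \<le> W p 1 / real p + real p powr (-5/4)"
    proof -
      have "?F p 1 = W p 1 / real p + W p 1 * (1 / (real p)\<^sup>2)"
        using p2 by (simp add: field_simps power2_eq_square)
      also have "W p 1 * (1 / (real p)\<^sup>2) \<le> 1 * (1 / (real p)\<^sup>2)" using W(2)[OF pp] by (intro mult_right_mono) auto
      also have "1 * (1 / (real p)\<^sup>2) = real p powr (-2)" using p2 by (simp add: powr_minus powr_numeral field_simps)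
      also have "\<dots> \<le> real p powr (-5/4)" using p2 by (intro powr_mono) auto
      finally show ?thesis by simp
    qed
    also have "(\<Sum>v=2..N. ?F p v) \<le> (\<Sum>v=2..N. 2 * real p powr (- 3/4 * real v))"
    proof (intro sum_mono)
      fix v
      have "?F p v \<le> 1 * (2 * real p powr (- 3/4 * real v))"
        using W(1)[of p v] W(2)[OF pp, of v] p2 powr_three_quarters[of "real p" v] by (intro mult_mono) auto
      then show "?F p v \<le> 2 * real p powr (- 3/4 * real v)" by simp
    qed
    also have "\<dots> = 2 * (\<Sum>v=2..N. real p powr (- 3/4 * real v))" by (simp only: sum_distrib_left)
    also have "\<dots> \<le> 2 * (5/2 * real p powr (-5/4))" using prime_power_tail(1)[OF p2, of N] by simp
    finally show "(\<Sum>v=1..N. ?F p v) \<le> W p 1 / real p + 6 * real p powr (-5/4)" by simp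
  qed (use F0 primes_leD in auto)
  finally show ?thesis .
qed

lemma max_hyperplane_le_rho:
  fixes A :: "nat \<Rightarrow> (int ^ 'n::finite) set"
  assumes p: "prime p"
  shows "max_hyperplane A p \<le> rho A p"
proof -
  have p1: "int p > 1" using prime_gt_1_nat[OF p] by simp
  \<comment> \<open>A bound for \<open>Max\<close> needs a nonempty family; the hyperplane with all
    coefficients 1 through the origin is a witness.\<close>
  have "(\<chi> i. 1) \<in> (zmod_vecs p :: (int ^ 'n) set)" "(\<chi> i. 1) \<noteq> (0 :: int ^ 'n)" "0 \<in> {0..<int p}"
    using p1 by (auto simp: zmod_vecs_def vec_eq_iff)
  then have "{x \<in> zmod_vecs p. [(\<Sum>i\<in>UNIV. (\<chi> i. 1) $ i * x $ i) = 0] (mod int p)} \<in> (affine_hyperplanes p :: (int ^ 'n) set set)"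
    unfolding affine_hyperplanes_def by blast
  then have ne: "(affine_hyperplanes p :: (int ^ 'n) set set) \<noteq> {}" by blast
  show ?thesis
    unfolding max_hyperplane_def rho_def using finite_affine_hyperplanes ne
    by (intro Max.boundedI) (auto intro!: card_mono)
qed

lemma ratio_bounds:
  fixes A :: "nat \<Rightarrow> (int ^ 'n::finite) set"
  assumes "prime p"
  shows "0 \<le> real (max_hyperplane A p) / real (rho A p)" "real (max_hyperplane A p) / real (rho A p) \<le> 1"
  using max_hyperplane_le_rho[OF assms, of A] by (auto simp: divide_le_eq)

section \<open>The prime sums in the exponents\<close>

definition sum_inv :: "(nat \<Rightarrow> (int ^ 'n::finite) set) \<Rightarrow> real \<Rightarrow> real" where
  "sum_inv A x = (\<Sum>p\<in>admissible_primes A x. 1 / real p)"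

definition sum_gain :: "(nat \<Rightarrow> (int ^ 'n::finite) set) \<Rightarrow> real \<Rightarrow> real" where
  "sum_gain A x = (\<Sum>p\<in>admissible_primes A x. (1 - real (max_hyperplane A p) / real (rho A p)) * (1 / real p))"

lemma finite_admissible_primes [simp]: "finite (admissible_primes A x)"
  by (simp add: admissible_primes_eq)

lemma sum_gain_bounds: "0 \<le> sum_gain A x" "sum_gain A x \<le> sum_inv A x"
proof -
  have b: "0 \<le> 1 - real (max_hyperplane A p) / real (rho A p)" "1 - real (max_hyperplane A p) / real (rho A p) \<le> 1"
    if "p \<in> admissible_primes A x" for p
    using that ratio_bounds[of p A] by (simp_all add: admissible_primes_def)
  show "0 \<le> sum_gain A x" unfolding sum_gain_def using b by (intro sum_nonneg mult_nonneg_nonneg) auto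
  show "sum_gain A x \<le> sum_inv A x" unfolding sum_gain_def sum_inv_def
    using b by (intro sum_mono mult_left_le_one_le) auto
qed

lemma sum_inverse_primes_le_half_plus:
  "(\<Sum>p\<in>primes_le x. 1 / real p) \<le> 1/2 + (\<Sum>p\<in>primes_le x - primes_le 2. 1 / real p)"
proof -
  have "primes_le x \<subseteq> insert 2 (primes_le x - primes_le 2)"
  proof
    fix p assume p: "p \<in> primes_le x"
    show "p \<in> insert 2 (primes_le x - primes_le 2)"
    proof (cases "p \<in> primes_le 2")
      case True
      then have "real p = 2" using primes_leD(2,3)[OF True] by linarith
      then show ?thesis by simp
    qed (use p in simp)
  qed
  then have "(\<Sum>p\<in>primes_le x. 1 / real p) \<le> (\<Sum>p\<in>insert 2 (primes_le x - primes_le 2). 1 / real p)"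
    by (intro sum_mono2) auto
  also have "\<dots> = 1/2 + (\<Sum>p\<in>primes_le x - primes_le 2. 1 / real p)"
  proof -
    have "(2::nat) \<in> primes_le 2" by (simp add: primes_le_def)
    then show ?thesis by (subst sum.insert) auto
  qed
  finally show ?thesis .
qed

text \<open>The bound is uniform in the family A. It is what makes the required size of x depend on
  \<alpha> and x0 alone.\<close>

lemma sum_inv_le_ln_ln:
  assumes "x \<ge> 2" shows "sum_inv A x \<le> 5 + 6 * ln (ln x / ln 2)"
proof -
  have r: "ln x / ln 2 > 0" using assms by simp
  have "sum_inv A x \<le> (\<Sum>p\<in>primes_le x. 1 / real p)"
    unfolding sum_inv_def admissible_primes_eq by (intro sum_mono2) auto
  also have "\<dots> \<le> 1/2 + (\<Sum>p\<in>primes_le x - primes_le 2. 1 / real p)"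
    by (rule sum_inverse_primes_le_half_plus)
  also have "(\<Sum>p\<in>primes_le x - primes_le 2. 1 / real p) \<le> ln (exp 4 * (ln x / ln 2) ^ 6)"
    using exp_sum_inverse_primes_le[of 2 x] assms r by (subst ln_ge_iff) auto
  also have "ln (exp 4 * (ln x / ln 2) ^ 6) = 4 + 6 * ln (ln x / ln 2)"
    using r by (subst ln_mult) (auto simp: ln_realpow)
  finally show ?thesis by simp
qed

text \<open>Primes up to the frequency cutoff exp S yield no saving. By Mertens, forgoing half of
  1/p at each of them costs a power of 1 + S, whose exponent 3 is half of the 6 in
  \<open>exp_sum_inverse_primes_le\<close>.\<close>

lemma exp_half_sum_small_primes:
  assumes S: "S \<ge> 0"
  shows "exp (1/2 * (\<Sum>p\<in>primes_le (exp S). 1 / real p)) \<le> 8 * exp 3 * (1 + S) ^ 3"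
proof (cases "exp S \<ge> 2")
  case False
  then have "primes_le (exp S) = {}" using primes_leD(2,3) by force
  moreover have "1 \<le> 8 * exp (3::real)" using one_le_exp_iff[of "3::real"] by linarith
  then have "1 * 1 \<le> 8 * exp 3 * (1 + S) ^ 3" using S by (intro mult_mono) (auto simp: one_le_power)
  ultimately show ?thesis by simp
next
  case True
  let ?s = "\<Sum>p\<in>primes_le (exp S). 1 / real p"
  have "?s \<le> 1/2 + (\<Sum>p\<in>primes_le (exp S) - primes_le 2. 1 / real p)"
    by (rule sum_inverse_primes_le_half_plus)
  then have "exp ?s \<le> exp (1/2 + (\<Sum>p\<in>primes_le (exp S) - primes_le 2. 1 / real p))" by simp
  also have "\<dots> = exp (1/2) * exp (\<Sum>p\<in>primes_le (exp S) - primes_le 2. 1 / real p)" by (rule exp_add)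
  also have "\<dots> \<le> exp 2 * (exp 4 * (2 * (1 + S)) ^ 6)"
  proof (intro mult_mono)
    have "exp (\<Sum>p\<in>primes_le (exp S) - primes_le 2. 1 / real p) \<le> exp 4 * (ln (exp S) / ln 2) ^ 6"
      using True by (intro exp_sum_inverse_primes_le) auto
    also have "\<dots> \<le> exp 4 * (2 * (1 + S)) ^ 6"
    proof (intro mult_left_mono power_mono)
      have "S \<le> 2 * S * ln 2" using ln2_ge_two_thirds S mult_left_mono[of "2/3" "ln 2" "2 * S"] by linarith
      then have "S / ln 2 \<le> 2 * S" by (simp add: divide_le_eq)
      then show "ln (exp S) / ln 2 \<le> 2 * (1 + S)" by simp
    qed (use S in auto)
    finally show "exp (\<Sum>p\<in>primes_le (exp S) - primes_le 2. 1 / real p) \<le> exp 4 * (2 * (1 + S)) ^ 6" .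
  qed auto
  also have "\<dots> = (8 * exp 3 * (1 + S) ^ 3)\<^sup>2"
  proof -
    have e: "exp 2 * exp 4 = (exp 3 :: real)\<^sup>2" by (simp add: power2_eq_square mult_exp_exp)
    have "exp 2 * (exp 4 * (2 * (1 + S)) ^ 6) = (exp 2 * exp 4) * (2 * (1 + S)) ^ 6" by (simp only: mult.assoc)
    also have "\<dots> = (exp 3)\<^sup>2 * (2 * (1 + S)) ^ (3 * 2)" unfolding e by simp
    also have "\<dots> = (8 * exp 3 * (1 + S) ^ 3)\<^sup>2" by (simp only: power_mult power_mult_distrib) (simp add: power2_eq_square)
    finally show ?thesis .
  qed
  finally have "(exp (1/2 * ?s))\<^sup>2 \<le> (8 * exp 3 * (1 + S) ^ 3)\<^sup>2" by (simp add: exp_double[symmetric])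
  then show ?thesis by (rule power2_le_imp_le) (use S in simp)
qed

text \<open>By the arithmetic-geometric mean, sqrt g \<le> 1 - (1 - g)/2 for the ratio g at p.
  Primes up to H have ratio 1 and are corrected by 1/(2p). The remaining terms are nonnegative, so
  the range may be enlarged from z to x, which produces the full sums over admissible primes up to
  x.\<close>

lemma sum_sqrt_hyper_ratio_le:
  fixes A :: "nat \<Rightarrow> (int ^ 'n::finite) set"
  assumes zx: "z \<le> x" and H: "H > 0"
  shows "(\<Sum>p\<in>primes_le z. adm_ind A p 1 * sqrt (hyper_ratio A H p 1) / real p)
    \<le> sum_inv A x - 1/2 * sum_gain A x + 1/2 * (\<Sum>p\<in>primes_le H. 1 / real p)"
proof -
  let ?g = "\<lambda>p. real (max_hyperplane A p) / real (rho A p)"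
  let ?t = "\<lambda>p. adm_ind A p 1 * (1 / real p - 1/2 * ((1 - ?g p) * (1 / real p)))"
  let ?b = "\<lambda>p. if real p \<le> H then 1/2 * (1 / real p) else 0"
  have adm: "0 \<le> adm_ind A p v" "adm_ind A p v \<le> 1" for p v by (auto simp: adm_ind_def)
  have t0: "?t p \<ge> 0" if "prime p" for p
  proof -
    have "1/2 * ((1 - ?g p) * (1 / real p)) \<le> 1 * (1 * (1 / real p))"
      using ratio_bounds[OF that, of A] by (intro mult_mono mult_nonneg_nonneg) auto
    then have "0 \<le> 1 / real p - 1/2 * ((1 - ?g p) * (1 / real p))" by simp
    then show ?thesis using adm(1) by (rule mult_nonneg_nonneg[rotated])
  qed
  have termwise: "adm_ind A p 1 * sqrt (hyper_ratio A H p 1) / real p \<le> ?t p + ?b p" if p: "prime p" for p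
  proof (cases "real p \<le> H")
    case True
    have "adm_ind A p 1 * (1/2 * ((1 - ?g p) * (1 / real p))) \<le> 1 * (1/2 * (1 * (1 / real p)))"
      using ratio_bounds[OF p, of A] adm by (intro mult_mono mult_nonneg_nonneg) auto
    moreover have "hyper_ratio A H p 1 = 1" using True by (simp add: hyper_ratio_def)
    ultimately show ?thesis using True by (simp add: right_diff_distrib)
  next
    case False
    have "sqrt (?g p) \<le> (1 + ?g p) / 2"
      using arith_geo_mean_sqrt[of 1 "?g p"] ratio_bounds[OF p, of A] by simp
    then have "sqrt (hyper_ratio A H p 1) \<le> 1 - 1/2 * (1 - ?g p)" using False by (simp add: hyper_ratio_def field_simps)
    then have "adm_ind A p 1 * sqrt (hyper_ratio A H p 1) / real p \<le> adm_ind A p 1 * (1 - 1/2 * (1 - ?g p)) / real p"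
      using adm by (intro divide_right_mono mult_left_mono) auto
    also have "a * (1 - 1/2 * (1 - g)) / k = a * (1 / k - 1/2 * ((1 - g) * (1 / k)))" for a g k :: real
      by (cases "k = 0") (simp_all add: field_simps)
    then have "adm_ind A p 1 * (1 - 1/2 * (1 - ?g p)) / real p = ?t p" .
    finally show ?thesis using False by simp
  qed
  have "(\<Sum>p\<in>primes_le z. adm_ind A p 1 * sqrt (hyper_ratio A H p 1) / real p) \<le> (\<Sum>p\<in>primes_le z. ?t p + ?b p)"
    using termwise primes_leD(1) by (intro sum_mono) blast
  also have "\<dots> = (\<Sum>p\<in>primes_le z. ?t p) + (\<Sum>p\<in>primes_le z. ?b p)" by (rule sum.distrib)
  also have "(\<Sum>p\<in>primes_le z. ?t p) \<le> (\<Sum>p\<in>primes_le x. ?t p)"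
    using primes_le_mono[OF zx] t0 primes_leD(1) by (intro sum_mono2) auto
  also have "\<dots> = (\<Sum>p\<in>admissible_primes A x. 1 / real p - 1/2 * ((1 - ?g p) * (1 / real p)))"
    by (rule sum_admissible_primes[symmetric])
  also have "\<dots> = sum_inv A x - 1/2 * sum_gain A x"
    by (simp only: sum_subtractf sum_distrib_left sum_inv_def sum_gain_def)
  also have "(\<Sum>p\<in>primes_le z. ?b p) = (\<Sum>p\<in>{p \<in> primes_le z. real p \<le> H}. 1/2 * (1 / real p))"
    by (rule sum.inter_filter[symmetric]) simp
  also have "\<dots> \<le> (\<Sum>p\<in>primes_le H. 1/2 * (1 / real p))"
  proof (rule sum_mono2)
    show "{p \<in> primes_le z. real p \<le> H} \<subseteq> primes_le H" by (auto simp: primes_le_def)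
  qed auto
  also have "\<dots> = 1/2 * (\<Sum>p\<in>primes_le H. 1 / real p)" by (rule sum_distrib_left[symmetric])
  finally show ?thesis by simp
qed

text \<open>The factorization q = q * 1 with c = 1 reduces the claim to a box mass and a volume that
  both lie in [0,1].\<close>

lemma disc_Delta_le_1:
  fixes A :: "nat \<Rightarrow> (int ^ 'n::finite) set"
  assumes q: "q > 0" "rho A q \<ge> 1"
  shows "disc (Delta A q) \<le> 1"
proof -
  have "\<bar>dil_mass A q 1 a l - (\<Prod>i\<in>UNIV. l $ i)\<bar> \<le> 1" if l: "\<And>i. 0 \<le> l $ i \<and> l $ i \<le> 1" for a l :: "real ^ 'n"
  proof -
    have "card {x \<in> crt_set A q. \<forall>i. frac (of_int (1 * x $ i) / real q - a $ i) \<le> l $ i} \<le> rho A q"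
      unfolding rho_def by (intro card_mono) auto
    then have "0 \<le> dil_mass A q 1 a l" "dil_mass A q 1 a l \<le> 1" by (auto simp: dil_mass_def divide_le_eq)
    moreover have "0 \<le> (\<Prod>i\<in>UNIV. l $ i)" "(\<Prod>i\<in>UNIV. l $ i) \<le> 1"
      using l by (auto intro!: prod_nonneg prod_le_1)
    ultimately show ?thesis by linarith
  qed
  then have "disc (Delta A (q * 1)) \<le> 1" using q by (intro disc_Delta_mult_le[where c = 1]) auto
  then show ?thesis by simp
qed

text \<open>All solutions s are congruent modulo r: if c s0 = 1 as well, then s = s (c s0) = (c s)
  s0 = s0.\<close>

lemma card_rough_inverse_class_le:
  fixes r Y :: nat and z :: real and c :: int
  assumes z: "z > 1" and r: "r > 0"
  shows "real (card {s \<in> {1..Y}. [c * int s = 1] (mod int r) \<and> (\<forall>p. prime p \<and> real p \<le> z \<longrightarrow> \<not> p dvd s)})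
    \<le> real Y / real r * (2 * radical_factor r / ln z) + z ^ 4"
proof (cases "\<exists>s0. [c * int s0 = 1] (mod int r)")
  case False
  then have e: "{s \<in> {1..Y}. [c * int s = 1] (mod int r) \<and> (\<forall>p. prime p \<and> real p \<le> z \<longrightarrow> \<not> p dvd s)} = {}" by blast
  have "0 \<le> real Y / real r * (2 * radical_factor r / ln z) + z ^ 4"
    using z radical_factor_ge_1[of r] by (intro add_nonneg_nonneg mult_nonneg_nonneg divide_nonneg_nonneg ln_ge_zero) auto
  then show ?thesis unfolding e by simp
next
  case True
  then obtain s0 where s0: "[c * int s0 = 1] (mod int r)" by blast
  have "[s = s0] (mod r)" if s: "[c * int s = 1] (mod int r)" for s
  proof -
    have "[int s * 1 = int s * (c * int s0)] (mod int r)" by (intro cong_mult cong_refl cong_sym[OF s0])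
    also have "int s * (c * int s0) = (c * int s) * int s0" by simp
    also have "[(c * int s) * int s0 = 1 * int s0] (mod int r)" by (intro cong_mult cong_refl s)
    finally show ?thesis by (simp add: cong_int_iff)
  qed
  then have "{s \<in> {1..Y}. [c * int s = 1] (mod int r) \<and> (\<forall>p. prime p \<and> real p \<le> z \<longrightarrow> \<not> p dvd s)}
     \<subseteq> {s \<in> {1..Y}. [s = s0] (mod r) \<and> (\<forall>p. prime p \<and> real p \<le> z \<longrightarrow> \<not> p dvd s)}" by blast
  then have "card {s \<in> {1..Y}. [c * int s = 1] (mod int r) \<and> (\<forall>p. prime p \<and> real p \<le> z \<longrightarrow> \<not> p dvd s)}
     \<le> card {s \<in> {1..Y}. [s = s0] (mod r) \<and> (\<forall>p. prime p \<and> real p \<le> z \<longrightarrow> \<not> p dvd s)}"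
    by (intro card_mono) auto
  then show ?thesis using card_rough_residue_class_le[OF z r, of Y s0] by linarith
qed

section \<open>Averaging over moduli with small smooth part\<close>

definition smooth_moduli :: "(nat \<Rightarrow> (int ^ 'n::finite) set) \<Rightarrow> real \<Rightarrow> real \<Rightarrow> nat set" where
  "smooth_moduli A z x = {r. r \<in> {1..nat \<lfloor>x\<rfloor>} \<and> prime_factors r \<subseteq> primes_le z \<and> rho A r \<ge> 1 \<and> real r \<le> x powr (1/4)}"

lemma finite_smooth_moduli: "finite (smooth_moduli A z x)"
  by (rule finite_subset[of _ "{1..nat \<lfloor>x\<rfloor>}"]) (auto simp: smooth_moduli_def)

text \<open>Each q becomes a triple (r, c, s), and its discrepancy is bounded by a quantity
  depending on r and c only. The number of s for given r and c has a bound independent of c, so the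
  sum over the inverses that occur is majorized by the sum over all residues c, where
  \<open>sum_dil_bound_le\<close> applies. Of s only the size and the absence of prime factors up to
  z are retained.\<close>

lemma sum_disc_small_smooth_part_le:
  fixes A :: "nat \<Rightarrow> (int ^ 'n::finite) set" and x z \<delta> :: real
  assumes z: "z > 1" "z ^ 5 \<le> sqrt x" and x: "x > 1" and \<delta>: "0 < \<delta>" "\<delta> \<le> 1"
  shows "(\<Sum>q\<in>{q \<in> moduli_upto A x. \<not> real (smooth_part z q) > x powr (1/4)}. disc (Delta A q)) \<le>
    (\<Sum>r\<in>smooth_moduli A z x. 3 * x / ln z * (radical_factor r / real r) * (real CARD('n) * (\<delta> + 1 / real r)
     + real CARD('n) * (4 * \<delta> * wconst \<delta> ^ CARD('n))
     + wconst \<delta> ^ CARD('n) * sqrt (mfun (hyper_ratio A (1 / \<delta>\<^sup>2)) r)))"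
proof -
  let ?Q = "{q \<in> moduli_upto A x. \<not> real (smooth_part z q) > x powr (1/4)}"
  let ?R = "smooth_moduli A z x"
  let ?Y = "\<lambda>r. nat \<lfloor>x / real r\<rfloor>"
  let ?S = "\<lambda>r c. {s \<in> {1..?Y r}. [c * int s = 1] (mod int r) \<and> (\<forall>p. prime p \<and> real p \<le> z \<longrightarrow> \<not> p dvd s)}"
  let ?K = "\<lambda>r. real CARD('n) * (\<delta> + 1 / real r) + real CARD('n) * (4 * \<delta> * wconst \<delta> ^ CARD('n))
     + wconst \<delta> ^ CARD('n) * sqrt (mfun (hyper_ratio A (1 / \<delta>\<^sup>2)) r)"
  have lz: "ln z > 0" using z by simp
  have R: "r > 0" "rho A r \<ge> 1" "real r \<le> x powr (1/4)" if "r \<in> ?R" for r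
    using that by (auto simp: smooth_moduli_def)
  have nn: "dil_bound A \<delta> r c \<ge> 0" if "r \<in> ?R" for r c
    using R[OF that] \<delta> by (intro dil_bound_nonneg)
  have "(\<Sum>q\<in>?Q. disc (Delta A q)) \<le> (\<Sum>(r, c, s)\<in>(SIGMA r:?R. SIGMA c:{0..<int r}. ?S r c). dil_bound A \<delta> r c)"
  proof (rule sum_le_included[where i = "\<lambda>(r, c, s). r * s"])
    have "moduli_upto A x \<subseteq> {..nat \<lfloor>x\<rfloor>}" by (auto simp: moduli_upto_def le_nat_floor)
    then show "finite ?Q" by (intro finite_subset[of ?Q "{..nat \<lfloor>x\<rfloor>}"]) auto
    show "finite (SIGMA r:?R. SIGMA c:{0..<int r}. ?S r c)"
      by (intro finite_SigmaI finite_smooth_moduli) auto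
    show "\<forall>y\<in>(SIGMA r:?R. SIGMA c:{0..<int r}. ?S r c). 0 \<le> (case y of (r, c, s) \<Rightarrow> dil_bound A \<delta> r c)"
      using nn by auto
    show "\<forall>q\<in>?Q. \<exists>y\<in>(SIGMA r:?R. SIGMA c:{0..<int r}. ?S r c).
        (case y of (r, c, s) \<Rightarrow> r * s) = q \<and> disc (Delta A q) \<le> (case y of (r, c, s) \<Rightarrow> dil_bound A \<delta> r c)"
    proof
      fix q assume q: "q \<in> ?Q"
      then have q0: "q > 0" "real q \<le> x" "rho A q \<ge> 1" "real (smooth_part z q) \<le> x powr (1/4)"
        by (auto simp: moduli_upto_def moduli_def)
      define r where "r = smooth_part z q"
      obtain s where s: "q = smooth_part z q * s" "smooth_part z q > 0" "s > 0" "coprime (smooth_part z q) s"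
        "prime_factors (smooth_part z q) \<subseteq> primes_le z" "\<And>p. prime p \<Longrightarrow> real p \<le> z \<Longrightarrow> \<not> p dvd s"
        by (rule smooth_part[OF q0(1), of z]) (rule that)
      note s = s[folded r_def]
      have "rho A r * rho A s = rho A q" using rho_mult[OF s(4,2,3), of A] s(1) by simp
      then have rho: "rho A r \<ge> 1" "rho A s \<ge> 1" using q0(3) by (auto intro!: Suc_leI gr0I)
      obtain c0 where c0: "[c0 * int s = 1] (mod int r)" using coprime_inverses_exist[OF s(4)] by blast
      define c where "c = c0 mod int r"
      have c: "[c * int s = 1] (mod int r)" "c \<in> {0..<int r}"
        using c0 s(2) by (auto simp: c_def cong_def mod_mult_left_eq)
      have "r \<le> q" using s(1,3) by (metis dvd_imp_le dvd_triv_left q0(1))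
      then have "r \<le> nat \<lfloor>x\<rfloor>" using q0(2) by (intro le_nat_floor) linarith
      then have rR: "r \<in> ?R" using s(2,5) rho(1) q0(4) by (simp add: smooth_moduli_def r_def[symmetric] Suc_le_eq)
      have "real r * real s \<le> x" using q0(2) s(1) by (metis of_nat_mult)
      then have "real s \<le> x / real r" using s(2) by (simp add: field_simps)
      then have "s \<le> ?Y r" by (rule le_nat_floor)
      then have sS: "s \<in> ?S r c" using c(1) s(3,6) by (simp add: Suc_le_eq)
      have "disc (Delta A (r * s)) \<le> dil_bound A \<delta> r c"
      proof (rule disc_Delta_mult_le[OF s(4,2,3) c(1) rho])
        fix a l :: "real ^ 'n" assume "\<And>i. 0 \<le> l $ i \<and> l $ i \<le> 1"
        then show "\<bar>dil_mass A r c a l - (\<Prod>i\<in>UNIV. l $ i)\<bar> \<le> dil_bound A \<delta> r c"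
          by (rule dil_mass_le_dil_bound[OF s(2) \<delta> rho(1)])
      qed
      then have "disc (Delta A q) \<le> dil_bound A \<delta> r c" using s(1) by simp
      then show "\<exists>y\<in>(SIGMA r:?R. SIGMA c:{0..<int r}. ?S r c).
        (case y of (r, c, s) \<Rightarrow> r * s) = q \<and> disc (Delta A q) \<le> (case y of (r, c, s) \<Rightarrow> dil_bound A \<delta> r c)"
        using rR c(2) sS s(1)[symmetric] by (intro bexI[of _ "(r, c, s)"]) auto
    qed
  qed
  also have "\<dots> = (\<Sum>r\<in>?R. \<Sum>(c, s)\<in>(SIGMA c:{0..<int r}. ?S r c). dil_bound A \<delta> r c)"
    by (subst sum.Sigma) (auto simp: finite_smooth_moduli split_def)
  also have "\<dots> = (\<Sum>r\<in>?R. \<Sum>c\<in>{0..<int r}. \<Sum>s\<in>?S r c. dil_bound A \<delta> r c)"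
    by (intro sum.cong refl sum.Sigma[symmetric]) auto
  also have "\<dots> \<le> (\<Sum>r\<in>?R. 3 * x / ln z * (radical_factor r / real r) * ?K r)"
  proof (rule sum_mono)
    fix r assume r: "r \<in> ?R"
    define M where "M = 3 * radical_factor r * x / ((real r)\<^sup>2 * ln z)"
    have r0: "real r > 0" using R(1)[OF r] by simp
    have card_le: "real (card (?S r c)) \<le> M" for c
    proof -
      have "real (card (?S r c)) \<le> real (?Y r) / real r * (2 * radical_factor r / ln z) + z ^ 4"
        by (rule card_rough_inverse_class_le[OF z(1) R(1)[OF r]])
      also have "\<dots> \<le> x / real r / real r * (2 * radical_factor r / ln z) + z ^ 4"
        using x r0 radical_factor_ge_1[of r] lz
        by (intro add_right_mono mult_right_mono divide_right_mono of_nat_floor divide_nonneg_nonneg) auto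
      \<comment> \<open>The sieve remainder is dominated by the main term: r \<le> x powr (1/4)
        gives r^2 \<le> sqrt x, and z^4 ln z \<le> z^5 \<le> sqrt x. This turns the sieve constant 2
        into 3.\<close>
      also have "z ^ 4 \<le> radical_factor r * x / ((real r)\<^sup>2 * ln z)"
      proof -
        have "(real r)\<^sup>2 \<le> (x powr (1/4))\<^sup>2" using R(3)[OF r] by (intro power_mono) auto
        also have "\<dots> = sqrt x" using x by (simp add: powr_power powr_half_sqrt[symmetric])
        finally have r2: "(real r)\<^sup>2 \<le> sqrt x" .
        have "z ^ 4 * ln z \<le> z ^ 4 * z" using z ln_le_minus_one[of z] by (intro mult_left_mono) auto
        also have "\<dots> \<le> sqrt x" using z(2) by (simp add: power_numeral_reduce mult_ac)
        finally have "(z ^ 4 * ln z) * (real r)\<^sup>2 \<le> sqrt x * sqrt x" using r2 x by (intro mult_mono) auto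
        also have "\<dots> = x" using x by simp
        also have "\<dots> \<le> radical_factor r * x" using radical_factor_ge_1[of r] x by (simp add: mult_le_cancel_right1)
        finally show ?thesis using r0 lz by (simp add: pos_le_divide_eq mult_ac)
      qed
      also have "x / real r / real r * (2 * radical_factor r / ln z) + radical_factor r * x / ((real r)\<^sup>2 * ln z) = M"
        using r0 lz unfolding M_def power2_eq_square by (simp add: field_simps)
      finally show ?thesis by simp
    qed
    have "(\<Sum>c\<in>{0..<int r}. \<Sum>s\<in>?S r c. dil_bound A \<delta> r c) = (\<Sum>c\<in>{0..<int r}. real (card (?S r c)) * dil_bound A \<delta> r c)"
      by simp
    also have "\<dots> \<le> (\<Sum>c\<in>{0..<int r}. M * dil_bound A \<delta> r c)"
      using card_le nn[OF r] by (intro sum_mono mult_right_mono)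
    also have "\<dots> = M * (\<Sum>c\<in>{0..<int r}. dil_bound A \<delta> r c)" by (simp only: sum_distrib_left)
    also have "\<dots> \<le> M * (real r * ?K r)"
    proof (rule mult_left_mono)
      show "(\<Sum>c\<in>{0..<int r}. dil_bound A \<delta> r c) \<le> real r * ?K r"
        using R[OF r] \<delta> by (intro sum_dil_bound_le)
      show "0 \<le> M" using card_le[of 0] by linarith
    qed
    also have "\<dots> = 3 * x / ln z * (radical_factor r / real r) * ?K r"
    proof -
      have "M * real r = 3 * x / ln z * (radical_factor r / real r)"
        using r0 lz unfolding M_def power2_eq_square by (simp add: field_simps)
      then show ?thesis by (simp only: mult.assoc[symmetric])
    qed
    finally show "(\<Sum>c\<in>{0..<int r}. \<Sum>s\<in>?S r c. dil_bound A \<delta> r c) \<le> 3 * x / ln z * (radical_factor r / real r) * ?K r" .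
  qed
  finally show ?thesis .
qed

lemma sum_smooth_moduli_le:
  fixes A :: "nat \<Rightarrow> (int ^ 'n::finite) set"
  assumes W: "\<And>p v. 0 \<le> W p v" "\<And>p v. prime p \<Longrightarrow> W p v \<le> 1"
    and w: "\<And>r. r \<in> smooth_moduli A z x \<Longrightarrow> w r = mfun W r"
  shows "(\<Sum>r\<in>smooth_moduli A z x. w r * radical_factor r / real r) \<le> exp ((\<Sum>p\<in>primes_le z. W p 1 / real p) + 6 * zeta_const)"
proof -
  have "(\<Sum>r\<in>smooth_moduli A z x. w r * radical_factor r / real r) = (\<Sum>r\<in>smooth_moduli A z x. mfun W r * radical_factor r / real r)"
    using w by (intro sum.cong) auto
  also have "\<dots> \<le> (\<Sum>r | r \<in> {1..nat \<lfloor>x\<rfloor>} \<and> prime_factors r \<subseteq> primes_le z. mfun W r * radical_factor r / real r)"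
  proof (rule sum_mono2)
    show "finite {r. r \<in> {1..nat \<lfloor>x\<rfloor>} \<and> prime_factors r \<subseteq> primes_le z}"
      by (rule finite_subset[of _ "{1..nat \<lfloor>x\<rfloor>}"]) auto
    show "smooth_moduli A z x \<subseteq> {r. r \<in> {1..nat \<lfloor>x\<rfloor>} \<and> prime_factors r \<subseteq> primes_le z}"
      unfolding smooth_moduli_def by blast
    fix r
    show "0 \<le> mfun W r * radical_factor r / real r"
      using mfun_nonneg[of W r] W(1) radical_factor_ge_1[of r] by simp
  qed
  also have "\<dots> \<le> exp ((\<Sum>p\<in>primes_le z. W p 1 / real p) + 6 * zeta_const)"
    using W by (rule sum_mfun_weighted_le)
  finally show ?thesis .
qed

text \<open>The summands belong to the moduli up to sqrt x, to the larger moduli with large smooth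
  part, and to those with small smooth part. There 48 = 3 * 16 combines the 3 of the sieve bound
  with K \<le> 16 (1 + S).\<close>

definition total_const :: "nat \<Rightarrow> real" where
  "total_const n = 2 + rankin_const + 48 * exp (7 * zeta_const) * (6 * real n + 8 * exp 3) * 7 ^ n"

text \<open>Three Euler products over r are needed, with weights 1, 1/r and the root of
  \<open>hyper_ratio\<close>. The first is of size exp E and is multiplied by \<delta>, the second
  is bounded, the third has size exp (E - S/2) up to powers of 1 + S. The choice \<delta> = exp (-
  S/2) makes the first match the third, and S \<le> E lets the second be absorbed.\<close>

lemma main_sum_le:
  fixes A :: "nat \<Rightarrow> (int ^ 'n::finite) set" and x z :: real
  defines "S \<equiv> sum_gain A x" and "E \<equiv> sum_inv A x"
  assumes z: "z > 1" "z \<le> x"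
  defines "\<delta> \<equiv> exp (- S / 2)"
  shows "(\<Sum>r\<in>smooth_moduli A z x. 3 * x / ln z * (radical_factor r / real r) * (real CARD('n) * (\<delta> + 1 / real r)
     + real CARD('n) * (4 * \<delta> * wconst \<delta> ^ CARD('n))
     + wconst \<delta> ^ CARD('n) * sqrt (mfun (hyper_ratio A (1 / \<delta>\<^sup>2)) r)))
    \<le> 3 * x / ln z * (exp (7 * zeta_const) * exp (E - S / 2) * ((6 * real CARD('n) + 8 * exp 3) * 7 ^ CARD('n) * (1 + S) ^ (CARD('n) + 3)))"
proof -
  let ?R = "smooth_moduli A z x" and ?n = "real CARD('n)" and ?H = "1 / \<delta>\<^sup>2"
  define L where "L = wconst \<delta> ^ CARD('n)"
  have S: "0 \<le> S" "S \<le> E" unfolding S_def E_def by (rule sum_gain_bounds)+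
  \<comment> \<open>The frequency cutoff is thus exp S, and \<open>wconst \<delta>\<close> is linear
    in S.\<close>
  have H: "?H = exp S" by (simp add: \<delta>_def exp_minus inverse_eq_divide power_divide flip: exp_double)
  have x0: "x > 0" "ln z > 0" using z by auto
  have L: "0 \<le> L" "L \<le> 7 ^ CARD('n) * (1 + S) ^ CARD('n)"
  proof -
    have w: "wconst \<delta> = 7 + 2 * S" unfolding wconst_def H by simp
    show "0 \<le> L" using S by (simp add: L_def w)
    have "L \<le> (7 * (1 + S)) ^ CARD('n)" unfolding L_def w using S by (intro power_mono) auto
    then show "L \<le> 7 ^ CARD('n) * (1 + S) ^ CARD('n)" by (simp only: power_mult_distrib)
  qed
  have r0: "r > 0" "rho A r \<ge> 1" if "r \<in> ?R" for r using that by (auto simp: smooth_moduli_def)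
  have a: "(\<Sum>r\<in>?R. 1 * radical_factor r / real r) \<le> exp (E + 7 * zeta_const)"
  proof -
    have "(\<Sum>r\<in>?R. 1 * radical_factor r / real r) \<le> exp ((\<Sum>p\<in>primes_le z. adm_ind A p 1 / real p) + 6 * zeta_const)"
    proof (rule sum_smooth_moduli_le)
      show "1 = mfun (adm_ind A) r" if "r \<in> ?R" for r using r0[OF that] by (simp add: mfun_adm_ind)
    qed (auto simp: adm_ind_def)
    also have "(\<Sum>p\<in>primes_le z. adm_ind A p 1 / real p) \<le> E"
    proof -
      have "(\<Sum>p\<in>primes_le z. adm_ind A p 1 / real p) \<le> (\<Sum>p\<in>primes_le x. adm_ind A p 1 / real p)"
        using primes_le_mono[OF z(2)] by (intro sum_mono2) (auto simp: adm_ind_def)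
      then show ?thesis by (simp add: E_def sum_inv_def sum_admissible_primes)
    qed
    then have "exp ((\<Sum>p\<in>primes_le z. adm_ind A p 1 / real p) + 6 * zeta_const) \<le> exp (E + 7 * zeta_const)"
      using zeta_const_nonneg by simp
    finally show ?thesis .
  qed
  have b: "(\<Sum>r\<in>?R. (1 / real r) * radical_factor r / real r) \<le> exp (7 * zeta_const)"
  proof -
    have "(\<Sum>r\<in>?R. (1 / real r) * radical_factor r / real r) \<le> exp ((\<Sum>p\<in>primes_le z. 1 / real (p ^ 1) / real p) + 6 * zeta_const)"
    proof (rule sum_smooth_moduli_le)
      show "1 / real r = mfun (\<lambda>p v. 1 / real (p ^ v)) r" if "r \<in> ?R" for r using mfun_inverse[OF r0(1)[OF that]] ..
      show "1 / real (p ^ v) \<le> 1" if "prime p" for p v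
        using prime_gt_0_nat[OF that] by (simp add: divide_le_eq)
    qed simp
    also have "(\<Sum>p\<in>primes_le z. 1 / real (p ^ 1) / real p) \<le> (\<Sum>p\<in>primes_le z. real p powr (-5/4))"
    proof (intro sum_mono)
      fix p assume "p \<in> primes_le z"
      then have p: "real p \<ge> 2" by (rule primes_leD)
      have "1 / real (p ^ 1) / real p = real p powr (-2)" using p by (simp add: powr_minus powr_numeral field_simps power2_eq_square)
      also have "\<dots> \<le> real p powr (-5/4)" using p by (intro powr_mono) auto
      finally show "1 / real (p ^ 1) / real p \<le> real p powr (-5/4)" .
    qed
    then have "exp ((\<Sum>p\<in>primes_le z. 1 / real (p ^ 1) / real p) + 6 * zeta_const) \<le> exp (7 * zeta_const)"
      using sum_le_zeta_const[of "primes_le z"] by (simp del: power_one_right)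
    finally show ?thesis .
  qed
  have c: "(\<Sum>r\<in>?R. sqrt (mfun (hyper_ratio A ?H) r) * radical_factor r / real r)
     \<le> exp (E - S / 2 + 7 * zeta_const) * (8 * exp 3 * (1 + S) ^ 3)"
  proof -
    have "(\<Sum>r\<in>?R. sqrt (mfun (hyper_ratio A ?H) r) * radical_factor r / real r)
       \<le> exp ((\<Sum>p\<in>primes_le z. adm_ind A p 1 * sqrt (hyper_ratio A ?H p 1) / real p) + 6 * zeta_const)"
    proof (rule sum_smooth_moduli_le[where W = "\<lambda>p v. adm_ind A p v * sqrt (hyper_ratio A ?H p v)"])
      show "sqrt (mfun (hyper_ratio A ?H) r) = mfun (\<lambda>p v. adm_ind A p v * sqrt (hyper_ratio A ?H p v)) r" if "r \<in> ?R" for r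
        using r0[OF that] unfolding mfun_distrib sqrt_mfun[symmetric] by (simp add: mfun_adm_ind)
      show "0 \<le> adm_ind A p v * sqrt (hyper_ratio A ?H p v)" for p v
        by (simp add: adm_ind_def hyper_ratio_nonneg)
      show "adm_ind A p v * sqrt (hyper_ratio A ?H p v) \<le> 1" if "prime p" for p v
      proof -
        have "hyper_ratio A ?H p v \<le> 1" using ratio_bounds(2)[OF that, of A] by (simp add: hyper_ratio_def)
        then show ?thesis by (simp add: adm_ind_def)
      qed
    qed
    also have "\<dots> \<le> exp (E - S / 2 + 1/2 * (\<Sum>p\<in>primes_le ?H. 1 / real p) + 7 * zeta_const)"
      using sum_sqrt_hyper_ratio_le[OF z(2), of ?H A] zeta_const_nonneg H
      unfolding S_def[symmetric] E_def[symmetric] by simp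
    also have "\<dots> = exp (E - S / 2 + 7 * zeta_const) * exp (1/2 * (\<Sum>p\<in>primes_le (exp S). 1 / real p))"
      unfolding H by (simp add: exp_add)
    also have "\<dots> \<le> exp (E - S / 2 + 7 * zeta_const) * (8 * exp 3 * (1 + S) ^ 3)"
      using S by (intro mult_left_mono exp_half_sum_small_primes) auto
    finally show ?thesis .
  qed
  define \<Phi> where "\<Phi> = exp (7 * zeta_const) * exp (E - S / 2)"
  have \<Phi>0: "\<Phi> > 0" by (simp add: \<Phi>_def)
  have \<Phi>a: "exp (E + 7 * zeta_const) * \<delta> = \<Phi>" by (simp add: \<Phi>_def \<delta>_def flip: exp_add)
  have \<Phi>b: "exp (7 * zeta_const) \<le> \<Phi>" using S by (simp add: \<Phi>_def)
  have \<Phi>c: "exp (E - S / 2 + 7 * zeta_const) = \<Phi>" by (simp add: \<Phi>_def flip: exp_add)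
  have "(\<Sum>r\<in>?R. 3 * x / ln z * (radical_factor r / real r) * (?n * (\<delta> + 1 / real r) + ?n * (4 * \<delta> * L) + L * sqrt (mfun (hyper_ratio A ?H) r)))
    = 3 * x / ln z * (?n * (1 + 4 * L) * ((\<Sum>r\<in>?R. 1 * radical_factor r / real r) * \<delta>)
       + ?n * (\<Sum>r\<in>?R. (1 / real r) * radical_factor r / real r)
       + L * (\<Sum>r\<in>?R. sqrt (mfun (hyper_ratio A ?H) r) * radical_factor r / real r))"
    unfolding distrib_left[of "3 * x / ln z"] sum_distrib_left sum_distrib_right sum.distrib[symmetric]
  proof (intro sum.cong refl)
    fix r
    show "3 * x / ln z * (radical_factor r / real r) * (?n * (\<delta> + 1 / real r) + ?n * (4 * \<delta> * L) + L * sqrt (mfun (hyper_ratio A ?H) r))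
      = 3 * x / ln z * (?n * (1 + 4 * L) * (1 * radical_factor r / real r * \<delta>))
       + 3 * x / ln z * (?n * ((1 / real r) * radical_factor r / real r))
       + 3 * x / ln z * (L * (sqrt (mfun (hyper_ratio A ?H) r) * radical_factor r / real r))"
      by (simp add: divide_inverse algebra_simps)
  qed
  also have "\<dots> \<le> 3 * x / ln z * (?n * (1 + 4 * L) * \<Phi> + ?n * \<Phi> + L * (\<Phi> * (8 * exp 3 * (1 + S) ^ 3)))"
  proof (intro mult_left_mono add_mono)
    show "(\<Sum>r\<in>?R. 1 * radical_factor r / real r) * \<delta> \<le> \<Phi>"
      unfolding \<Phi>a[symmetric] using a by (intro mult_right_mono) (auto simp: \<delta>_def)
    show "(\<Sum>r\<in>?R. (1 / real r) * radical_factor r / real r) \<le> \<Phi>" using b \<Phi>b by linarith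
    show "(\<Sum>r\<in>?R. sqrt (mfun (hyper_ratio A ?H) r) * radical_factor r / real r) \<le> \<Phi> * (8 * exp 3 * (1 + S) ^ 3)"
      using c unfolding \<Phi>c .
  qed (use L x0 in auto)
  also have "\<dots> \<le> 3 * x / ln z * (\<Phi> * ((6 * ?n + 8 * exp 3) * 7 ^ CARD('n) * (1 + S) ^ (CARD('n) + 3)))"
  proof (intro mult_left_mono)
    define B where "B = 7 ^ CARD('n) * (1 + S) ^ CARD('n)"
    have B1: "1 \<le> B" unfolding B_def using S mult_mono[of 1 "7 ^ CARD('n)" 1 "(1 + S) ^ CARD('n)"] by (simp add: one_le_power)
    have T1: "1 \<le> (1 + S) ^ 3" using S by (simp add: one_le_power)
    have "?n * (1 + 4 * L) + ?n + L * (8 * exp 3 * (1 + S) ^ 3) \<le> ?n * (1 + 4 * B) + ?n + B * (8 * exp 3 * (1 + S) ^ 3)"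
      using L S unfolding B_def[symmetric] by (intro add_mono mult_left_mono mult_right_mono) auto
    also have "?n * (1 + 4 * B) + ?n \<le> 6 * ?n * B"
    proof -
      have "?n * 1 \<le> ?n * B" using B1 by (intro mult_left_mono) auto
      then show ?thesis by (simp add: algebra_simps)
    qed
    also have "6 * ?n * B = 6 * ?n * B * 1" by simp
    also have "\<dots> \<le> 6 * ?n * B * (1 + S) ^ 3" using T1 B1 by (intro mult_left_mono) auto
    also have "6 * ?n * B * (1 + S) ^ 3 + B * (8 * exp 3 * (1 + S) ^ 3) = (6 * ?n + 8 * exp 3) * 7 ^ CARD('n) * (1 + S) ^ (CARD('n) + 3)"
      by (simp add: B_def power_add algebra_simps)
    finally have "\<Phi> * (?n * (1 + 4 * L) + ?n + L * (8 * exp 3 * (1 + S) ^ 3)) \<le> \<Phi> * ((6 * ?n + 8 * exp 3) * 7 ^ CARD('n) * (1 + S) ^ (CARD('n) + 3))"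
      using \<Phi>0 by (intro mult_left_mono) auto
    then show "?n * (1 + 4 * L) * \<Phi> + ?n * \<Phi> + L * (\<Phi> * (8 * exp 3 * (1 + S) ^ 3)) \<le> \<Phi> * ((6 * ?n + 8 * exp 3) * 7 ^ CARD('n) * (1 + S) ^ (CARD('n) + 3))"
      by (simp add: algebra_simps)
  qed (use x0 in auto)
  finally show ?thesis unfolding L_def \<Phi>_def by simp
qed

text \<open>The exponent n + 4 of 1 + S collects n from the Fourier weights, 3 from the primes below
  the frequency cutoff and 1 from 1 / ln z = K / ln x.\<close>

lemma sum_disc_le:
  fixes A :: "nat \<Rightarrow> (int ^ 'n::finite) set" and x :: real
  defines "S \<equiv> sum_gain A x" and "E \<equiv> sum_inv A x"
  assumes x: "x > 1" "64 + 16 * S \<le> ln x"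
  shows "(\<Sum>q\<in>moduli_upto A x. disc (Delta A q)) \<le>
    total_const CARD('n) * (x / ln x * exp (E - S / 2) * (1 + S) ^ (CARD('n) + 4))"
proof -
  have S: "0 \<le> S" "S \<le> E" unfolding S_def E_def by (rule sum_gain_bounds)+
  \<comment> \<open>The slope 4 gives exp (- K/4) \<le> exp (- S/2) for large smooth parts, and K
    \<ge> 16 gives z^5 \<le> sqrt x. The assumption on x reads 4 K \<le> ln x, that is ln z \<ge>
    4.\<close>
  define K where "K = 16 + 4 * S"
  define z where "z = x powr (1 / K)"
  define \<delta> where "\<delta> = exp (- S / 2)"
  define \<Phi> where "\<Phi> = x / ln x * exp (E - S / 2) * (1 + S) ^ (CARD('n) + 4)"
  have K: "K \<ge> 16" using S by (simp add: K_def)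
  have lx: "ln x > 0" using x by simp
  have lz: "ln z = ln x / K" using x by (simp add: z_def ln_powr)
  have lz4: "ln z \<ge> 4" unfolding lz using x(2) K by (simp add: K_def field_simps)
  have z0: "z > 0" using x by (simp add: z_def)
  have "ln z > 0" using lz4 by linarith
  then have z1: "z > 1" using z0 by simp
  have zx: "z \<le> x"
  proof -
    have "x powr (1 / K) \<le> x powr 1" using x K by (intro powr_mono) (auto simp: divide_le_eq)
    then show ?thesis using x by (simp add: z_def)
  qed
  have z5: "z ^ 5 \<le> sqrt x"
  proof -
    have "z ^ 5 = x powr (5 / K)" using x by (simp add: z_def powr_power)
    also have "\<dots> \<le> x powr (1 / 2)" using x K by (intro powr_mono) (auto simp: field_simps)
    also have "\<dots> = sqrt x" using x by (simp add: powr_half_sqrt)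
    finally show ?thesis .
  qed
  have \<delta>: "0 < \<delta>" "\<delta> \<le> 1" using S by (auto simp: \<delta>_def)
  have P1: "1 \<le> (1 + S) ^ (CARD('n) + 4)" using S by (simp add: one_le_power)
  have X0: "x / ln x > 0" using x lx by simp
  have base: "x / ln x * exp (E - S / 2) \<le> \<Phi>"
  proof -
    have "0 \<le> x / ln x * exp (E - S / 2)" using X0 by (intro mult_nonneg_nonneg) auto
    from mult_left_mono[OF P1 this] show ?thesis unfolding \<Phi>_def by (simp only: mult_1_right)
  qed
  let ?B = "{q \<in> moduli_upto A x. real (smooth_part z q) > x powr (1/4)}"
  let ?G = "{q \<in> moduli_upto A x. \<not> real (smooth_part z q) > x powr (1/4)}"
  have "moduli_upto A x \<subseteq> {..nat \<lfloor>x\<rfloor>}" by (auto simp: moduli_upto_def le_nat_floor)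
  then have fin: "finite (moduli_upto A x)" by (rule finite_subset) simp
  have "(\<Sum>q\<in>moduli_upto A x. disc (Delta A q)) = (\<Sum>q\<in>?B \<union> ?G. disc (Delta A q))"
    by (intro sum.cong) auto
  also have "\<dots> = (\<Sum>q\<in>?B. disc (Delta A q)) + (\<Sum>q\<in>?G. disc (Delta A q))"
    using fin by (intro sum.union_disjoint) auto
  also have "(\<Sum>q\<in>?B. disc (Delta A q)) \<le> (\<Sum>q\<in>?B. 1)"
    by (intro sum_mono disc_Delta_le_1) (auto simp: moduli_upto_def moduli_def)
  also have "(\<Sum>q\<in>?B. 1) = real (card ?B)" by simp
  also have "\<dots> \<le> sqrt x + rankin_const * (x / ln x) * exp (- ln x / (4 * ln z)) * exp E"
    unfolding E_def sum_inv_def by (rule card_large_smooth_part_le[OF lz4 z0 x(1)])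
  also have "sqrt x \<le> 2 * \<Phi>"
  proof -
    have "ln x = 2 * ln (sqrt x)" using x by (simp add: ln_sqrt)
    also have "\<dots> \<le> 2 * sqrt x" using ln_le_minus_one[of "sqrt x"] x by simp
    finally have "sqrt x * ln x \<le> sqrt x * (2 * sqrt x)" using x by (intro mult_left_mono) auto
    also have "\<dots> = 2 * x" using x by simp
    finally have "sqrt x \<le> 2 * (x / ln x)" using lx by (simp add: field_simps)
    also have "\<dots> \<le> 2 * (x / ln x * exp (E - S / 2))"
    proof -
      have "1 \<le> exp (E - S / 2)" using S by simp
      then have "x / ln x * 1 \<le> x / ln x * exp (E - S / 2)" using X0 by (intro mult_left_mono) auto
      then show ?thesis by simp
    qed
    finally show ?thesis using base by linarith
  qed
  also have "rankin_const * (x / ln x) * exp (- ln x / (4 * ln z)) * exp E \<le> rankin_const * \<Phi>"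
  proof -
    have "- ln x / (4 * ln z) = - K / 4" unfolding lz using lx K by (simp add: field_simps)
    also have "\<dots> \<le> - S / 2" using S by (simp add: K_def)
    finally have "exp (- ln x / (4 * ln z)) * exp E \<le> exp (- S / 2) * exp E" by (intro mult_right_mono) auto
    also have "\<dots> = exp (E - S / 2)" by (simp flip: exp_add)
    finally have "x / ln x * (exp (- ln x / (4 * ln z)) * exp E) \<le> x / ln x * exp (E - S / 2)"
      using X0 by (intro mult_left_mono) auto
    also note base
    finally have "rankin_const * (x / ln x * (exp (- ln x / (4 * ln z)) * exp E)) \<le> rankin_const * \<Phi>"
      using rankin_const_pos by (intro mult_left_mono) auto
    then show ?thesis by (simp only: mult.assoc)
  qed
  also have "(\<Sum>q\<in>?G. disc (Delta A q)) \<le> 48 * exp (7 * zeta_const) * (6 * real CARD('n) + 8 * exp 3) * 7 ^ CARD('n) * \<Phi>"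
  proof -
    define c where "c = exp (7 * zeta_const) * exp (E - S / 2) * ((6 * real CARD('n) + 8 * exp 3) * 7 ^ CARD('n) * (1 + S) ^ (CARD('n) + 3))"
    have c0: "c \<ge> 0" using S by (simp add: c_def)
    have "(\<Sum>q\<in>?G. disc (Delta A q)) \<le> 3 * x / ln z * c"
      unfolding c_def S_def E_def
      by (rule order_trans[OF sum_disc_small_smooth_part_le[OF z1 z5 x(1) \<delta>] main_sum_le[OF z1 zx, of A, folded S_def, folded \<delta>_def, unfolded S_def]])
    also have "3 * x / ln z = 3 * K * (x / ln x)" unfolding lz by simp
    also have "3 * K * (x / ln x) * c \<le> 48 * (1 + S) * (x / ln x) * c"
      using c0 X0 S by (intro mult_right_mono) (auto simp: K_def)
    also have "\<dots> = 48 * exp (7 * zeta_const) * (6 * real CARD('n) + 8 * exp 3) * 7 ^ CARD('n) * \<Phi>"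
    proof -
      have "(1 + S) ^ (CARD('n) + 4) = (1 + S) * (1 + S) ^ (CARD('n) + 3)" by (simp add: numeral_eq_Suc)
      then show ?thesis unfolding c_def \<Phi>_def by (simp only: mult_ac)
    qed
    finally show ?thesis .
  qed
  finally have "(\<Sum>q\<in>moduli_upto A x. disc (Delta A q)) \<le> 2 * \<Phi> + rankin_const * \<Phi> +
     48 * exp (7 * zeta_const) * (6 * real CARD('n) + 8 * exp 3) * 7 ^ CARD('n) * \<Phi>" by linarith
  also have "\<dots> = total_const CARD('n) * \<Phi>" by (simp only: total_const_def distrib_right)
  finally show ?thesis unfolding \<Phi>_def .
qed

text \<open>Raise 1 + t \<le> exp t with t = S / (6k) to the k-th power. The exponent 1/6 = 1/2 -
  1/3 is the part of the saving that is spent on the powers of 1 + S.\<close>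

lemma power_le_exp:
  fixes S :: real
  assumes "S \<ge> 0" "k > 0"
  shows "(1 + S) ^ k \<le> (6 * real k) ^ k * exp (S / 6)"
proof -
  have "1 + S \<le> 6 * real k * (1 + S / (6 * real k))" using assms by (simp add: distrib_left)
  also have "\<dots> \<le> 6 * real k * exp (S / (6 * real k))"
    by (intro mult_left_mono exp_ge_add_one_self) auto
  finally have "(1 + S) ^ k \<le> (6 * real k * exp (S / (6 * real k))) ^ k"
    using assms by (intro power_mono) auto
  also have "\<dots> = (6 * real k) ^ k * exp (S / 6)"
    using assms by (simp add: power_mult_distrib flip: exp_of_nat_mult)
  finally show ?thesis .
qed

theorem theorem1p2:
  shows "\<exists>C::real. \<forall>(\<alpha>::real) (x0::real). \<alpha> > 0 \<and> x0 \<ge> 2 \<longrightarrow>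
    (\<exists>X::real. \<forall>A :: nat \<Rightarrow> (int ^ 'n::finite) set.
       prime_power_family A \<longrightarrow>
       (\<forall>y\<ge>x0. (\<Sum>p\<in>admissible_primes A y. ln (real p)) \<ge> \<alpha> * y) \<longrightarrow>
       (\<forall>x\<ge>X.
          (1 / real (card (moduli_upto A x))) * (\<Sum>q\<in>moduli_upto A x. disc (Delta A q))
          \<le> C / \<alpha> * exp (- (1/3) *
              (\<Sum>p\<in>admissible_primes A x.
                 (1 - real (max_hyperplane A p) / real (rho A p)) * (1 / real p)))))"
proof -
  define k where "k = CARD('n) + 4"
  define C where "C = total_const CARD('n) * (6 * real k) ^ k / lower_const"
  have "\<exists>X. \<forall>A :: nat \<Rightarrow> (int ^ 'n) set. prime_power_family A \<longrightarrow>
       (\<forall>y\<ge>x0. (\<Sum>p\<in>admissible_primes A y. ln (real p)) \<ge> \<alpha> * y) \<longrightarrow>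
       (\<forall>x\<ge>X. (1 / real (card (moduli_upto A x))) * (\<Sum>q\<in>moduli_upto A x. disc (Delta A q))
          \<le> C / \<alpha> * exp (- (1/3) * sum_gain A x))"
    if \<alpha>: "\<alpha> > 0" and x0: "x0 \<ge> 2" for \<alpha> x0 :: real
  proof -
    \<comment> \<open>The bound of \<open>sum_inv_le_ln_ln\<close> replaces S here, so the threshold
      can be fixed before the family A is chosen.\<close>
    have "eventually (\<lambda>x::real. 64 + 16 * (5 + 6 * ln (ln x / ln 2)) \<le> ln x \<and> ln x \<le> \<alpha> * sqrt x \<and> x \<ge> x0\<^sup>2 \<and> x \<ge> 2) at_top"
      using \<alpha> by (intro eventually_conj eventually_ge_at_top) real_asymp+
    then obtain X where X: "\<And>x. x \<ge> X \<Longrightarrow> 64 + 16 * (5 + 6 * ln (ln x / ln 2)) \<le> ln x \<and> ln x \<le> \<alpha> * sqrt x \<and> x \<ge> x0\<^sup>2 \<and> x \<ge> 2"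
      by (auto simp: eventually_at_top_linorder)
    show ?thesis
    proof (intro exI[of _ X] allI impI)
      fix A :: "nat \<Rightarrow> (int ^ 'n) set" and x :: real
      assume dens: "\<forall>y\<ge>x0. (\<Sum>p\<in>admissible_primes A y. ln (real p)) \<ge> \<alpha> * y" and x: "x \<ge> X"
      note Xx = X[OF x]
      define S where "S = sum_gain A x"
      define E where "E = sum_inv A x"
      have S: "0 \<le> S" "S \<le> E" unfolding S_def E_def by (rule sum_gain_bounds)+
      have x2: "x \<ge> 2" "x > 1" using Xx by auto
      have lx: "ln x > 0" using x2 by simp
      have up: "(\<Sum>q\<in>moduli_upto A x. disc (Delta A q)) \<le> total_const CARD('n) * (x / ln x * exp (E - S / 2) * (1 + S) ^ (CARD('n) + 4))"
        unfolding S_def E_def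
      proof (rule sum_disc_le[OF x2(2)])
        define t where "t = ln (ln x / ln 2)"
        have g: "sum_gain A x \<le> 5 + 6 * t"
          unfolding t_def by (rule order_trans[OF sum_gain_bounds(2) sum_inv_le_ln_ln[OF x2(1)]])
        have "64 + 16 * sum_gain A x \<le> 64 + 16 * (5 + 6 * t)"
          by (intro add_left_mono mult_left_mono g) simp
        also have "\<dots> \<le> ln x" unfolding t_def using Xx by blast
        finally show "64 + 16 * sum_gain A x \<le> ln x" .
      qed
      define \<P> where "\<P> = {p. prime p \<and> rho A p \<ge> 1}"
      have adm: "\<P> \<inter> primes_le y = admissible_primes A y" for y
        by (auto simp: \<P>_def admissible_primes_def primes_le_def)
      \<comment> \<open>Products of distinct admissible primes are moduli regardless of the sets at
        higher prime powers, and they alone suffice for the lower bound.\<close>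
      have "real (card {q \<in> moduli A. q \<ge> 1 \<and> real q \<le> x}) * ln x \<ge>
        lower_const * \<alpha> * x * exp (\<Sum>p\<in>\<P> \<inter> primes_le x. 1 / real p)"
      proof (rule card_ge_exp_sum_inverse)
        show "\<Prod>U \<in> moduli A" if "finite U" "U \<subseteq> \<P>" for U
        proof -
          have "prime p \<and> rho A p \<ge> 1" if "p \<in> U" for p using that \<open>U \<subseteq> \<P>\<close> by (auto simp: \<P>_def)
          then have "rho A (\<Prod>U) \<ge> 1" "\<Prod>U > 0"
            using \<open>finite U\<close> by (intro rho_prod_primes_pos prod_set_primes_pos; blast)+
          then show ?thesis by (simp add: moduli_def Suc_le_eq)
        qed
        show "(\<Sum>p\<in>\<P> \<inter> primes_le y. ln (real p)) \<ge> \<alpha> * y" if "y \<ge> x0" for y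
          unfolding adm using dens that by blast
        show "x0 \<le> sqrt x" using Xx x0 by (intro real_le_rsqrt) auto
      qed (use Xx x2 \<alpha> in \<open>auto simp: \<P>_def\<close>)
      also have "{q \<in> moduli A. q \<ge> 1 \<and> real q \<le> x} = moduli_upto A x"
        by (auto simp: moduli_upto_def moduli_def)
      finally have low: "lower_const * \<alpha> * x * exp E \<le> real (card (moduli_upto A x)) * ln x"
        unfolding adm E_def sum_inv_def .
      define N where "N = real (card (moduli_upto A x))"
      have lowpos: "lower_const * \<alpha> * x * exp E > 0" using lower_const_pos \<alpha> x2 by simp
      then have "N * ln x > 0" using low by (simp add: N_def)
      then have N0: "N > 0" using lx by (simp add: zero_less_mult_iff)
      have T0: "total_const CARD('n) > 0"
        unfolding total_const_def using rankin_const_pos by (intro add_pos_nonneg) auto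
      have "(1 + S) ^ k \<le> (6 * real k) ^ k * exp (S / 6)" using S by (intro power_le_exp) (auto simp: k_def)
      then have "x / ln x * exp (E - S / 2) * (1 + S) ^ k \<le> x / ln x * exp (E - S / 2) * ((6 * real k) ^ k * exp (S / 6))"
        using x2 lx by (intro mult_left_mono) auto
      also have "\<dots> = (6 * real k) ^ k * exp (- (1/3) * S) * (x * exp E / ln x)"
      proof -
        have "exp (E - S / 2) * exp (S / 6) = exp (- (1/3) * S) * exp E" by (simp flip: exp_add)
        then show ?thesis by (simp add: mult_ac)
      qed
      \<comment> \<open>The common factor x exp E / ln x is exchanged for the number of moduli; this
        is where 1/\<alpha> enters.\<close>
      also have "\<dots> \<le> (6 * real k) ^ k * exp (- (1/3) * S) * (N / (lower_const * \<alpha>))"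
        using low lower_const_pos \<alpha> lx by (intro mult_left_mono) (auto simp: N_def field_simps)
      finally have "total_const CARD('n) * (x / ln x * exp (E - S / 2) * (1 + S) ^ k)
        \<le> total_const CARD('n) * ((6 * real k) ^ k * exp (- (1/3) * S) * (N / (lower_const * \<alpha>)))"
        using T0 by (intro mult_left_mono) auto
      also have "\<dots> = N * (C / \<alpha> * exp (- (1/3) * S))"
        by (simp add: C_def)
      finally have "(\<Sum>q\<in>moduli_upto A x. disc (Delta A q)) \<le> N * (C / \<alpha> * exp (- (1/3) * S))"
        using up unfolding k_def by linarith
      then have "1 / N * (\<Sum>q\<in>moduli_upto A x. disc (Delta A q)) \<le> 1 / N * (N * (C / \<alpha> * exp (- (1/3) * S)))"
        using N0 by (intro mult_left_mono) auto
      then show "1 / real (card (moduli_upto A x)) * (\<Sum>q\<in>moduli_upto A x. disc (Delta A q)) \<le> C / \<alpha> * exp (- (1/3) * sum_gain A x)"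
        using N0 by (simp add: N_def S_def)
    qed
  qed
  then show ?thesis unfolding sum_gain_def by blast
qed

end
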